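(* Let $L$ be a Banach function space such that $L$ and its Banach dual $L^*$ have order continuous norms, and let $A_1,A_2,\ldots,A_m$ be positive kernel operators on $L$. If $P_j=A_j\cdots A_mA_1\cdots A_{j-1}$ for $j=1,\ldots,m$ (so that $P_1=A_1A_2\cdots A_m$), then $$\rho_{ess}\left(A_1^{\left(\frac1m\right)}\circ A_2^{\left(\frac1m\right)}\circ\cdots\circ A_m^{\left(\frac1m\right)}\right)\le\rho_{ess}\left(P_1^{\left(\frac1m\right)}\circ P_2^{\left(\frac1m\right)}\circ\cdots\circ P_m^{\left(\frac1m\right)}\right)^{\frac1m}\le\rho_{ess}(A_1A_2\cdots A_m)^{\frac1m}.$$
   Context: Let $\mu$ be a $\sigma$-finite positive measure on a $\sigma$-algebra of subsets of a non-void set $X$, and let $M(X,\mu)$ be the vector space of equivalence classes (modulo a.e. equality) of complex measurable functions on $X$. A Banach space $L\subseteq M(X,\mu)$ is a Banach function space if $f\in L$, $g\in M(X,\mu)$ and $|g|\le |f|$ imply $g\in L$ and $\|g\|\le\|f\|$. It is assumed throughout that $X$ is the carrier of $L$: there is no subset $Y\subseteq X$ of strictly positive measure such that $f=0$ a.e. on $Y$ for all $f\in L$. A norm is order continuous if $0\le f_n\downarrow 0$ implies $\|f_n\|\to 0$. A (linear) operator $A$ on $L$ is positive if it maps nonnegative functions to nonnegative ones (positive operators are automatically bounded). $A$ is a kernel operator if there is a $\mu\times\mu$-measurable function $a(x,y)$ on $X\times X$ such that for all $f\in L$ and almost all $x\in X$, $\int_X|a(x,y)f(y)|\,d\mu(y)<\infty$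 and $(Af)(x)=\int_X a(x,y)f(y)\,d\mu(y)$; such an $A$ is positive iff $a\ge 0$ a.e. If $A_1,\dots,A_m$ are positive kernel operators on $L$ with kernels $a_1,\dots,a_m$ and $\alpha_1,\dots,\alpha_m>0$ with $\sum_j\alpha_j=1$, then the Hadamard weighted geometric mean $A_1^{(\alpha_1)}\circ\cdots\circ A_m^{(\alpha_m)}$ is the positive kernel operator on $L$ with kernel $a_1(x,y)^{\alpha_1}\cdots a_m(x,y)^{\alpha_m}$ (it is defined on all of $L$). $\rho_{ess}(A)$ denotes the essential spectral radius of $A$, i.e. the spectral radius of the image of $A$ in the Calkin algebra. *)

theory Defs
  imports "HOL-Analysis.Analysis" "HOL-Algebra.QuotRing"
begin

class complex_banach = banach +
  fixes scaleC :: "complex \<Rightarrow> 'a \<Rightarrow> 'a"  (infixr \<open>*\<^sub>C\<close> 75)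
  assumes scaleC_add_right: "c *\<^sub>C (x + y) = c *\<^sub>C x + c *\<^sub>C y"
    and scaleC_add_left: "(c + d) *\<^sub>C x = c *\<^sub>C x + d *\<^sub>C x"
    and scaleC_scaleC: "c *\<^sub>C d *\<^sub>C x = (c * d) *\<^sub>C x"
    and scaleC_of_real: "complex_of_real r *\<^sub>C x = r *\<^sub>R x"
    and norm_scaleC: "norm (c *\<^sub>C x) = cmod c * norm x"

lemma vector_space_scaleC: "vector_space (scaleC :: complex \<Rightarrow> 'l \<Rightarrow> 'l::complex_banach)"
  using scaleC_of_real[of 1]
  by unfold_locales (auto simp: scaleC_add_right scaleC_add_left scaleC_scaleC)

abbreviation clinear :: "('l::complex_banach \<Rightarrow> 'l) \<Rightarrow> bool"
  where "clinear \<equiv> Vector_Spaces.linear scaleC scaleC"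

definition bounded_ops :: "('l::complex_banach \<Rightarrow> 'l) set"
  where "bounded_ops = {T. clinear T \<and> bounded_linear T}"

definition compact_ops :: "('l::complex_banach \<Rightarrow> 'l) set"
  where "compact_ops = {T \<in> bounded_ops. compact (closure (T ` cball 0 1))}"

definition bounded_op_ring :: "('l::complex_banach \<Rightarrow> 'l) ring"
  where "bounded_op_ring =
    \<lparr>carrier = bounded_ops, mult = (\<circ>), one = id, zero = (\<lambda>_. 0), add = (\<lambda>S T f. S f + T f)\<rparr>"

definition calkin_algebra :: "('l::complex_banach \<Rightarrow> 'l) set ring"
  where "calkin_algebra = bounded_op_ring Quot compact_ops"

definition calkin_class :: "('l::complex_banach \<Rightarrow> 'l) \<Rightarrow> ('l \<Rightarrow> 'l) set"
  where "calkin_class T = compact_ops +>\<^bsub>bounded_op_ring\<^esub> T"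

definition essential_spectrum :: "('l::complex_banach \<Rightarrow> 'l) \<Rightarrow> complex set"
  where "essential_spectrum T =
    {c. calkin_class (\<lambda>f. c *\<^sub>C f - T f) \<notin> Units calkin_algebra}"

text \<open>The essential spectrum of a bounded operator is empty exactly when the space has finite
  dimension, i.e. when the Calkin algebra is the zero algebra.  Inserting \<open>0\<close> sets the essential
  spectral radius to \<open>0\<close> in that case and changes nothing otherwise.\<close>

definition essential_spectral_radius :: "('l::complex_banach \<Rightarrow> 'l) \<Rightarrow> real"
  where "essential_spectral_radius T = Sup (insert 0 (cmod ` essential_spectrum T))"

text \<open>The elements of the type \<open>'l\<close> are the elements of the space, that is, classes of complex
  measurable functions modulo equality almost everywhere.  The map \<open>rep\<close> chooses a
  representative of each class, so it is linear and injective only modulo null sets, and it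
  identifies \<open>'l\<close> with a subspace of the space of all classes of measurable functions.
  The last assumption says that the whole underlying set is the carrier of the space.\<close>

locale banach_function_space = sigma_finite_measure M
  for M :: "'a measure" +
  fixes rep :: "'l::complex_banach \<Rightarrow> 'a \<Rightarrow> complex"
  assumes space_nonempty: "space M \<noteq> {}"
    and rep_measurable: "rep f \<in> borel_measurable M"
    and rep_add: "AE x in M. rep (f + g) x = rep f x + rep g x"
    and rep_scaleC: "AE x in M. rep (c *\<^sub>C f) x = c * rep f x"
    and rep_inject: "(AE x in M. rep f x = rep g x) \<Longrightarrow> f = g"
    and solid: "\<lbrakk>u \<in> borel_measurable M; AE x in M. cmod (u x) \<le> cmod (rep f x)\<rbrakk>
      \<Longrightarrow> \<exists>g. (AE x in M. rep g x = u x) \<and> norm g \<le> norm f"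
    and carrier_UNIV: "\<lbrakk>Y \<in> sets M; emeasure M Y > 0\<rbrakk>
      \<Longrightarrow> \<exists>f. \<not> (AE x in M. x \<in> Y \<longrightarrow> rep f x = 0)"

definition positive_cone :: "'a measure \<Rightarrow> ('l \<Rightarrow> 'a \<Rightarrow> complex) \<Rightarrow> 'l::complex_banach set"
  where "positive_cone M rep = {f. AE x in M. rep f x \<in> \<real>\<^sub>\<ge>\<^sub>0}"

text \<open>The Banach dual consists of the complex linear members of the type of all bounded real
  linear maps into \<open>complex\<close>, with the same operator norm.  Below is its positive cone.\<close>

definition dual_cone :: "'l::complex_banach set \<Rightarrow> ('l \<Rightarrow>\<^sub>L complex) set"
  where "dual_cone P =
    {\<phi>. Vector_Spaces.linear scaleC (*) (blinfun_apply \<phi>) \<and>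
        (\<forall>f\<in>P. blinfun_apply \<phi> f \<in> \<real>\<^sub>\<ge>\<^sub>0)}"

text \<open>The order is the one induced by the cone \<open>P\<close>: \<open>u \<le> v\<close> iff \<open>v - u \<in> P\<close>.
  The last premise says that \<open>0\<close> is the greatest lower bound of the sequence.  Every lower bound
  of a sequence in \<open>P\<close> lies in \<open>P - P\<close>; so for the dual cone, the bounds that are considered
  are automatically complex linear.\<close>

definition order_continuous_norm :: "'v::real_normed_vector set \<Rightarrow> bool"
  where "order_continuous_norm P \<longleftrightarrow>
    (\<forall>f::nat \<Rightarrow> 'v.
      (\<forall>n. f n \<in> P) \<longrightarrow> (\<forall>n. f n - f (Suc n) \<in> P) \<longrightarrow>
      (\<forall>g. (\<forall>n. f n - g \<in> P) \<longrightarrow> - g \<in> P) \<longrightarrow>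
      (\<lambda>n. norm (f n)) \<longlonglongrightarrow> 0)"

definition has_kernel ::
  "'a measure \<Rightarrow> ('l \<Rightarrow> 'a \<Rightarrow> complex) \<Rightarrow> ('l \<Rightarrow> 'l::complex_banach) \<Rightarrow> ('a \<times> 'a \<Rightarrow> complex) \<Rightarrow> bool"
  where "has_kernel M rep A a \<longleftrightarrow>
    a \<in> borel_measurable (M \<Otimes>\<^sub>M M) \<and>
    (\<forall>f. AE x in M. integrable M (\<lambda>y. a (x, y) * rep f y) \<and>
      rep (A f) x = (\<integral>y. a (x, y) * rep f y \<partial>M))"

definition positive_kernel_operator ::
  "'a measure \<Rightarrow> ('l \<Rightarrow> 'a \<Rightarrow> complex) \<Rightarrow> ('l \<Rightarrow> 'l::complex_banach) \<Rightarrow> bool"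
  where "positive_kernel_operator M rep A \<longleftrightarrow>
    clinear A \<and> A ` positive_cone M rep \<subseteq> positive_cone M rep \<and> (\<exists>a. has_kernel M rep A a)"

text \<open>In a Banach function space an operator and its kernel determine each other up to null sets,
  hence the description below does not depend on the kernels \<open>a j\<close>.\<close>

definition hadamard_mean ::
  "'a measure \<Rightarrow> ('l \<Rightarrow> 'a \<Rightarrow> complex) \<Rightarrow> 'i set \<Rightarrow> ('i \<Rightarrow> real) \<Rightarrow>
    ('i \<Rightarrow> 'l \<Rightarrow> 'l) \<Rightarrow> 'l \<Rightarrow> 'l::complex_banach"
  where "hadamard_mean M rep J \<alpha> A =
    (THE H. \<exists>a :: 'i \<Rightarrow> 'a \<times> 'a \<Rightarrow> real.
      (\<forall>j\<in>J. has_kernel M rep (A j) (\<lambda>z. complex_of_real (a j z)) \<and>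
        (AE z in M \<Otimes>\<^sub>M M. 0 \<le> a j z)) \<and>
      has_kernel M rep H (\<lambda>z. complex_of_real (\<Prod>j\<in>J. a j z powr \<alpha> j)))"

definition op_product :: "('i \<Rightarrow> 'l \<Rightarrow> 'l) \<Rightarrow> 'i list \<Rightarrow> 'l \<Rightarrow> 'l"
  where "op_product A js = foldr (\<circ>) (map A js) id"

end

theory Submission
  imports Defs
begin

text \<open>Call a positive operator \<open>T\<close> semicompact up to \<open>d\<close> if it maps the positive part of the unit ball
  below \<open>u + h\<close>, with \<open>u \<ge> 0\<close> fixed and \<open>h\<close> positive of norm at most \<open>d\<close> (de Pagter and Schep).  This notion is
  monotone in \<open>T\<close>, and it passes from \<open>A\<^sub>1, \<dots>, A\<^sub>m\<close> to their arithmetic mean, hence, by the inequality of the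
  means, to their Hadamard geometric mean.  It also describes the essential spectral radius of a
  positive kernel operator \<open>T\<close>, through the growth of \<open>T ^ n\<close>.  In one direction, the ball measure of
  noncompactness bounds semicompactness, and Rickart's proof of the spectral radius formula bounds the
  ball measures of the powers of \<open>T\<close>.  In the other direction, kernel operators map order intervals to
  precompact sets when the norm is order continuous, so that semicompactness of \<open>T\<close> bounds the ball measures of
  the powers of \<open>T\<close>, and Riesz theory makes \<open>c - T\<close> invertible modulo the compact operators.

  With these facts the theorem reduces to order inequalities.  By Hoelder, the product of two Hadamard means is below
  the Hadamard mean of the products.  So the \<open>m\<close>-th power of the mean of the \<open>A\<^sub>j\<close>, with the factors of the successive
  means shifted cyclically, is below the mean of the \<open>P\<^sub>j\<close>, and the \<open>n\<close>-th power of the latter is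
  below the mean of the \<open>P\<^sub>j ^ n\<close>.  Finally \<open>P\<^sub>j = X Y\<close> and \<open>P\<^sub>1 = Y X\<close> give \<open>P\<^sub>j ^ (n + 1) = X P\<^sub>1 ^ n Y\<close>.\<close>

section \<open>Riesz theory and the ball measure of noncompactness\<close>

text \<open>The ball measure is not monotone for the order of positive operators: an operator below
  a compact one need not be compact. Semicompactness is monotone, but a semicompact kernel operator
  is controlled only after one more application of the operator. Such losses are harmless because a
  radius sees only the exponential rate of the powers: a spare factor, the 4 that comes from the
  separation 1/2 in Riesz's lemma, and the norms of the outer factors after a rotation all disappear
  in the limit. A second obstacle is that inverses modulo compact operators are chosen point by
  point, with no analytic dependence on \<open>c\<close>. Averages over roots of unity need only
  finite sums and the resolvent identity, so the argument runs with a seminorm and congruences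
  modulo its null ideal. A third is that the sigma-algebra need not be countably generated: null
  sets that depend on a test set cannot be united over all test sets. Positivity of kernels is
  therefore tested on sets that involve only countably many test sets each.\<close>

definition finitely_covered :: "'a::metric_space set \<Rightarrow> real \<Rightarrow> bool"
  where "finitely_covered S r \<longleftrightarrow> (\<exists>F. finite F \<and> S \<subseteq> (\<Union>x\<in>F. cball x r))"

lemma finitely_covered_mono:
  "finitely_covered T r \<Longrightarrow> S \<subseteq> T \<Longrightarrow> r \<le> r' \<Longrightarrow> finitely_covered S r'"
  unfolding finitely_covered_def by (meson SUP_mono order_trans subset_cball)

lemma finitely_covered_plus:
  fixes S T U :: "'a::real_normed_vector set"
  assumes "finitely_covered S r" "finitely_covered T s"
    and "\<And>z. z \<in> U \<Longrightarrow> \<exists>x\<in>S. \<exists>y\<in>T. z = x + y"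
  shows "finitely_covered U (r + s)"
proof -
  obtain F G where F: "finite F" "S \<subseteq> (\<Union>x\<in>F. cball x r)" and G: "finite G" "T \<subseteq> (\<Union>x\<in>G. cball x s)"
    using assms(1,2) unfolding finitely_covered_def by blast
  have "U \<subseteq> (\<Union>x\<in>(\<lambda>(a, b). a + b) ` (F \<times> G). cball x (r + s))"
  proof
    fix z assume "z \<in> U"
    then obtain x y where xy: "x \<in> S" "y \<in> T" "z = x + y" using assms(3) by blast
    obtain a b where ab: "a \<in> F" "dist a x \<le> r" "b \<in> G" "dist b y \<le> s" using F G xy by fastforce
    have "dist (a + b) z \<le> r + s"
      using dist_triangle_add[of a b x y] ab(2,4) unfolding xy(3) by linarith
    with ab show "z \<in> (\<Union>x\<in>(\<lambda>(a, b). a + b) ` (F \<times> G). cball x (r + s))"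
      by (auto intro!: bexI[of _ "(a, b)"])
  qed
  then show ?thesis
    unfolding finitely_covered_def using F(1) G(1) by (meson finite_SigmaI finite_imageI)
qed

text \<open>A point of \<open>S\<close> within \<open>r\<close> of a centre \<open>a\<close> has the
  form \<open>a + r b\<close> with \<open>b\<close> in the unit ball, and \<open>T b\<close> lies
  within \<open>s\<close> of some centre \<open>g\<close>. The points \<open>T a + r g\<close> are
  then centres for the radius \<open>r * s\<close>. Submultiplicativity of the ball measure is the
  case where \<open>S\<close> is itself the image of a ball.\<close>

lemma finitely_covered_image:
  fixes T :: "'a::real_normed_vector \<Rightarrow> 'b::real_normed_vector"
  assumes T: "linear T" and S: "finitely_covered S r" and B: "finitely_covered (T ` cball 0 1) s" and "0 \<le> r"
  shows "finitely_covered (T ` S) (r * s)"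
proof -
  obtain F G where F: "finite F" "S \<subseteq> (\<Union>x\<in>F. cball x r)"
    and G: "finite G" "T ` cball 0 1 \<subseteq> (\<Union>x\<in>G. cball x s)"
    using S B unfolding finitely_covered_def by blast
  have "T ` S \<subseteq> (\<Union>x\<in>(\<lambda>(a, b). T a + r *\<^sub>R b) ` (F \<times> G). cball x (r * s))"
  proof
    fix z assume "z \<in> T ` S"
    then obtain x where x: "x \<in> S" "z = T x" by auto
    obtain a where a: "a \<in> F" "norm (x - a) \<le> r" using F x by (force simp: dist_norm norm_minus_commute)
    \<comment> \<open>For \<open>r = 0\<close> division by zero gives \<open>b = 0\<close>, which is
      right because then \<open>x = a\<close>.\<close>
    define b where "b = (x - a) /\<^sub>R r"
    have nb: "norm b \<le> 1" using a(2) \<open>0 \<le> r\<close> by (cases "r = 0") (auto simp: b_def divide_inverse_commute[symmetric])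
    have xb: "x = a + r *\<^sub>R b" using a(2) by (cases "r = 0") (auto simp: b_def)
    obtain g where g: "g \<in> G" "norm (T b - g) \<le> s" using G nb by (force simp: dist_norm norm_minus_commute)
    have "dist (T a + r *\<^sub>R g) z = r * norm (T b - g)"
      unfolding x(2) by (subst xb) (simp add: linear_add[OF T] linear_scale[OF T] dist_norm
          scaleR_diff_right[symmetric] norm_minus_commute \<open>0 \<le> r\<close>)
    then have "dist (T a + r *\<^sub>R g) z \<le> r * s" using g(2) \<open>0 \<le> r\<close> by (simp add: mult_left_mono)
    with a g show "z \<in> (\<Union>x\<in>(\<lambda>(a, b). T a + r *\<^sub>R b) ` (F \<times> G). cball x (r * s))"
      by (auto intro!: bexI[of _ "(a, g)"])
  qed
  then show ?thesis
    unfolding finitely_covered_def using F(1) G(1) by (meson finite_SigmaI finite_imageI)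
qed

lemma compact_closure_iff_finitely_covered:
  fixes S :: "'a::complete_space set"
  shows "compact (closure S) \<longleftrightarrow> (\<forall>e>0. finitely_covered S e)"
proof
  assume "compact (closure S)"
  then show "\<forall>e>0. finitely_covered S e"
    unfolding compact_eq_totally_bounded finitely_covered_def
    by (meson SUP_mono ball_subset_cball closure_subset order_trans)
next
  assume *: "\<forall>e>0. finitely_covered S e"
  show "compact (closure S)"
    unfolding compact_eq_totally_bounded
  proof (intro conjI allI impI)
    show "complete (closure S)" by (simp add: complete_eq_closed)
    fix e :: real assume "e > 0"
    then obtain F where F: "finite F" "S \<subseteq> (\<Union>x\<in>F. cball x (e/2))"
      using * unfolding finitely_covered_def by (meson half_gt_zero)
    \<comment> \<open>A finite union of closed balls is closed, so it also contains the closure; the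
      halved radius leaves room for open balls.\<close>
    have "closure S \<subseteq> (\<Union>x\<in>F. cball x (e/2))"
      using F by (intro closure_minimal closed_UN) auto
    also have "\<dots> \<subseteq> (\<Union>x\<in>F. ball x e)" using \<open>e > 0\<close> by (intro UN_mono) auto
    finally show "\<exists>k. finite k \<and> closure S \<subseteq> (\<Union>x\<in>k. ball x e)" using F(1) by blast
  qed
qed

lemma finitely_covered_subseq:
  fixes S :: "'a::complete_space set"
  assumes "\<forall>e>0. finitely_covered S e" "\<And>n. x n \<in> S"
  obtains r l where "strict_mono (r::nat \<Rightarrow> nat)" "(x \<circ> r) \<longlonglongrightarrow> l"
proof -
  have "compact (closure S)" using assms(1) by (simp add: compact_closure_iff_finitely_covered)
  moreover have "\<forall>n. x n \<in> closure S" using assms(2) closure_subset by blast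
  ultimately show ?thesis using that unfolding compact_def by blast
qed

lemma finitely_covered_convergent:
  assumes "convergent (x :: nat \<Rightarrow> 'a::metric_space)" "e > 0"
  shows "finitely_covered (range x) e"
proof -
  obtain l where "x \<longlonglongrightarrow> l" using assms(1) by (auto simp: convergent_def)
  then obtain N where N: "\<And>n. n \<ge> N \<Longrightarrow> dist (x n) l < e" using assms(2) by (meson metric_LIMSEQ_D)
  have "range x \<subseteq> (\<Union>z\<in>insert l (x ` {..<N}). cball z e)"
  proof
    fix z assume "z \<in> range x"
    then obtain n where n: "z = x n" by auto
    show "z \<in> (\<Union>z\<in>insert l (x ` {..<N}). cball z e)"
      using N[of n] n assms(2) by (cases "n < N") (auto simp: dist_commute less_imp_le not_less intro!: bexI[of _ n])
  qed
  then show ?thesis unfolding finitely_covered_def by (meson finite_imageI finite_insert finite_lessThan)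
qed

section \<open>The ball measure of noncompactness\<close>

definition noncompactness :: "('a::real_normed_vector \<Rightarrow> 'b::real_normed_vector) \<Rightarrow> real"
  where "noncompactness T = Inf {r. 0 \<le> r \<and> finitely_covered (T ` cball 0 1) r}"

lemma finitely_covered_onorm:
  assumes "bounded_linear T" shows "finitely_covered (T ` cball 0 1) (onorm T)"
proof -
  have "norm (T x) \<le> onorm T" if "norm x \<le> 1" for x
    using onorm[OF assms, of x] onorm_pos_le[OF assms] that mult_left_le[of "norm x" "onorm T"] by linarith
  then show ?thesis
    unfolding finitely_covered_def by (intro exI[of _ "{0}"]) auto
qed

text \<open>The infimum need not be attained, so upper bounds are tested with an arbitrary slack
  \<open>e\<close>; the converse \<open>finitely_covered_noncompactness\<close> carries the same
  slack.\<close>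

lemma noncompactness_le:
  assumes "\<And>e. e > 0 \<Longrightarrow> finitely_covered (T ` cball 0 1) (r + e)" "0 \<le> r"
  shows "noncompactness T \<le> r"
proof (rule field_le_epsilon)
  fix e :: real assume "e > 0"
  then show "noncompactness T \<le> r + e"
    unfolding noncompactness_def using assms by (intro cInf_lower bdd_belowI[of _ 0]) auto
qed

lemma
  assumes "bounded_linear T"
  shows noncompactness_nonneg: "0 \<le> noncompactness T"
    and finitely_covered_noncompactness:
      "e > 0 \<Longrightarrow> finitely_covered (T ` cball 0 1) (noncompactness T + e)"
    and noncompactness_le_onorm: "noncompactness T \<le> onorm T"
proof -
  let ?A = "{r. 0 \<le> r \<and> finitely_covered (T ` cball 0 1) r}"
  have ne: "onorm T \<in> ?A"
    using finitely_covered_onorm[OF assms] onorm_pos_le[OF assms] by auto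
  then show "0 \<le> noncompactness T"
    unfolding noncompactness_def by (intro cInf_greatest) auto
  show "noncompactness T \<le> onorm T"
    using ne unfolding noncompactness_def by (intro cInf_lower bdd_belowI[of _ 0]) auto
  assume "e > 0"
  then obtain r where "r \<in> ?A" "r < noncompactness T + e"
    using cInf_lessD[of ?A "noncompactness T + e"] ne unfolding noncompactness_def by auto
  then show "finitely_covered (T ` cball 0 1) (noncompactness T + e)"
    by (auto intro: finitely_covered_mono)
qed

lemma noncompactness_add:
  assumes "bounded_linear S" "bounded_linear T"
  shows "noncompactness (\<lambda>x. S x + T x) \<le> noncompactness S + noncompactness T"
proof (rule noncompactness_le)
  fix e :: real assume "e > 0"
  have "finitely_covered ((\<lambda>x. S x + T x) ` cball 0 1) ((noncompactness S + e/2) + (noncompactness T + e/2))"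
    by (rule finitely_covered_plus[OF finitely_covered_noncompactness[OF assms(1)]
          finitely_covered_noncompactness[OF assms(2)]]) (use \<open>e > 0\<close> in auto)
  then show "finitely_covered ((\<lambda>x. S x + T x) ` cball 0 1) (noncompactness S + noncompactness T + e)"
    by (simp add: algebra_simps)
qed (simp add: add_nonneg_nonneg assms noncompactness_nonneg)

lemma noncompactness_compose:
  assumes S: "bounded_linear S" and T: "bounded_linear T"
  shows "noncompactness (S \<circ> T) \<le> noncompactness S * noncompactness T"
proof (rule noncompactness_le)
  fix e :: real assume e: "e > 0"
  define a b where "a = noncompactness S" and "b = noncompactness T"
  have ab: "a \<ge> 0" "b \<ge> 0" using noncompactness_nonneg S T by (auto simp: a_def b_def)
  \<comment> \<open>The product \<open>(b + d) * (a + d)\<close> exceeds \<open>a * b\<close> by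
    \<open>d * (a + b) + d * d\<close>, and \<open>d <= 1\<close> bounds this by
    \<open>d * (a + b + 1)\<close>.\<close>
  define d where "d = min 1 (e / (a + b + 1))"
  have d: "d > 0" "d \<le> 1" using e ab by (auto simp: d_def)
  have "d \<le> e / (a + b + 1)" by (simp add: d_def)
  with ab have d3: "d * (a + b + 1) \<le> e" by (subst (asm) pos_le_divide_eq) auto
  have "finitely_covered (S ` T ` cball 0 1) ((b + d) * (a + d))"
    using finitely_covered_image[OF bounded_linear.linear[OF S] finitely_covered_noncompactness[OF T d(1)]
       finitely_covered_noncompactness[OF S d(1)]] ab d(1) by (simp add: a_def b_def)
  moreover have "d * d \<le> d" using d by (simp add: mult_left_le)
  then have "(b + d) * (a + d) \<le> a * b + e" using d3 by (simp add: algebra_simps)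
  ultimately show "finitely_covered ((S \<circ> T) ` cball 0 1) (noncompactness S * noncompactness T + e)"
    unfolding image_comp a_def b_def by (rule finitely_covered_mono[OF _ order_refl])
qed (simp add: assms noncompactness_nonneg)

lemma noncompactness_scale:
  assumes S: "bounded_linear S" and T: "bounded_linear T"
  shows "noncompactness (S \<circ> T) \<le> onorm S * noncompactness T"
  using noncompactness_compose[OF S T] noncompactness_le_onorm[OF S] noncompactness_nonneg[OF T]
  by (meson mult_right_mono order_trans)

lemma noncompactness_eq_0_iff:
  fixes T :: "'a::real_normed_vector \<Rightarrow> 'b::banach"
  assumes "bounded_linear T"
  shows "noncompactness T = 0 \<longleftrightarrow> compact (closure (T ` cball 0 1))"
proof
  assume "noncompactness T = 0"
  then show "compact (closure (T ` cball 0 1))"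
    using finitely_covered_noncompactness[OF assms]
    by (auto simp: compact_closure_iff_finitely_covered)
next
  assume "compact (closure (T ` cball 0 1))"
  then have "noncompactness T \<le> 0"
    by (intro noncompactness_le) (auto simp: compact_closure_iff_finitely_covered)
  then show "noncompactness T = 0" using noncompactness_nonneg[OF assms] by simp
qed

section \<open>Operators that are proper on bounded sets\<close>

text \<open>For a bounded operator between Banach spaces this is a sequential form of being upper
  semi-Fredholm, that is, of having a finite-dimensional kernel and a closed range. In this form it
  passes to compositions, and no dimension has to be counted.\<close>

definition proper_on_bounded :: "('a::real_normed_vector \<Rightarrow> 'b::real_normed_vector) \<Rightarrow> bool"
  where "proper_on_bounded D \<longleftrightarrow> (\<forall>x::nat \<Rightarrow> 'a. bounded (range x) \<longrightarrow> convergent (\<lambda>n. D (x n)) \<longrightarrow>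
    (\<exists>r l. strict_mono (r::nat \<Rightarrow> nat) \<and> (x \<circ> r) \<longlonglongrightarrow> l))"

lemma proper_on_boundedE:
  assumes "proper_on_bounded D" "bounded (range x)" "convergent (\<lambda>n. D (x n))"
  obtains r l where "strict_mono (r::nat \<Rightarrow> nat)" "(\<lambda>n. x (r n)) \<longlonglongrightarrow> l"
  using assms unfolding proper_on_bounded_def comp_def by blast

text \<open>Since \<open>x n = S (x n) + (x n - S (x n))\<close> and the second sequence converges,
  a cover of the sequence by balls of radius \<open>s\<close> yields one of radius
  \<open>s * r + e\<close>. As \<open>r < 1\<close>, iteration shrinks the radius to zero, and the
  sequence is precompact.\<close>

lemma proper_on_bounded_id_minus:
  fixes S :: "'a::banach \<Rightarrow> 'a"
  assumes S: "bounded_linear S" and cov: "finitely_covered (S ` cball 0 1) r" and r: "0 \<le> r" "r < 1"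
  shows "proper_on_bounded (\<lambda>x. x - S x)"
  unfolding proper_on_bounded_def
proof (intro allI impI)
  fix x :: "nat \<Rightarrow> 'a"
  assume bdd: "bounded (range x)" and conv: "convergent (\<lambda>n. x n - S (x n))"
  have step: "finitely_covered (range x) (s * r + e)" if "finitely_covered (range x) s" "s \<ge> 0" "e > 0" for s e
    by (rule finitely_covered_plus[OF finitely_covered_image[OF bounded_linear.linear[OF S] that(1) cov that(2)]
          finitely_covered_convergent[OF conv that(3)]])
      (auto simp: algebra_simps)
  obtain C where C: "C > 0" "\<And>n. norm (x n) \<le> C" using bdd by (metis bounded_pos rangeI)
  have cov_pow: "finitely_covered (range x) (C * ((1 + r)/2) ^ n)" for n
  proof (induction n)
    case 0
    show ?case unfolding finitely_covered_def by (rule exI[of _ "{0}"]) (use C in auto)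
  next
    case (Suc n)
    \<comment> \<open>For the old radius \<open>s\<close>, the slack \<open>s * ((1 - r)/2)\<close>
      turns the factor \<open>r\<close> into \<open>(1 + r)/2\<close>, still below 1.\<close>
    have "finitely_covered (range x) (C * ((1 + r)/2) ^ n * r + C * ((1 + r)/2) ^ n * ((1 - r)/2))"
      using Suc C r by (intro step) auto
    moreover have "C * ((1 + r)/2) ^ n * r + C * ((1 + r)/2) ^ n * ((1 - r)/2) = C * ((1 + r)/2) ^ Suc n"
      by (simp add: field_simps)
    ultimately show ?case by (simp only:)
  qed
  have "\<forall>e>0. finitely_covered (range x) e"
  proof (intro allI impI)
    fix e :: real assume "e > 0"
    have "(\<lambda>n. C * ((1 + r)/2) ^ n) \<longlonglongrightarrow> C * 0" using r by (intro tendsto_intros) auto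
    then have "eventually (\<lambda>n. C * ((1 + r)/2) ^ n < e) sequentially"
      using \<open>e > 0\<close> by (intro order_tendstoD) auto
    then obtain n where "C * ((1 + r)/2) ^ n < e" by (auto simp: eventually_sequentially)
    then show "finitely_covered (range x) e"
      using cov_pow[of n] by (auto intro: finitely_covered_mono)
  qed
  then show "\<exists>r l. strict_mono (r::nat \<Rightarrow> nat) \<and> (x \<circ> r) \<longlonglongrightarrow> l"
    by (rule finitely_covered_subseq) auto
qed

lemma proper_on_bounded_compose:
  assumes D: "proper_on_bounded D" and E: "proper_on_bounded E" and lin: "bounded_linear E"
  shows "proper_on_bounded (D \<circ> E)"
  unfolding proper_on_bounded_def
proof (intro allI impI)
  fix x :: "nat \<Rightarrow> _"
  assume bdd: "bounded (range x)" and conv: "convergent (\<lambda>n. (D \<circ> E) (x n))"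
  have "bounded (range (\<lambda>n. E (x n)))"
    using bounded_linear_image[OF bdd lin] by (simp add: image_image)
  then obtain r l where r: "strict_mono (r::nat \<Rightarrow> nat)" "(\<lambda>n. E (x (r n))) \<longlonglongrightarrow> l"
    using proper_on_boundedE[OF D, of "\<lambda>n. E (x n)"] conv by auto
  have "bounded (range (\<lambda>n. x (r n)))" using bdd by (rule bounded_subset) auto
  then obtain r' l' where "strict_mono (r'::nat \<Rightarrow> nat)" "(\<lambda>n. x (r (r' n))) \<longlonglongrightarrow> l'"
    using proper_on_boundedE[OF E, of "\<lambda>n. x (r n)"] r(2) by (auto simp: convergent_def)
  then show "\<exists>r l. strict_mono (r::nat \<Rightarrow> nat) \<and> (x \<circ> r) \<longlonglongrightarrow> l"
    using strict_mono_compose[OF r(1)] by (intro exI[of _ "r \<circ> r'"] exI[of _ l']) (auto simp: comp_def)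
qed

text \<open>A nearest point need not exist. A point closer than twice the distance serves instead,
  and this factor 2 becomes the 1/2 in Riesz's lemma.\<close>

lemma near_subspace_point:
  fixes N :: "'a::real_normed_vector set"
  assumes "subspace N" "closed N"
  obtains y where "y \<in> N" "\<And>z. z \<in> N \<Longrightarrow> norm (x - y) \<le> 2 * norm (x - y - z)"
proof (cases "x \<in> N")
  case True
  with that[of x] show ?thesis by simp
next
  case False
  have ne: "N \<noteq> {}" using subspace_0[OF assms(1)] by auto
  have pos: "infdist x N > 0"
    using False ne assms(2) by (metis in_closed_iff_infdist_zero infdist_nonneg less_eq_real_def)
  then obtain y where y: "y \<in> N" "dist x y < 2 * infdist x N"
    using cInf_lessD[of "dist x ` N" "2 * infdist x N"] ne by (auto simp: infdist_def)
  show ?thesis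
  proof (rule that[OF y(1)])
    fix z assume "z \<in> N"
    then have "infdist x N \<le> dist x (y + z)"
      using y(1) assms(1) by (intro infdist_le subspace_add)
    then show "norm (x - y) \<le> 2 * norm (x - y - z)"
      using y(2) by (simp add: dist_norm algebra_simps)
  qed
qed

lemma riesz_lemma:
  fixes Y Z :: "'a::real_normed_vector set"
  assumes "subspace Y" "closed Y" "subspace Z" "Y \<subseteq> Z" "z \<in> Z" "z \<notin> Y"
  obtains x where "x \<in> Z" "norm x = 1" "\<And>y. y \<in> Y \<Longrightarrow> 1/2 \<le> norm (x - y)"
proof -
  obtain y where y: "y \<in> Y" "\<And>w. w \<in> Y \<Longrightarrow> norm (z - y) \<le> 2 * norm (z - y - w)"
    using near_subspace_point[OF assms(1,2), of z] by blast
  have pos: "norm (z - y) > 0" using y(1) assms(6) by auto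
  define x where "x = (z - y) /\<^sub>R norm (z - y)"
  show ?thesis
  proof (rule that[of x])
    show "x \<in> Z" unfolding x_def using y(1) assms by (intro subspace_scale subspace_diff) auto
    show "norm x = 1" using pos by (simp add: x_def)
    fix w assume "w \<in> Y"
    then have "norm (z - y) \<le> 2 * norm (z - y - norm (z - y) *\<^sub>R w)"
      using assms(1) by (intro y(2) subspace_scale)
    also have "z - y - norm (z - y) *\<^sub>R w = norm (z - y) *\<^sub>R (x - w)"
      using pos by (simp add: x_def scaleR_diff_right)
    finally show "1/2 \<le> norm (x - w)" using pos by simp
  qed
qed

lemma closed_kernel: "bounded_linear E \<Longrightarrow> closed {x. E x = 0}"
  by (intro closed_Collect_eq linear_continuous_on continuous_intros)

text \<open>If no constant works, there are unit vectors at distance at least 1/2 from the kernel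
  whose images tend to 0. Properness gives a limit point, which lies in the kernel: a contradiction.
  The passage to another preimage \<open>y\<close> of \<open>E x\<close> replaces the norm of the
  quotient by the kernel.\<close>

lemma proper_lower_bound:
  fixes E :: "'a::real_normed_vector \<Rightarrow> 'b::real_normed_vector"
  assumes E: "bounded_linear E" and pr: "proper_on_bounded E"
  obtains C :: real where "\<And>x. \<exists>y. E y = E x \<and> norm y \<le> C * norm (E x)"
proof (rule ccontr)
  assume contra: "\<not> thesis"
  interpret E: bounded_linear E by fact
  let ?N = "{x. E x = 0}"
  have N: "subspace ?N" "closed ?N" using closed_kernel[OF E] linear_subspace_kernel E.linear_axioms by auto
  have "\<exists>y. norm y = 1 \<and> norm (E y) \<le> 1 / real (Suc n) \<and> (\<forall>z\<in>?N. 1/2 \<le> norm (y - z))" for n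
  proof -
    have "\<not> (\<forall>x. \<exists>y. E y = E x \<and> norm y \<le> real (Suc n) * norm (E x))"
      using contra that by blast
    then obtain x where x: "\<And>y. E y = E x \<Longrightarrow> norm y > real (Suc n) * norm (E x)"
      by (meson not_le)
    obtain y where y: "E y = 0" "\<And>z. z \<in> ?N \<Longrightarrow> norm (x - y) \<le> 2 * norm (x - y - z)"
      using near_subspace_point[OF N, of x] by auto
    have b: "norm (x - y) > real (Suc n) * norm (E x)" using x[of "x - y"] y(1) by (simp add: E.diff)
    then have pos: "norm (x - y) > 0" by (meson le_less_trans mult_nonneg_nonneg norm_ge_zero of_nat_0_le_iff)
    define w where "w = (x - y) /\<^sub>R norm (x - y)"
    have "norm (E w) = norm (E x) / norm (x - y)"
      using y(1) by (simp add: w_def E.scaleR E.diff divide_inverse_commute)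
    also have "\<dots> \<le> 1 / real (Suc n)" using b pos by (simp add: field_simps)
    finally have "norm (E w) \<le> 1 / real (Suc n)" .
    moreover have "1/2 \<le> norm (w - z)" if "z \<in> ?N" for z
    proof -
      have "norm (x - y) \<le> 2 * norm (x - y - norm (x - y) *\<^sub>R z)"
        using that N(1) by (intro y(2) subspace_scale)
      also have "x - y - norm (x - y) *\<^sub>R z = norm (x - y) *\<^sub>R (w - z)"
        using pos by (simp add: w_def scaleR_diff_right)
      finally show ?thesis using pos by simp
    qed
    moreover have "norm w = 1" using pos by (simp add: w_def)
    ultimately show ?thesis by blast
  qed
  then have "\<forall>n. \<exists>y. norm y = 1 \<and> norm (E y) \<le> 1 / real (Suc n) \<and> (\<forall>z\<in>?N. 1/2 \<le> norm (y - z))"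
    by blast
  from choice[OF this] obtain y where "\<forall>n. norm (y n) = 1 \<and> norm (E (y n)) \<le> 1 / real (Suc n) \<and>
      (\<forall>z\<in>?N. 1/2 \<le> norm (y n - z))" by blast
  then have y: "\<And>n. norm (y n) = 1" "\<And>n. norm (E (y n)) \<le> 1 / real (Suc n)"
      "\<And>n z. E z = 0 \<Longrightarrow> 1/2 \<le> norm (y n - z)" by auto
  have lim: "(\<lambda>n. E (y n)) \<longlonglongrightarrow> 0"
    by (rule Lim_null_comparison[OF always_eventually LIMSEQ_inverse_real_of_nat])
      (use y(2) in \<open>auto simp: divide_inverse\<close>)
  have "bounded (range y)" using y(1) by (intro boundedI[of _ 1]) auto
  then obtain r l where r: "strict_mono (r::nat \<Rightarrow> nat)" "(\<lambda>n. y (r n)) \<longlonglongrightarrow> l"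
    using proper_on_boundedE[OF pr] lim by (metis convergentI)
  have "(\<lambda>n. E (y (r n))) \<longlonglongrightarrow> E l" using r(2) by (rule E.tendsto)
  moreover have "(\<lambda>n. E (y (r n))) \<longlonglongrightarrow> 0" using LIMSEQ_subseq_LIMSEQ[OF lim r(1)] by (simp add: comp_def)
  ultimately have "E l = 0" using LIMSEQ_unique by blast
  then have "1/2 \<le> norm (y (r n) - l)" for n using y(3) by blast
  moreover have "(\<lambda>n. norm (y (r n) - l)) \<longlonglongrightarrow> 0" using r(2) by (simp add: LIM_zero_iff tendsto_norm_zero)
  ultimately have "1/2 \<le> (0::real)" by (intro LIMSEQ_le_const[of "\<lambda>n. norm (y (r n) - l)"]) auto
  then show False by simp
qed

text \<open>By \<open>proper_lower_bound\<close> a convergent sequence in the range has bounded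
  preimages, and properness makes a subsequence of these converge.\<close>

lemma closed_range_proper:
  assumes E: "bounded_linear E" and pr: "proper_on_bounded E"
  shows "closed (range E)"
  unfolding closed_sequential_limits
proof (intro allI impI, elim conjE)
  fix w l assume w: "\<forall>n. w n \<in> range E" and l: "w \<longlonglongrightarrow> l"
  obtain C where C: "\<And>x. \<exists>y. E y = E x \<and> norm y \<le> C * norm (E x)" using proper_lower_bound[OF E pr] by blast
  have "\<forall>n. \<exists>y. E y = w n \<and> norm y \<le> C * norm (w n)" using w C by (metis imageE)
  then obtain y where y: "\<And>n. E (y n) = w n" "\<And>n. norm (y n) \<le> C * norm (w n)" by metis
  obtain K where K: "K > 0" "\<And>n. norm (w n) \<le> K"
    using convergent_imp_bounded[OF l] by (metis bounded_pos rangeI)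
  have "norm (y n) \<le> \<bar>C\<bar> * K" for n
    using y(2)[of n] K(2)[of n] by (smt (verit, best) mult_mono norm_ge_zero)
  then have "bounded (range y)" by (intro boundedI) auto
  then obtain r x where r: "strict_mono (r::nat \<Rightarrow> nat)" "(\<lambda>n. y (r n)) \<longlonglongrightarrow> x"
    using proper_on_boundedE[OF pr, of y] convergentI[OF l] by (auto simp: y(1))
  have "(\<lambda>n. E (y (r n))) \<longlonglongrightarrow> E x" using r(2) by (rule bounded_linear.tendsto[OF E])
  moreover have "(\<lambda>n. E (y (r n))) \<longlonglongrightarrow> l" using LIMSEQ_subseq_LIMSEQ[OF l r(1)] y(1) by (simp add: comp_def)
  ultimately show "l \<in> range E" using LIMSEQ_unique by blast
qed


section \<open>Bounded complex-linear operators and compact operators\<close>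

lemma clinear_iff:
  "clinear T \<longleftrightarrow> (\<forall>x y. T (x + y) = T x + T y) \<and> (\<forall>c x. T (c *\<^sub>C x) = c *\<^sub>C T x)"
  using vector_space_scaleC by (auto simp: Vector_Spaces.linear_iff)

lemma bounded_opsI:
  assumes "\<And>x y. T (x + y) = T x + T y" "\<And>c x. T (c *\<^sub>C x) = c *\<^sub>C T x" "\<And>x. norm (T x) \<le> K * norm x"
  shows "T \<in> bounded_ops"
proof -
  have "bounded_linear T"
    by (rule bounded_linear_intro[of T K])
      (use assms(1,3) assms(2)[of "complex_of_real _"] in \<open>auto simp: scaleC_of_real mult.commute\<close>)
  then show ?thesis using assms(1,2) by (simp add: bounded_ops_def clinear_iff)
qed

lemma bounded_ops_bounded_linear: "T \<in> bounded_ops \<Longrightarrow> bounded_linear T"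
  and bounded_ops_add: "T \<in> bounded_ops \<Longrightarrow> T (x + y) = T x + T y"
  and bounded_ops_scaleC: "T \<in> bounded_ops \<Longrightarrow> T (c *\<^sub>C x) = c *\<^sub>C T x"
  by (auto simp: bounded_ops_def clinear_iff)

lemma bounded_ops_diff: "T \<in> bounded_ops \<Longrightarrow> T (x - y) = T x - T y"
  and bounded_ops_zero: "T \<in> bounded_ops \<Longrightarrow> T 0 = 0"
  using bounded_ops_bounded_linear linear_diff linear_0 bounded_linear.linear by blast+

lemma scaleC_diff_right: "c *\<^sub>C (x - y) = c *\<^sub>C x - c *\<^sub>C (y::'l::complex_banach)"
  by (metis add_diff_cancel diff_add_cancel scaleC_add_right)

lemma scaleC_one: "1 *\<^sub>C x = (x::'l::complex_banach)"
  using scaleC_of_real[of 1 x] by simp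

lemma scaleC_zero_left: "0 *\<^sub>C x = (0::'l::complex_banach)"
  using scaleC_of_real[of 0 x] by simp

lemma scaleC_zero_right: "c *\<^sub>C 0 = (0::'l::complex_banach)"
  using scaleC_diff_right[of c 0 0] by simp

lemma bounded_linear_scaleC: "bounded_linear ((*\<^sub>C) c :: 'l \<Rightarrow> 'l::complex_banach)"
  by (rule bounded_linear_intro[of _ "cmod c"])
    (auto simp: scaleC_add_right norm_scaleC scaleC_scaleC mult.commute simp flip: scaleC_of_real)

lemma bounded_linear_in_bounded_ops:
  "bounded_linear T \<Longrightarrow> (\<And>c x. T (c *\<^sub>C x) = c *\<^sub>C T x) \<Longrightarrow> T \<in> bounded_ops"
  by (simp add: bounded_ops_def clinear_iff linear_add bounded_linear.linear)

lemma bounded_ops_intros: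
  "id \<in> bounded_ops" "(\<lambda>x. x) \<in> bounded_ops" "(\<lambda>x. 0) \<in> bounded_ops"
  "S \<in> bounded_ops \<Longrightarrow> T \<in> bounded_ops \<Longrightarrow> S \<circ> T \<in> bounded_ops"
  "S \<in> bounded_ops \<Longrightarrow> T \<in> bounded_ops \<Longrightarrow> (\<lambda>x. S x + T x) \<in> bounded_ops"
  "S \<in> bounded_ops \<Longrightarrow> T \<in> bounded_ops \<Longrightarrow> (\<lambda>x. S x - T x) \<in> bounded_ops"
  "T \<in> bounded_ops \<Longrightarrow> (\<lambda>x. c *\<^sub>C T x) \<in> bounded_ops"
proof goal_cases
  case 7
  then show ?case
    using bounded_linear_compose[OF bounded_linear_scaleC bounded_ops_bounded_linear]
    by (intro bounded_linear_in_bounded_ops) (auto simp: bounded_ops_scaleC scaleC_scaleC mult.commute)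
qed (auto simp: bounded_ops_scaleC comp_def id_def scaleC_add_right scaleC_diff_right scaleC_zero_right
      intro!: bounded_linear_in_bounded_ops bounded_linear_add bounded_linear_sub bounded_linear_ident
        bounded_linear_zero dest: bounded_ops_bounded_linear bounded_linear_compose)

lemma bounded_ops_compose:
  "S \<in> bounded_ops \<Longrightarrow> T \<in> bounded_ops \<Longrightarrow> (\<lambda>x. S (T x)) \<in> bounded_ops"
  using bounded_ops_intros(4) by (simp add: comp_def)

lemma bounded_ops_funpow: "T \<in> bounded_ops \<Longrightarrow> T ^^ n \<in> bounded_ops"
  by (induction n) (auto intro: bounded_ops_intros)

lemma compact_ops_iff: "T \<in> compact_ops \<longleftrightarrow> T \<in> bounded_ops \<and> noncompactness T = 0"
  by (auto simp: compact_ops_def noncompactness_eq_0_iff bounded_ops_bounded_linear)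

text \<open>In the kernel of a proper operator every bounded sequence has a convergent subsequence,
  so the closed balls of the kernel are compact.\<close>

lemma compact_ops_into_proper_kernel:
  assumes Q: "Q \<in> bounded_ops" and E: "bounded_linear E" "proper_on_bounded E" and EQ: "\<And>y. E (Q y) = 0"
  shows "Q \<in> compact_ops"
proof -
  define C where "C = onorm Q"
  have QC: "norm (Q y) \<le> C" if "norm y \<le> 1" for y
    using onorm[OF bounded_ops_bounded_linear[OF Q], of y] onorm_pos_le[OF bounded_ops_bounded_linear[OF Q]] that
      mult_left_le[of "norm y" "onorm Q"] unfolding C_def by linarith
  let ?N = "{x. E x = 0} \<inter> cball 0 C"
  have cl: "closed ?N" using closed_kernel[OF E(1)] by (intro closed_Int) auto
  have "compact ?N"
    unfolding compact_def
  proof (intro allI impI)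
    fix f :: "nat \<Rightarrow> _" assume f: "\<forall>n. f n \<in> ?N"
    then have "bounded (range f)" by (intro boundedI[of _ C]) auto
    moreover have "convergent (\<lambda>n. E (f n))" using f by (simp add: convergent_const)
    ultimately obtain r l where r: "strict_mono (r::nat \<Rightarrow> nat)" "(\<lambda>n. f (r n)) \<longlonglongrightarrow> l"
      using proper_on_boundedE[OF E(2)] by blast
    have "\<And>n. f (r n) \<in> ?N" using f by simp
    from closed_sequentially[OF cl this r(2)] have "l \<in> ?N" .
    then show "\<exists>l\<in>?N. \<exists>r. strict_mono r \<and> (f \<circ> r) \<longlonglongrightarrow> l" using r by (auto simp: comp_def)
  qed
  moreover have "closure (Q ` cball 0 1) \<subseteq> ?N"
    using EQ QC by (intro closure_minimal cl) auto
  ultimately have "compact (closure (Q ` cball 0 1))"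
    using compact_Int_closed[of ?N "closure (Q ` cball 0 1)"] by (simp add: inf.absorb2)
  then show ?thesis using Q by (simp add: compact_ops_def)
qed

text \<open>Pigeonhole: infinitely many images share finitely many centres, so two of them are at
  distance at most \<open>2 * r < 1/2\<close>. This will contradict the separation 1/2 supplied by
  Riesz's lemma, and it is the source of the constant 1/4.\<close>

lemma image_unit_vectors_not_separated:
  assumes "finitely_covered (S ` cball 0 1) r" "r < 1/4" "\<And>n. norm (x n) = 1"
  obtains p q :: nat where "p < q" "norm (S (x p) - S (x q)) < 1/2"
proof -
  obtain F where F: "finite F" "S ` cball 0 1 \<subseteq> (\<Union>x\<in>F. cball x r)"
    using assms(1) by (auto simp: finitely_covered_def)
  have "\<exists>a\<in>F. dist a (S (x n)) \<le> r" for n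
  proof -
    have "S (x n) \<in> S ` cball 0 1" using assms(3)[of n] by auto
    then show ?thesis using F(2) by fastforce
  qed
  then obtain f where f: "\<And>n. f n \<in> F" "\<And>n. dist (f n) (S (x n)) \<le> r" by metis
  have "finite (range f)" by (rule finite_subset[OF _ F(1)]) (use f(1) in auto)
  then have "\<not> inj f" using range_inj_infinite by blast
  then obtain p q where pq: "f p = f q" "p < q" unfolding inj_def by (metis linorder_neqE_nat)
  have "dist (S (x p)) (S (x q)) \<le> dist (f p) (S (x p)) + dist (f p) (S (x q))"
    by (metis dist_commute dist_triangle)
  also have "\<dots> \<le> r + r" using f(2)[of p] f(2)[of q] pq(1) by simp
  finally show ?thesis using that[OF pq(2)] assms(2) by (simp add: dist_norm)
qed

section \<open>Ascent, descent and a parametrix\<close>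

lemma range_funpow_antimono:
  fixes D :: "'a \<Rightarrow> 'a"
  shows "m \<le> n \<Longrightarrow> range (D ^^ n) \<subseteq> range (D ^^ m)"
  by (auto simp: le_iff_add funpow_add)

lemma kernel_funpow_mono:
  fixes D :: "'a::zero \<Rightarrow> 'a"
  shows "D 0 = 0 \<Longrightarrow> m \<le> n \<Longrightarrow> (D ^^ m) x = 0 \<Longrightarrow> (D ^^ n) x = 0"
proof (induction n)
  case (Suc n)
  then show ?case by (cases "m = Suc n") auto
qed auto

locale small_noncompactness =
  fixes S :: "'l::complex_banach \<Rightarrow> 'l" and r :: real
  assumes S: "S \<in> bounded_ops" and cov: "finitely_covered (S ` cball 0 1) r" and r: "0 \<le> r" "r < 1/4"
begin

definition D :: "'l \<Rightarrow> 'l" where "D x = x - S x"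

lemma D: "D \<in> bounded_ops" and D_proper: "proper_on_bounded D"
  unfolding D_def[abs_def]
  using S cov r by (auto intro!: bounded_ops_intros proper_on_bounded_id_minus bounded_ops_bounded_linear)

lemma funpow_D: "D ^^ n \<in> bounded_ops" "bounded_linear (D ^^ n)" "proper_on_bounded (D ^^ n)"
proof -
  show 1: "D ^^ n \<in> bounded_ops" for n using D by (rule bounded_ops_funpow)
  then show 2: "bounded_linear (D ^^ n)" for n by (rule bounded_ops_bounded_linear)
  show "proper_on_bounded (D ^^ n)"
  proof (induction n)
    case 0
    show ?case by (auto simp: proper_on_bounded_def convergent_def comp_def intro!: exI[of _ id] strict_mono_id)
  next
    case (Suc n)
    show ?case using proper_on_bounded_compose[OF D_proper Suc 2] by (simp only: funpow.simps)
  qed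
qed

lemma subspace_range_D: "subspace (range (D ^^ n))"
  by (intro linear_subspace_image subspace_UNIV bounded_linear.linear funpow_D)

lemma subspace_kernel_D: "subspace {x. (D ^^ n) x = 0}"
  by (intro linear_subspace_kernel bounded_linear.linear funpow_D)

lemma D_range: "x \<in> range (D ^^ n) \<Longrightarrow> D x \<in> range (D ^^ Suc n)"
  by auto

text \<open>Otherwise Riesz's lemma yields unit vectors in \<open>range (D ^^ p)\<close> at distance
  1/2 from the next range. For \<open>p < q\<close> one has
  \<open>S (x p) - S (x q) = x p - (D (x p) + (x q - D (x q)))\<close>, where the bracket lies in
  \<open>range (D ^^ Suc p)\<close>. So the images under \<open>S\<close> are separated as well,
  which the small ball measure forbids.\<close>

lemma descent_finite: "\<exists>p. range (D ^^ p) \<subseteq> range (D ^^ Suc p)"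
proof (rule ccontr)
  assume "\<not> ?thesis"
  then have nsub: "\<not> range (D ^^ p) \<subseteq> range (D ^^ Suc p)" for p by blast
  have "\<exists>x\<in>range (D ^^ p). norm x = 1 \<and> (\<forall>y\<in>range (D ^^ Suc p). 1/2 \<le> norm (x - y))" for p
  proof -
    obtain z where "z \<in> range (D ^^ p)" "z \<notin> range (D ^^ Suc p)" using nsub[of p] by blast
    then show ?thesis
      using riesz_lemma[OF subspace_range_D[of "Suc p"] closed_range_proper[OF funpow_D(2,3)] subspace_range_D[of p]
          range_funpow_antimono[of p "Suc p"]] by (metis le_SucI order_refl)
  qed
  then obtain x where x: "\<And>p. x p \<in> range (D ^^ p)" "\<And>p. norm (x p) = 1"
      "\<And>p y. y \<in> range (D ^^ Suc p) \<Longrightarrow> 1/2 \<le> norm (x p - y)" by metis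
  obtain p q where pq: "p < q" "norm (S (x p) - S (x q)) < 1/2"
    using image_unit_vectors_not_separated[OF cov r(2), of x] x(2) by blast
  have sub: "range (D ^^ q) \<subseteq> range (D ^^ Suc p)" "range (D ^^ Suc q) \<subseteq> range (D ^^ Suc p)"
    using pq(1) by (intro range_funpow_antimono; simp)+
  have "D (x p) + (x q - D (x q)) \<in> range (D ^^ Suc p)"
    using D_range[OF x(1)[of p]] D_range[OF x(1)[of q]] x(1)[of q] sub
    by (intro subspace_add[OF subspace_range_D] subspace_diff[OF subspace_range_D]) blast+
  from x(3)[OF this] have "1/2 \<le> norm (S (x p) - S (x q))" by (simp add: D_def algebra_simps)
  then show False using pq(2) by simp
qed

text \<open>This is the argument for the ranges with increasing kernels in place of decreasing
  ranges; now it is the vector with the larger index that stays away from the subspace.\<close>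

lemma ascent_finite: "\<exists>p. {x. (D ^^ Suc p) x = 0} \<subseteq> {x. (D ^^ p) x = 0}"
proof (rule ccontr)
  let ?K = "\<lambda>p. {x. (D ^^ p) x = 0}"
  assume "\<not> ?thesis"
  then have nsub: "\<not> ?K (Suc p) \<subseteq> ?K p" for p by blast
  have D0: "D 0 = 0" using D by (rule bounded_ops_zero)
  have mono: "?K m \<subseteq> ?K n" if "m \<le> n" for m n using kernel_funpow_mono[of D m n, OF D0 that] by blast
  have "\<exists>x\<in>?K (Suc p). norm x = 1 \<and> (\<forall>y\<in>?K p. 1/2 \<le> norm (x - y))" for p
  proof -
    obtain z where "z \<in> ?K (Suc p)" "z \<notin> ?K p" using nsub[of p] by blast
    then show ?thesis
      using riesz_lemma[OF subspace_kernel_D[of p] closed_kernel[OF funpow_D(2)] subspace_kernel_D[of "Suc p"]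
          mono[of p "Suc p"], of z] by (metis le_SucI order_refl)
  qed
  then obtain x where x: "\<And>p. x p \<in> ?K (Suc p)" "\<And>p. norm (x p) = 1"
      "\<And>p y. y \<in> ?K p \<Longrightarrow> 1/2 \<le> norm (x p - y)" by metis
  obtain q p where pq: "q < p" "norm (S (x q) - S (x p)) < 1/2"
    using image_unit_vectors_not_separated[OF cov r(2), of x] x(2) by blast
  have DK: "D y \<in> ?K n" if "y \<in> ?K (Suc n)" for y n using that by (simp add: funpow_swap1)
  have "?K (Suc q) \<subseteq> ?K p" "?K q \<subseteq> ?K p" using pq(1) by (intro mono; simp)+
  then have "D (x p) + (x q - D (x q)) \<in> ?K p"
    using DK[OF x(1)[of p]] DK[OF x(1)[of q]] x(1)[of q]
    by (intro subspace_add[OF subspace_kernel_D] subspace_diff[OF subspace_kernel_D]) blast+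
  from x(3)[OF this] have "1/2 \<le> norm (S (x p) - S (x q))" by (simp add: D_def algebra_simps)
  then show False using pq(2) by (simp add: norm_minus_commute)
qed

lemma range_stable: "range (D ^^ p) \<subseteq> range (D ^^ Suc p) \<Longrightarrow> range (D ^^ p) \<subseteq> range (D ^^ (p + k))"
proof (induction k)
  case (Suc k)
  have "range (D ^^ Suc p) = D ` range (D ^^ p)" by (simp add: image_comp comp_def)
  also have "\<dots> \<subseteq> D ` range (D ^^ (p + k))" using Suc by blast
  also have "\<dots> = range (D ^^ (p + Suc k))" by (simp add: image_comp comp_def)
  finally show ?case using Suc.prems by blast
qed auto

lemma kernel_stable:
  "{x. (D ^^ Suc p) x = 0} \<subseteq> {x. (D ^^ p) x = 0} \<Longrightarrow> {x. (D ^^ (p + k)) x = 0} \<subseteq> {x. (D ^^ p) x = 0}"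
proof (induction k)
  case (Suc k)
  show ?case
  proof
    fix x assume "x \<in> {x. (D ^^ (p + Suc k)) x = 0}"
    then have "(D ^^ Suc p) ((D ^^ k) x) = 0" unfolding add_Suc_right add_Suc[symmetric] funpow_add by simp
    then have "(D ^^ p) ((D ^^ k) x) = 0" using Suc.prems by blast
    then have "(D ^^ (p + k)) x = 0" by (simp add: funpow_add)
    then show "x \<in> {x. (D ^^ p) x = 0}" using Suc.IH[OF Suc.prems] by blast
  qed
qed auto

lemma stable_power:
  obtains p where "p \<ge> 1" "\<And>x. \<exists>z. (D ^^ p) x = (D ^^ p) ((D ^^ p) z)"
    "\<And>x. (D ^^ p) ((D ^^ p) x) = 0 \<Longrightarrow> (D ^^ p) x = 0"
proof -
  obtain a b where a: "range (D ^^ a) \<subseteq> range (D ^^ Suc a)" and b: "{x. (D ^^ Suc b) x = 0} \<subseteq> {x. (D ^^ b) x = 0}"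
    using descent_finite ascent_finite by blast
  \<comment> \<open>Both chains are constant from here on. The successor makes \<open>p\<close>
    positive, since the parametrix uses \<open>D ^^ (p - 1)\<close>.\<close>
  define p where "p = Suc (max a b)"
  have ab: "a \<le> p" "b \<le> p" by (auto simp: p_def)
  show ?thesis
  proof (rule that[of p])
    show "p \<ge> 1" by (simp add: p_def)
    fix x
    have "(D ^^ p) x \<in> range (D ^^ a)" using range_funpow_antimono[OF ab(1), of D] by blast
    moreover obtain k where k: "p + p = a + k" using ab by (metis le_iff_add trans_le_add1)
    ultimately have "(D ^^ p) x \<in> range (D ^^ (p + p))" using range_stable[OF a, of k] k by auto
    then show "\<exists>z. (D ^^ p) x = (D ^^ p) ((D ^^ p) z)" by (auto simp: funpow_add)
    assume "(D ^^ p) ((D ^^ p) x) = 0"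
    then have "(D ^^ (p + p)) x = 0" by (simp add: funpow_add)
    moreover obtain k where "p + p = b + k" using ab by (metis le_iff_add trans_le_add1)
    ultimately have "(D ^^ b) x = 0" using kernel_stable[OF b, of k] by auto
    then show "(D ^^ p) x = 0" using kernel_funpow_mono[of D b p, OF bounded_ops_zero[OF D] ab(2)] by blast
  qed
qed

text \<open>The parametrix is the inverse of a power of \<open>D\<close> on its range, extended by \<open>0\<close>
  on its kernel, composed with a smaller power of \<open>D\<close>.\<close>

lemma parametrix:
  obtains W where "W \<in> bounded_ops" "(\<lambda>x. W (D x) - x) \<in> compact_ops"
    "\<And>B. B \<in> bounded_ops \<Longrightarrow> (\<And>x. B (S x) = S (B x)) \<Longrightarrow> (\<And>x. B (W x) = W (B x))"
proof -
  obtain p where p: "p \<ge> 1" "\<And>x. \<exists>z. (D ^^ p) x = (D ^^ p) ((D ^^ p) z)"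
    "\<And>x. (D ^^ p) ((D ^^ p) x) = 0 \<Longrightarrow> (D ^^ p) x = 0" using stable_power by metis
  define E where "E = D ^^ p"
  note E = funpow_D[of p, folded E_def] and pE = p(2,3)[folded E_def]
  note Ediff = bounded_ops_diff[OF E(1)] and Eadd = bounded_ops_add[OF E(1)] and Esc = bounded_ops_scaleC[OF E(1)]
  \<comment> \<open>The value of the inverse at \<open>y\<close> is pinned down by
    \<open>E (E x) = E y\<close> with \<open>x\<close> in the range of \<open>E\<close>. On this
    range \<open>E\<close> is injective, because \<open>E (E w) = 0\<close> forces
    \<open>E w = 0\<close>.\<close>
  have unique: "x = x'" if x: "x \<in> range E" "x' \<in> range E" "E (y - E x) = 0" "E (y - E x') = 0" for x x' y
  proof -
    obtain w w' where w: "x = E w" "x' = E w'" using x by auto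
    have "E (E (x - x')) = 0" using x(3,4) by (simp add: Ediff)
    then have "E (E (w - w')) = 0" using pE(2) by (metis Ediff w)
    then have "E (w - w') = 0" by (rule pE(2))
    then show ?thesis by (simp add: w Ediff)
  qed
  \<comment> \<open>\<open>E\<close> maps its range onto itself; used twice, this gives
    \<open>E y = E (E (E w))\<close>.\<close>
  have ex: "\<exists>x. x \<in> range E \<and> E (y - E x) = 0" for y
  proof -
    obtain z where z: "E y = E (E z)" using pE(1) by blast
    obtain w where "E z = E (E w)" using pE(1) by blast
    then show ?thesis using z by (intro exI[of _ "E w"]) (simp add: Ediff)
  qed
  define V where "V y = (THE x. x \<in> range E \<and> E (y - E x) = 0)" for y
  have V: "V y \<in> range E" "E (y - E (V y)) = 0" for y
  proof -
    have "\<exists>!x. x \<in> range E \<and> E (y - E x) = 0" using ex[of y] unique[of _ _ y] by blast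
    from theI'[OF this] show "V y \<in> range E" "E (y - E (V y)) = 0" by (auto simp: V_def)
  qed
  have V_eq: "V y = x" if "x \<in> range E" "E (y - E x) = 0" for x y using unique[OF V(1) that(1) V(2) that(2)] .
  have rangeE: "x + y \<in> range E" if "x \<in> range E" "y \<in> range E" for x y
    using that by (auto simp: Eadd[symmetric])
  have rangeE': "c *\<^sub>C x \<in> range E" if "x \<in> range E" for x c
    using that by (auto simp: Esc[symmetric])
  have Vadd: "V (x + y) = V x + V y" for x y
  proof (rule V_eq)
    show "E (x + y - E (V x + V y)) = 0" using V(2)[of x] V(2)[of y] by (simp add: Eadd Ediff)
  qed (rule rangeE V)+
  have Vscale: "V (c *\<^sub>C x) = c *\<^sub>C V x" for c x
  proof (rule V_eq)
    have "E (c *\<^sub>C x - E (c *\<^sub>C V x)) = c *\<^sub>C E (x - E (V x))" by (simp add: Esc Ediff scaleC_diff_right)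
    also have "\<dots> = 0" by (simp add: V(2) scaleC_zero_right)
    finally show "E (c *\<^sub>C x - E (c *\<^sub>C V x)) = 0" .
  qed (rule rangeE' V)+
  \<comment> \<open>Properness replaces the open mapping theorem: normalised counterexamples
    accumulate at a point of the closed range of \<open>E\<close> that is killed by \<open>E\<close>
    applied twice. It is therefore 0, although its norm is 1.\<close>
  have bdd: "\<exists>K. \<forall>y. norm (V y) \<le> K * norm y"
  proof (rule ccontr)
    assume "\<not> ?thesis"
    then have "\<not> (\<forall>y. norm (V y) \<le> real (Suc n) * norm y)" for n by blast
    then have "\<exists>y. norm (V y) > real (Suc n) * norm y" for n unfolding not_all not_le .
    then obtain y where y: "\<And>n. norm (V (y n)) > real (Suc n) * norm (y n)" by metis
    have pos: "norm (V (y n)) > 0" for n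
      using y[of n] by (meson le_less_trans mult_nonneg_nonneg norm_ge_zero of_nat_0_le_iff)
    \<comment> \<open>The scaling gives the values \<open>x n = V (z n)\<close> norm 1, while
      \<open>z n\<close> tends to 0.\<close>
    define z x where "z n = complex_of_real (inverse (norm (V (y n)))) *\<^sub>C y n" and "x n = V (z n)" for n
    have x1: "norm (x n) = 1" for n using pos[of n] by (simp add: x_def z_def Vscale norm_scaleC norm_inverse)
    have z1: "norm (z n) \<le> 1 / real (Suc n)" for n
      using y[of n] pos[of n] by (simp add: z_def norm_scaleC norm_divide norm_inverse field_simps)
    have zlim: "z \<longlonglongrightarrow> 0"
      by (rule Lim_null_comparison[OF always_eventually LIMSEQ_inverse_real_of_nat])
        (use z1 in \<open>auto simp: divide_inverse\<close>)
    have "E (E (x n)) = E (z n)" for n using V(2)[of "z n"] by (simp add: x_def Ediff)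
    moreover have Ezlim: "(\<lambda>n. E (z n)) \<longlonglongrightarrow> 0" using bounded_linear.tendsto[OF E(2) zlim] by (simp add: bounded_ops_zero[OF E(1)])
    ultimately have EEx: "(\<lambda>n. (E \<circ> E) (x n)) \<longlonglongrightarrow> 0" by simp
    have "bounded (range x)" using x1 by (intro boundedI[of _ 1]) auto
    then obtain s l where s: "strict_mono (s::nat \<Rightarrow> nat)" "(\<lambda>n. x (s n)) \<longlonglongrightarrow> l"
      using proper_on_boundedE[OF proper_on_bounded_compose[OF E(3,3,2)]] convergentI[OF EEx] by metis
    have "l \<in> range E"
      using V(1) by (intro closed_sequentially[OF closed_range_proper[OF E(2,3)] _ s(2)]) (simp add: x_def)
    then obtain w where w: "l = E w" by auto
    have "(\<lambda>n. (E \<circ> E) (x (s n))) \<longlonglongrightarrow> E (E l)"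
      unfolding comp_def by (intro bounded_linear.tendsto[OF E(2)] s(2))
    moreover have "(\<lambda>n. (E \<circ> E) (x (s n))) \<longlonglongrightarrow> 0" using LIMSEQ_subseq_LIMSEQ[OF EEx s(1)] by (simp add: comp_def)
    ultimately have "E (E l) = 0" using LIMSEQ_unique by blast
    then have "l = 0" using pE(2) w by metis
    moreover have "(\<lambda>n. norm (x (s n))) \<longlonglongrightarrow> norm l" using s(2) by (rule tendsto_norm)
    then have "norm l = 1" using x1 by (simp add: LIMSEQ_const_iff)
    ultimately show False by simp
  qed
  then have Vb: "V \<in> bounded_ops" using Vadd Vscale by (meson bounded_opsI)
  \<comment> \<open>By uniqueness of its values, \<open>V\<close> commutes with everything that
    commutes with \<open>E\<close>. This later makes an inverse two-sided.\<close>
  have V_commute: "B (V y) = V (B y)" if B: "B \<in> bounded_ops" "\<And>x. B (E x) = E (B x)" for B y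
  proof (rule V_eq[symmetric])
    show "B (V y) \<in> range E" using V(1)[of y] B(2) by auto
    have "E (B y - E (B (V y))) = B (E (y - E (V y)))" by (simp add: Ediff bounded_ops_diff[OF B(1)] B(2))
    then show "E (B y - E (B (V y))) = 0" by (simp add: V(2) bounded_ops_zero[OF B(1)])
  qed
  define W where "W = V \<circ> (D ^^ (p - 1))"
  have D_commute: "B ((D ^^ n) x) = (D ^^ n) (B x)" if "B \<in> bounded_ops" "\<And>x. B (S x) = S (B x)" for B n x
    by (induction n arbitrary: x) (auto simp: D_def bounded_ops_diff[OF that(1)] that(2))
  have Wb: "W \<in> bounded_ops" unfolding W_def by (intro bounded_ops_intros Vb funpow_D)
  have WD: "W (D x) = V (E x)" for x
    using p(1) by (cases p) (auto simp: W_def E_def funpow_swap1)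
  show ?thesis
  proof (rule that[OF Wb])
    show "(\<lambda>x. W (D x) - x) \<in> compact_ops"
    proof (rule compact_ops_into_proper_kernel[OF _ E(2,3)])
      show "(\<lambda>x. W (D x) - x) \<in> bounded_ops" by (intro bounded_ops_intros bounded_ops_compose[OF Wb D])
      fix y
      \<comment> \<open>\<open>V\<close> after \<open>E\<close> is the projection onto the range of
        \<open>E\<close> along its kernel, so its difference to the identity has values in the
        kernel of a proper operator.\<close>
      have "E (E (V (E y) - y)) = 0" using V(2)[of "E y"] by (simp add: Ediff)
      then show "E (W (D y) - y) = 0" unfolding WD by (rule pE(2))
    qed
    fix B x assume B: "B \<in> bounded_ops" "\<And>x. B (S x) = S (B x)"
    have "B (E x) = E (B x)" for x unfolding E_def using B by (rule D_commute)
    then show "B (W x) = W (B x)" using V_commute[OF B(1)] D_commute[OF B] by (simp add: W_def)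
  qed
qed

end

section \<open>Invertibility modulo the compact operators\<close>

definition invertible_mod_compact :: "('l::complex_banach \<Rightarrow> 'l) \<Rightarrow> bool"
  where "invertible_mod_compact T \<longleftrightarrow> (\<exists>R\<in>bounded_ops. (\<lambda>x. T (R x) - x) \<in> compact_ops \<and> (\<lambda>x. R (T x) - x) \<in> compact_ops)"

text \<open>The factor is the geometric sum of the terms \<open>c ^ (n - 1 - j)\<close> times
  \<open>T ^^ j\<close>, built by the recursion that sends \<open>G\<close> to \<open>c ^ n\<close>
  plus \<open>T\<close> after \<open>G\<close>.\<close>

lemma geometric_factor:
  assumes "T \<in> bounded_ops"
  obtains G where "G \<in> bounded_ops" "\<And>x. G (T x) = T (G x)"
    "\<And>x. (c ^ n) *\<^sub>C x - (T ^^ n) x = G (c *\<^sub>C x - T x)"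
proof -
  have "\<exists>G\<in>bounded_ops. (\<forall>x. G (T x) = T (G x)) \<and> (\<forall>x. (c ^ n) *\<^sub>C x - (T ^^ n) x = G (c *\<^sub>C x - T x))"
  proof (induction n)
    case 0
    show ?case by (rule bexI[of _ "\<lambda>_. 0"]) (auto simp: scaleC_one bounded_ops_zero[OF assms] intro: bounded_ops_intros)
  next
    case (Suc n)
    then obtain G where G: "G \<in> bounded_ops" "\<And>x. G (T x) = T (G x)"
      "\<And>x. (c ^ n) *\<^sub>C x - (T ^^ n) x = G (c *\<^sub>C x - T x)" by blast
    let ?G = "\<lambda>x. (c ^ n) *\<^sub>C x + T (G x)"
    have "(c ^ Suc n) *\<^sub>C x - (T ^^ Suc n) x = ?G (c *\<^sub>C x - T x)" for x
    proof -
      have "?G (c *\<^sub>C x - T x) = (c ^ n) *\<^sub>C (c *\<^sub>C x - T x) + T ((c ^ n) *\<^sub>C x - (T ^^ n) x)"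
        by (simp only: G(3))
      also have "\<dots> = (c ^ Suc n) *\<^sub>C x - (T ^^ Suc n) x"
        by (simp add: bounded_ops_diff[OF assms] bounded_ops_scaleC[OF assms] scaleC_diff_right scaleC_scaleC mult.commute)
      finally show ?thesis ..
    qed
    moreover have "?G \<in> bounded_ops" by (intro bounded_ops_intros bounded_ops_compose[OF assms] G)
    moreover have "?G (T x) = T (?G x)" for x
      by (simp add: bounded_ops_add[OF assms] bounded_ops_scaleC[OF assms] G(2))
    ultimately show ?case by (intro bexI[of _ ?G]) blast+
  qed
  then show ?thesis using that by blast
qed

text \<open>The operator \<open>S\<close>, which is \<open>T ^^ n\<close> divided by
  \<open>c ^ n\<close>, has ball measure below 1/4, and \<open>1 - S = H (c - T)\<close> with the
  scaled geometric sum \<open>H\<close>. If \<open>W\<close> is the parametrix of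
  \<open>1 - S\<close>, then \<open>H W\<close> inverts \<open>c - T\<close> modulo compact
  operators, on both sides because \<open>W\<close> commutes with \<open>H\<close> and with
  \<open>c - T\<close>.\<close>

theorem invertible_mod_compact_of_noncompactness:
  assumes T: "T \<in> bounded_ops" and less: "4 * noncompactness (T ^^ n) < cmod c ^ n"
  shows "invertible_mod_compact (\<lambda>x. c *\<^sub>C x - T x)"
proof -
  have Tn: "T ^^ n \<in> bounded_ops" using T by (rule bounded_ops_funpow)
  note Tn' = bounded_ops_bounded_linear[OF Tn]
  have pos: "cmod c ^ n > 0" using less noncompactness_nonneg[OF Tn'] by linarith
  then have c0: "c ^ n \<noteq> 0" by (metis norm_power norm_zero less_irrefl)
  define b where "b = inverse (c ^ n)"
  define S where "S = (\<lambda>x. b *\<^sub>C (T ^^ n) x)"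
  have Sb: "S \<in> bounded_ops" unfolding S_def by (intro bounded_ops_intros Tn)
  have "noncompactness S \<le> cmod b * noncompactness (T ^^ n)"
  proof -
    have "onorm ((*\<^sub>C) b :: 'a \<Rightarrow> 'a) \<le> cmod b" by (rule onorm_bound) (simp_all add: norm_scaleC)
    moreover have "noncompactness ((*\<^sub>C) b \<circ> (T ^^ n)) \<le> onorm ((*\<^sub>C) b :: 'a \<Rightarrow> 'a) * noncompactness (T ^^ n)"
      by (rule noncompactness_scale[OF bounded_linear_scaleC Tn'])
    ultimately show ?thesis
      unfolding S_def using noncompactness_nonneg[OF Tn'] by (simp add: comp_def) (meson mult_right_mono order_trans)
  qed
  also have "\<dots> < 1/4" using less pos
    unfolding b_def norm_inverse norm_power by (simp add: field_simps)
  finally have nS: "noncompactness S < 1/4" .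
  \<comment> \<open>The midpoint lies strictly above the ball measure, so a finite cover with this
    radius exists.\<close>
  define r where "r = (noncompactness S + 1/4) / 2"
  have "finitely_covered (S ` cball 0 1) r"
    using finitely_covered_noncompactness[OF bounded_ops_bounded_linear[OF Sb], of "(1/4 - noncompactness S) / 2"] nS
    by (simp add: r_def field_simps)
  then interpret small_noncompactness S r
    using Sb nS noncompactness_nonneg[OF bounded_ops_bounded_linear[OF Sb]] by unfold_locales (auto simp: r_def)
  obtain W where W: "W \<in> bounded_ops" "(\<lambda>x. W (D x) - x) \<in> compact_ops"
    "\<And>B x. B \<in> bounded_ops \<Longrightarrow> (\<And>x. B (S x) = S (B x)) \<Longrightarrow> B (W x) = W (B x)" by (rule parametrix) blast
  obtain G where G: "G \<in> bounded_ops" "\<And>x. G (T x) = T (G x)"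
    "\<And>x. (c ^ n) *\<^sub>C x - (T ^^ n) x = G (c *\<^sub>C x - T x)" using geometric_factor[OF T] by blast
  define H where "H x = b *\<^sub>C G x" for x
  let ?C = "\<lambda>x. c *\<^sub>C x - T x"
  have Hb: "H \<in> bounded_ops" and Cb: "?C \<in> bounded_ops"
    unfolding H_def[abs_def] by (intro bounded_ops_intros G T)+
  have GC: "G (?C x) = ?C (G x)" for x using G(2) by (simp add: bounded_ops_diff[OF G(1)] bounded_ops_scaleC[OF G(1)])
  have D_eq: "D x = H (?C x)" for x
    unfolding H_def G(3)[symmetric] D_def
    using c0 by (simp add: S_def scaleC_diff_right scaleC_scaleC b_def scaleC_one)
  have HC: "H (?C x) = ?C (H x)" for x
    unfolding H_def GC by (simp add: scaleC_diff_right scaleC_scaleC bounded_ops_scaleC[OF T] mult.commute)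
  have T_pow: "B ((T ^^ k) x) = (T ^^ k) (B x)" if "\<And>x. B (T x) = T (B x)" for B :: "'a \<Rightarrow> 'a" and k x
    by (induction k arbitrary: x) (auto simp: that)
  have HS: "H (S x) = S (H x)" for x
    using T_pow[of G, OF G(2)]
    by (simp add: H_def S_def bounded_ops_scaleC[OF G(1)] bounded_ops_scaleC[OF Tn])
  have CS: "?C (S x) = S (?C x)" for x
    by (simp add: S_def bounded_ops_scaleC[OF T] bounded_ops_diff[OF Tn] bounded_ops_scaleC[OF Tn] scaleC_diff_right
        scaleC_scaleC mult.commute funpow_swap1)
  show ?thesis
    unfolding invertible_mod_compact_def
  proof (rule bexI[of _ "\<lambda>x. H (W x)"], intro conjI)
    have "?C (H (W x)) = W (D x)" for x
      using W(3)[OF Hb HS] W(3)[OF Cb CS] by (simp add: D_eq HC)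
    then show "(\<lambda>x. ?C (H (W x)) - x) \<in> compact_ops" using W(2) by simp
    have "H (W (?C x)) = W (D x)" for x using W(3)[OF Hb HS] by (simp add: D_eq)
    then show "(\<lambda>x. H (W (?C x)) - x) \<in> compact_ops" using W(2) by simp
  qed (rule bounded_ops_compose[OF Hb W(1)])
qed

section \<open>The spectral radius formula modulo a null ideal\<close>

text \<open>Scalars enter as a central copy \<open>emb\<close> of the complex field inside the ring.
  The value \<open>p 1\<close> is left free, as it is 0 when the Calkin algebra is zero;
  \<open>p_emb\<close> bounds a product so that no factor \<open>p 1\<close> appears.\<close>

locale seminormed_complex_algebra =
  fixes p :: "'r::{ring,monoid_mult} \<Rightarrow> real" and emb :: "complex \<Rightarrow> 'r"
  assumes p_nonneg: "0 \<le> p x"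
    and p_zero: "p 0 = 0"
    and p_add: "p (x + y) \<le> p x + p y"
    and p_minus: "p (- x) = p x"
    and p_mult: "p (x * y) \<le> p x * p y"
    and p_emb: "p (emb c * x) \<le> cmod c * p x"
    and emb_add: "emb (c + d) = emb c + emb d"
    and emb_mult: "emb (c * d) = emb c * emb d"
    and emb_1: "emb 1 = 1"
    and emb_commute: "x * emb c = emb c * x"
begin

lemma emb_left_commute: "x * (emb c * y) = emb c * (x * y)"
  by (metis emb_commute mult.assoc)

lemma emb_0: "emb 0 = 0"
  using emb_add[of 0 0] by simp

lemma emb_diff: "emb (c - d) = emb c - emb d"
  using emb_add[of "c - d" d] by (simp add: algebra_simps)

lemma emb_sum: "emb (sum f A) = (\<Sum>i\<in>A. emb (f i))"
  by (induction A rule: infinite_finite_induct) (auto simp: emb_0 emb_add)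

lemma p_diff: "p (x - y) \<le> p x + p y"
  using p_add[of x "- y"] by (simp add: p_minus)

lemma p_sum: "p (sum f A) \<le> (\<Sum>i\<in>A. p (f i))"
  by (induction A rule: infinite_finite_induct) (auto simp: p_zero intro: order_trans[OF p_add])

text \<open>Congruence modulo the null ideal of \<open>p\<close>; it takes the place of equality in
  a quotient algebra.\<close>

definition eqv :: "'r \<Rightarrow> 'r \<Rightarrow> bool" where "eqv x y \<longleftrightarrow> p (x - y) = 0"

lemma eqv_refl: "eqv x x"
  by (simp add: eqv_def p_zero)

lemma eqvI: "p (x - y) \<le> 0 \<Longrightarrow> eqv x y"
  using p_nonneg[of "x - y"] by (simp add: eqv_def)

lemma eqv_sym: "eqv x y \<Longrightarrow> eqv y x"
  using p_minus[of "x - y"] by (simp add: eqv_def)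

lemma eqv_trans [trans]: "eqv x y \<Longrightarrow> eqv y z \<Longrightarrow> eqv x z"
  using p_add[of "x - y" "y - z"] by (intro eqvI) (simp add: eqv_def)

lemma eqv_add: "eqv x y \<Longrightarrow> eqv x' y' \<Longrightarrow> eqv (x + x') (y + y')"
  using p_add[of "x - y" "x' - y'"] by (intro eqvI) (simp add: eqv_def algebra_simps)

lemma eqv_diff: "eqv x y \<Longrightarrow> eqv x' y' \<Longrightarrow> eqv (x - x') (y - y')"
  using p_diff[of "x - y" "x' - y'"] by (intro eqvI) (simp add: eqv_def algebra_simps)

lemma eqv_mult_left: "eqv x y \<Longrightarrow> eqv (z * x) (z * y)"
  using p_mult[of z "x - y"] by (intro eqvI) (simp add: eqv_def algebra_simps)

lemma eqv_mult_right: "eqv x y \<Longrightarrow> eqv (x * z) (y * z)"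
  using p_mult[of "x - y" z] by (intro eqvI) (simp add: eqv_def algebra_simps)

lemma eqv_sum: "(\<And>i. i \<in> A \<Longrightarrow> eqv (f i) (g i)) \<Longrightarrow> eqv (sum f A) (sum g A)"
  by (induction A rule: infinite_finite_induct) (auto intro: eqv_refl eqv_add)

lemma p_cong: "eqv x y \<Longrightarrow> p x = p y"
  using p_add[of "x - y" y] p_add[of "y - x" x] eqv_sym[of x y] by (simp add: eqv_def)

lemma power_difference_factor:
  "emb (z ^ n) - a ^ n = (emb z - a) * (\<Sum>j<n. emb (z ^ (n - 1 - j)) * a ^ j)"
proof (induction n)
  case 0
  show ?case by (simp add: emb_1)
next
  case (Suc n)
  let ?G = "\<Sum>j<n. emb (z ^ (n - 1 - j)) * a ^ j"
  have "(\<Sum>j<Suc n. emb (z ^ (Suc n - 1 - j)) * a ^ j) = emb (z ^ n) + (\<Sum>j<n. emb (z ^ (n - 1 - j)) * (a ^ j * a))"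
    by (subst sum.lessThan_Suc_shift) (simp add: power_commutes[symmetric])
  also have "(\<Sum>j<n. emb (z ^ (n - 1 - j)) * (a ^ j * a)) = a * ?G"
    by (simp add: sum_distrib_left power_commutes mult.assoc[symmetric] emb_commute)
  finally have G: "(\<Sum>j<Suc n. emb (z ^ (Suc n - 1 - j)) * a ^ j) = emb (z ^ n) + a * ?G" .
  have "(emb z - a) * (emb (z ^ n) + a * ?G) = emb (z ^ Suc n) - a * emb (z ^ n) + a * ((emb z - a) * ?G)"
    by (simp add: algebra_simps emb_mult emb_left_commute[of a])
  also have "\<dots> = emb (z ^ Suc n) - a ^ Suc n"
    unfolding Suc.IH[symmetric] by (simp add: algebra_simps)
  finally show ?case unfolding G ..
qed

end

section \<open>Averages over roots of unity and the growth of powers\<close>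

lemma sum_root_unity_powers:
  fixes n m :: nat
  assumes "0 < m" "m < n"
  shows "(\<Sum>k<n. exp (2 * of_real pi * \<i> * of_nat k / of_nat n) ^ m) = 0"
proof -
  define w where "w = exp (2 * of_real pi * \<i> * of_nat m / of_nat n)"
  have n: "1 \<le> n" using assms by simp
  have "exp (2 * of_real pi * \<i> * of_nat k / of_nat n) ^ m = w ^ k" for k
    by (simp add: w_def exp_of_nat_mult[symmetric] mult_ac)
  moreover have "w ^ n = 1" unfolding w_def using n by (simp add: complex_root_unity)
  moreover have "w \<noteq> 1" unfolding w_def complex_root_unity_eq_1[OF n]
    using assms by (auto dest: dvd_imp_le)
  ultimately show ?thesis by (simp add: sum_gp_strict)
qed

text \<open>Rickart's elementary proof of the spectral radius formula, in an algebra with a submultiplicative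
  seminorm and for inverses modulo its null ideal.  The mean of \<open>z (z - a)\<^sup>-\<^sup>1\<close> over the points
  \<open>z\<close> with \<open>z ^ n = r ^ n\<close> is an inverse of \<open>1 - (a / r) ^ n\<close>, and it depends on \<open>r\<close> with a
  Lipschitz constant independent of \<open>n\<close>.\<close>

locale resolvent_outside_disc = seminormed_complex_algebra p emb
  for p :: "'r::{ring,monoid_mult} \<Rightarrow> real" and emb :: "complex \<Rightarrow> 'r" +
  fixes a :: 'r and q :: real and R :: "complex \<Rightarrow> 'r"
  assumes q: "0 < q"
    and right_inverse: "q \<le> cmod c \<Longrightarrow> eqv ((emb c - a) * R c) 1"
    and left_inverse: "q \<le> cmod c \<Longrightarrow> eqv (R c * (emb c - a)) 1"
begin

lemma resolvent_identity:
  assumes "q \<le> cmod c" "q \<le> cmod d"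
  shows "eqv (R c - R d) (emb (d - c) * (R c * R d))"
proof -
  \<comment> \<open>The first 1 becomes \<open>(d - a) R d\<close>, the second
    \<open>R c (c - a)\<close>; then the terms with \<open>a\<close> cancel.\<close>
  have "eqv (R c * 1 - 1 * R d) (R c * ((emb d - a) * R d) - (R c * (emb c - a)) * R d)"
    using assms by (intro eqv_diff eqv_mult_left eqv_mult_right eqv_sym[OF right_inverse] eqv_sym[OF left_inverse])
  also have "R c * ((emb d - a) * R d) - (R c * (emb c - a)) * R d = emb (d - c) * (R c * R d)"
    by (simp add: emb_diff algebra_simps emb_left_commute[of "R c"])
  finally show ?thesis by simp
qed

text \<open>The inverses \<open>R c\<close> are arbitrary choices, so their bound comes from the
  resolvent identity: near \<open>c0\<close> it gives
  \<open>p (R c) <= p (R c) / 2 + p (R c0)\<close>. Compactness of the annulus makes these local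
  bounds uniform.\<close>

lemma resolvent_bounded: "\<exists>B>0. \<forall>c. q \<le> cmod c \<and> cmod c \<le> s \<longrightarrow> p (R c) \<le> B"
proof -
  define K where "K = {c. q \<le> cmod c \<and> cmod c \<le> s}"
  \<comment> \<open>The radius satisfies \<open>d c0 * (p (R c0) + 1) = 1/2\<close>; the summand 1
    keeps the denominator positive.\<close>
  define d where "d c = 1 / (2 * (p (R c) + 1))" for c
  have d: "d c > 0" for c using p_nonneg[of "R c"] by (simp add: d_def)
  have loc: "p (R c) \<le> 2 * p (R c0)" if "c \<in> K" "c0 \<in> K" "c \<in> ball c0 (d c0)" for c c0
  proof -
    have "p (R c) \<le> p (R c - R c0) + p (R c0)" using p_add[of "R c - R c0" "R c0"] by simp
    also have "p (R c - R c0) = p (emb (c0 - c) * (R c * R c0))"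
      using that by (intro p_cong resolvent_identity) (auto simp: K_def)
    also have "\<dots> \<le> cmod (c0 - c) * (p (R c) * p (R c0))"
      by (rule order_trans[OF p_emb mult_left_mono[OF p_mult]]) simp
    also have "\<dots> \<le> d c0 * (p (R c) * (p (R c0) + 1))"
      using that(3) p_nonneg[of "R c"] p_nonneg[of "R c0"]
      less_imp_le[OF d] by (intro mult_mono) (auto simp: dist_norm)
    also have "\<dots> = p (R c) / 2" using p_nonneg[of "R c0"] by (simp add: d_def field_simps)
    finally show ?thesis by simp
  qed
  have "K = cball 0 s \<inter> {c. q \<le> cmod c}" by (auto simp: K_def)
  moreover have "closed {c. q \<le> cmod c}" by (intro closed_Collect_le continuous_intros)
  ultimately have "compact K" by (simp add: compact_Int_closed)
  moreover have "K \<subseteq> (\<Union>c\<in>K. ball c (d c))" using d by auto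
  ultimately obtain C where C: "C \<subseteq> K" "finite C" "K \<subseteq> (\<Union>c\<in>C. ball c (d c))"
    using compactE_image[of K K "\<lambda>c. ball c (d c)"] by (metis open_ball)
  have "p (R c) \<le> 1 + (\<Sum>c\<in>C. 2 * p (R c))" if c: "c \<in> K" for c
  proof -
    obtain c0 where c0: "c0 \<in> C" "c \<in> ball c0 (d c0)" using C(3) c by blast
    then have "p (R c) \<le> 2 * p (R c0)" using C(1) c by (intro loc) auto
    also have "\<dots> \<le> (\<Sum>c\<in>C. 2 * p (R c))"
      using c0(1) C(2) p_nonneg by (intro member_le_sum[of c0 C "\<lambda>c. 2 * p (R c)"]) auto
    finally show ?thesis by simp
  qed
  moreover have "0 < 1 + (\<Sum>c\<in>C. 2 * p (R c))"
    using p_nonneg by (intro add_pos_nonneg sum_nonneg) auto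
  ultimately show ?thesis unfolding K_def by (metis (mono_tags, lifting) mem_Collect_eq)
qed

definition F :: "complex \<Rightarrow> 'r" where "F c = emb c * R c"

text \<open>Modulo the ideal \<open>F c\<close> is \<open>1 + a R c\<close>, so the difference is
  \<open>a (R c - R d)\<close> and the resolvent identity applies. The factor \<open>c\<close> in
  \<open>F\<close> is absorbed in this way, and the constant involves only \<open>p a\<close> and
  \<open>B\<close>.\<close>

lemma F_lipschitz:
  assumes "q \<le> cmod c" "q \<le> cmod d" "p (R c) \<le> B" "p (R d) \<le> B" "0 \<le> B"
  shows "p (F c - F d) \<le> p a * B\<^sup>2 * cmod (c - d)"
proof -
  have F: "eqv (F c) (1 + a * R c)" if "q \<le> cmod c" for c
  proof -
    have "F c = (emb c - a) * R c + a * R c" by (simp add: F_def algebra_simps)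
    moreover have "eqv ((emb c - a) * R c + a * R c) (1 + a * R c)"
      using that by (intro eqv_add right_inverse eqv_refl)
    ultimately show ?thesis by simp
  qed
  have "eqv (F c - F d) ((1 + a * R c) - (1 + a * R d))" using assms by (intro eqv_diff F)
  also have "(1 + a * R c) - (1 + a * R d) = a * (R c - R d)" by (simp add: algebra_simps)
  also have "eqv (a * (R c - R d)) (a * (emb (d - c) * (R c * R d)))"
    using assms by (intro eqv_mult_left resolvent_identity)
  finally have "p (F c - F d) = p (a * (emb (d - c) * (R c * R d)))" by (rule p_cong)
  also have "\<dots> \<le> p a * (cmod (d - c) * (p (R c) * p (R d)))"
    by (intro order_trans[OF p_mult] mult_left_mono order_trans[OF p_emb] p_mult p_nonneg norm_ge_zero)
  also have "\<dots> \<le> p a * (cmod (d - c) * (B * B))"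
    using assms p_nonneg by (intro mult_left_mono mult_mono) auto
  finally show ?thesis by (simp add: power2_eq_square norm_minus_commute mult_ac)
qed

definition root_mean :: "nat \<Rightarrow> real \<Rightarrow> 'r"
  where "root_mean n r = emb (1 / of_nat n) * (\<Sum>k<n. F (of_real r * exp (2 * of_real pi * \<i> * of_nat k / of_nat n)))"

lemma norm_root: "0 \<le> r \<Longrightarrow> cmod (of_real r * exp (2 * of_real pi * \<i> * of_nat k / of_nat n)) = r"
  by (simp add: norm_mult)

text \<open>At a point \<open>z\<close> with \<open>z ^ n = r ^ n\<close> the product of
  \<open>F z\<close> and \<open>r ^ n - a ^ n\<close> is the sum of \<open>z ^ (n - j) a ^ j\<close>
  over \<open>j < n\<close>. The mean over all such \<open>z\<close> keeps only
  \<open>j = 0\<close>, because the power sums of the roots of unity with exponents 1 to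
  \<open>n - 1\<close> vanish.\<close>

lemma root_mean_inverse:
  assumes "q \<le> r" "1 \<le> n"
  shows "eqv (root_mean n r * (1 - emb (1 / of_real r ^ n) * a ^ n)) 1"
proof -
  let ?w = "\<lambda>k. exp (2 * complex_of_real pi * \<i> * of_nat k / of_nat n)"
  let ?z = "\<lambda>k. complex_of_real r * ?w k"
  have r: "r > 0" using assms(1) q by simp
  have zn: "?z k ^ n = of_real r ^ n" for k
    using complex_root_unity[of n k] assms(2) by (simp add: power_mult_distrib)
  have step: "eqv (F (?z k) * (emb (of_real r ^ n) - a ^ n)) (\<Sum>j<n. emb (?z k ^ (n - j)) * a ^ j)" for k
  proof -
    let ?G = "\<Sum>j<n. emb (?z k ^ (n - 1 - j)) * a ^ j"
    have "F (?z k) * (emb (of_real r ^ n) - a ^ n) = emb (?z k) * ((R (?z k) * (emb (?z k) - a)) * ?G)"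
      unfolding F_def zn[of k, symmetric] power_difference_factor by (simp only: mult.assoc)
    also have "eqv (emb (?z k) * ((R (?z k) * (emb (?z k) - a)) * ?G)) (emb (?z k) * (1 * ?G))"
      using norm_root[of r k n] r assms(1) by (intro eqv_mult_left eqv_mult_right left_inverse) simp
    also have "emb (?z k) * (1 * ?G) = (\<Sum>j<n. emb (?z k ^ (n - j)) * a ^ j)"
    proof -
      have "emb (?z k) * (emb (?z k ^ (n - 1 - j)) * a ^ j) = emb (?z k ^ (n - j)) * a ^ j" if "j < n" for j
      proof -
        have "n - j = Suc (n - 1 - j)" using that by simp
        then show ?thesis by (simp only: power_Suc emb_mult mult.assoc)
      qed
      then show ?thesis by (simp add: sum_distrib_left)
    qed
    finally show ?thesis .
  qed
  have "(\<Sum>k<n. F (?z k)) * (emb (of_real r ^ n) - a ^ n) = (\<Sum>k<n. F (?z k) * (emb (of_real r ^ n) - a ^ n))"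
    by (simp add: sum_distrib_right)
  also have "eqv \<dots> (\<Sum>k<n. \<Sum>j<n. emb (?z k ^ (n - j)) * a ^ j)" by (intro eqv_sum step)
  also have "(\<Sum>k<n. \<Sum>j<n. emb (?z k ^ (n - j)) * a ^ j) = (\<Sum>j<n. emb (\<Sum>k<n. ?z k ^ (n - j)) * a ^ j)"
    by (subst sum.swap) (simp add: emb_sum sum_distrib_right)
  also have "\<dots> = (\<Sum>j<n. if j = 0 then emb (of_nat n * of_real r ^ n) else 0)"
  proof (intro sum.cong refl)
    fix j assume j: "j \<in> {..<n}"
    show "emb (\<Sum>k<n. ?z k ^ (n - j)) * a ^ j = (if j = 0 then emb (of_nat n * of_real r ^ n) else 0)"
    proof (cases "j = 0")
      case True
      then show ?thesis by (simp only: zn diff_zero sum_constant card_lessThan) simp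
    next
      case False
      then have "(\<Sum>k<n. ?z k ^ (n - j)) = of_real r ^ (n - j) * (\<Sum>k<n. ?w k ^ (n - j))"
        by (simp add: power_mult_distrib sum_distrib_left)
      also have "\<dots> = 0" using False j by (subst sum_root_unity_powers) auto
      finally show ?thesis using False by (simp add: emb_0)
    qed
  qed
  also have "\<dots> = emb (of_nat n * of_real r ^ n)" using assms(2) by (simp add: sum.delta)
  finally have *: "eqv ((\<Sum>k<n. F (?z k)) * (emb (of_real r ^ n) - a ^ n)) (emb (of_nat n * of_real r ^ n))" .
  let ?t = "1 / complex_of_real r ^ n"
  have t: "emb ?t * emb (of_real r ^ n) = 1" using r by (simp add: emb_mult[symmetric] emb_1)
  have "root_mean n r * (1 - emb ?t * a ^ n) = root_mean n r * (emb ?t * (emb (of_real r ^ n) - a ^ n))"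
    by (simp add: right_diff_distrib t)
  also have "\<dots> = emb (1 / of_nat n * ?t) * ((\<Sum>k<n. F (?z k)) * (emb (of_real r ^ n) - a ^ n))"
    unfolding root_mean_def emb_mult mult.assoc emb_left_commute[of "sum f A" for f A] ..
  also have "eqv \<dots> (emb (1 / of_nat n * ?t) * emb (of_nat n * of_real r ^ n))"
    by (rule eqv_mult_left[OF *])
  also have "emb (1 / of_nat n * ?t) * emb (of_nat n * of_real r ^ n) = 1"
    using r assms(2) by (simp add: emb_mult[symmetric] emb_1)
  finally show ?thesis .
qed

lemma p_root_mean_le:
  assumes "1 \<le> n" "\<And>k. p (f k) \<le> b"
  shows "p (emb (1 / of_nat n) * (\<Sum>k<n. f k)) \<le> b"
proof -
  have "p (emb (1 / of_nat n) * (\<Sum>k<n. f k)) \<le> cmod (1 / of_nat n) * p (\<Sum>k<n. f k)" by (rule p_emb)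
  also have "\<dots> \<le> 1 / real n * (\<Sum>k<n. b)"
    using assms by (intro mult_mono order_trans[OF p_sum] sum_mono) (auto simp: norm_divide p_nonneg)
  also have "\<dots> = b" using assms(1) by simp
  finally show ?thesis .
qed

definition power_bound :: "real \<Rightarrow> bool"
  where "power_bound r \<longleftrightarrow> (\<exists>C. \<forall>n. p (a ^ n) \<le> C * r ^ n)"

lemma power_boundI:
  assumes r: "r > 0" and ev: "eventually (\<lambda>n. p (a ^ n) \<le> C * r ^ n) sequentially"
  shows "power_bound r"
proof -
  obtain N where N: "\<And>n. n \<ge> N \<Longrightarrow> p (a ^ n) \<le> C * r ^ n" using ev by (auto simp: eventually_sequentially)
  define C' where "C' = \<bar>C\<bar> + (\<Sum>n<N. p (a ^ n) / r ^ n)"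
  have s: "0 \<le> (\<Sum>n<N. p (a ^ n) / r ^ n)" using r p_nonneg by (intro sum_nonneg) auto
  have "p (a ^ n) \<le> C' * r ^ n" for n
  proof (cases "n < N")
    case True
    have "p (a ^ n) / r ^ n \<le> (\<Sum>n<N. p (a ^ n) / r ^ n)"
      using True r p_nonneg by (intro member_le_sum[of n "{..<N}" "\<lambda>n. p (a ^ n) / r ^ n"]) auto
    then have "p (a ^ n) / r ^ n \<le> C'" by (simp add: C'_def)
    then show ?thesis using r by (simp add: pos_divide_le_eq)
  next
    case False
    have "C \<le> C'" using s by (simp add: C'_def)
    then show ?thesis using N[of n] False r by (smt (verit, best) mult_right_mono not_less zero_le_power)
  qed
  then show ?thesis unfolding power_bound_def by blast
qed

text \<open>The step width \<open>h\<close> does not depend on \<open>r'\<close>. At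
  \<open>t = r' + h\<close> the known bound makes \<open>(a / t) ^ n\<close> tend to 0, so the mean
  at \<open>t\<close> is close to 1. The Lipschitz bound carries this, uniformly in
  \<open>n\<close>, to \<open>r\<close> at distance at most \<open>2 * h\<close> from
  \<open>t\<close>, and a mean close to 1 bounds \<open>(a / r) ^ n\<close>.\<close>

lemma power_bound_step:
  assumes bnd: "\<And>c. q \<le> cmod c \<Longrightarrow> cmod c \<le> s + 1 \<Longrightarrow> p (R c) \<le> B" and B: "B > 0"
    and h: "0 < h" "h \<le> 1/2" "2 * h * (p a * B\<^sup>2) \<le> 1/4"
    and r': "power_bound r'" "q \<le> r'" "r' \<le> s" and r: "q \<le> r" "r' - h \<le> r" "r \<le> s"
  shows "power_bound r"
proof (cases "r' \<le> r")
  case True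
  obtain C where C: "\<And>n. p (a ^ n) \<le> C * r' ^ n" using r'(1) by (auto simp: power_bound_def)
  have "p (a ^ n) \<le> \<bar>C\<bar> * r ^ n" for n
    using C[of n] q r' True by (smt (verit, best) mult_mono power_mono zero_le_power)
  then show ?thesis unfolding power_bound_def by blast
next
  case False
  \<comment> \<open>\<open>t\<close> lies strictly above \<open>r'\<close>, so that the powers of
    \<open>r' / t\<close> tend to 0, and is at most \<open>s + 1\<close>, where \<open>B\<close>
    still bounds the inverses.\<close>
  define t where "t = r' + h"
  define L where "L = p a * B\<^sup>2"
  have t: "q \<le> t" "t \<le> s + 1" "r' < t" "0 < r'" "0 < t" "t - r \<le> 2 * h" "r < t"
    using h r' r q False by (auto simp: t_def)
  have L: "0 \<le> L" by (simp add: L_def p_nonneg)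
  have s: "0 \<le> s + 1" using r q by simp
  obtain C where C: "\<And>n. p (a ^ n) \<le> C * r' ^ n" using r'(1) by (auto simp: power_bound_def)
  have "(\<lambda>n. ((s + 1) * B) * (C * (r' / t) ^ n)) \<longlonglongrightarrow> ((s + 1) * B) * (C * 0)"
    using t by (intro tendsto_intros) auto
  then have ev: "eventually (\<lambda>n. ((s + 1) * B) * (C * (r' / t) ^ n) < 1/4) sequentially"
    by (intro order_tendstoD) auto
  have "eventually (\<lambda>n. p (a ^ n) \<le> 1 * r ^ n) sequentially"
    using ev eventually_ge_at_top[of 1]
  proof eventually_elim
    case (elim n)
    let ?z = "\<lambda>r k. complex_of_real r * exp (2 * of_real pi * \<i> * of_nat k / of_nat n)"
    define x y where "x u = emb (1 / of_real u ^ n) * a ^ n" and "y u = root_mean n u" for u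
    have inv: "eqv (y u * (1 - x u)) 1" if "q \<le> u" for u
      unfolding x_def y_def using that elim(2) by (rule root_mean_inverse)
    have pF: "p (F (?z t k)) \<le> (s + 1) * B" for k
    proof -
      have "p (F (?z t k)) \<le> cmod (?z t k) * p (R (?z t k))" unfolding F_def by (rule p_emb)
      also have "\<dots> = t * p (R (?z t k))" using norm_root[of t k n] t by simp
      also have "\<dots> \<le> (s + 1) * B"
        using t s norm_root[of t k n] p_nonneg by (intro mult_mono bnd) auto
      finally show ?thesis .
    qed
    have "p (y t) \<le> (s + 1) * B"
      unfolding y_def root_mean_def using elim(2) pF by (rule p_root_mean_le)
    moreover have "p (x t) \<le> C * (r' / t) ^ n"
    proof -
      have "p (x t) \<le> cmod (1 / of_real t ^ n) * p (a ^ n)" unfolding x_def by (rule p_emb)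
      also have "\<dots> \<le> (1 / t ^ n) * (C * r' ^ n)"
        using t C[of n] by (simp add: norm_divide norm_power divide_right_mono)
      finally show ?thesis by (simp add: power_divide)
    qed
    ultimately have "p (y t * x t) \<le> ((s + 1) * B) * (C * (r' / t) ^ n)"
      using s B by (intro order_trans[OF p_mult] mult_mono) (auto simp: p_nonneg)
    then have yx: "p (y t * x t) \<le> 1/4" using elim(1) by simp
    have "p (y t - 1) = p (y t * x t)"
    proof (rule p_cong)
      have "eqv (y t - y t * (1 - x t)) (y t - 1)" using t by (intro eqv_diff eqv_refl inv)
      then show "eqv (y t - 1) (y t * x t)" by (simp add: algebra_simps eqv_sym)
    qed
    then have y1: "p (y t - 1) \<le> 1/4" using yx by simp
    have "p (F (?z r k) - F (?z t k)) \<le> L * (2 * h)" for k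
    proof -
      have n: "cmod (?z r k) = r" "cmod (?z t k) = t" using r q t by (auto intro!: norm_root)
      have "p (F (?z r k) - F (?z t k)) \<le> p a * B\<^sup>2 * cmod (?z r k - ?z t k)"
        using r t B by (intro F_lipschitz bnd) (auto simp: n)
      also have "?z r k - ?z t k = ?z (r - t) k" by (simp add: left_diff_distrib)
      also have "cmod (?z (r - t) k) = t - r" using t by (simp add: norm_mult flip: of_real_diff)
      also have "p a * B\<^sup>2 * (t - r) \<le> L * (2 * h)" unfolding L_def[symmetric] using t L by (intro mult_left_mono)
      finally show ?thesis .
    qed
    then have "p (emb (1 / of_nat n) * (\<Sum>k<n. F (?z r k) - F (?z t k))) \<le> L * (2 * h)"
      using elim(2) by (intro p_root_mean_le)
    then have "p (y r - y t) \<le> 1/4"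
      using h(3) by (simp add: y_def root_mean_def sum_subtractf right_diff_distrib L_def mult_ac)
    then have yr: "p (y r - 1) \<le> 1/2" using y1 p_add[of "y r - y t" "y t - 1"] by simp
    have "eqv (y r * (1 - x r)) 1" using r by (intro inv)
    \<comment> \<open>The inverse relation becomes \<open>x = (y - 1) - (y - 1) x\<close>, so that
      \<open>p x\<close> is at most \<open>1/2 + p x / 2\<close> and hence at most 1.\<close>
    then have "eqv (y r - y r * (1 - x r) - (y r - 1) * x r) (y r - 1 - (y r - 1) * x r)"
      by (intro eqv_diff eqv_refl)
    then have "eqv (x r) (y r - 1 - (y r - 1) * x r)" by (simp add: algebra_simps)
    then have "p (x r) = p (y r - 1 - (y r - 1) * x r)" by (rule p_cong)
    also have "\<dots> \<le> p (y r - 1) + p (y r - 1) * p (x r)"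
      by (rule order_trans[OF p_diff add_left_mono[OF p_mult]])
    also have "\<dots> \<le> 1/2 + 1/2 * p (x r)"
      using yr by (intro add_mono mult_right_mono p_nonneg)
    finally have px: "p (x r) \<le> 1" by simp
    have "emb (of_real r ^ n) * x r = emb (of_real r ^ n * (1 / of_real r ^ n)) * a ^ n"
      unfolding x_def emb_mult by (simp only: mult.assoc)
    then have "a ^ n = emb (of_real r ^ n) * x r" using r q by (simp add: emb_1)
    then have "p (a ^ n) \<le> cmod (of_real r ^ n) * p (x r)" using p_emb by metis
    also have "\<dots> \<le> r ^ n * 1" using r q px by (intro mult_mono) (auto simp: norm_power p_nonneg)
    finally show "p (a ^ n) \<le> 1 * r ^ n" by simp
  qed
  then show ?thesis by (rule power_boundI[rotated]) (use r q in auto)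
qed

theorem power_bound_q: "power_bound q"
proof -
  define s where "s = max q (p a)"
  obtain B where B: "B > 0" "\<And>c. q \<le> cmod c \<Longrightarrow> cmod c \<le> s + 1 \<Longrightarrow> p (R c) \<le> B"
    using resolvent_bounded by meson
  \<comment> \<open>The second bound gives \<open>2 * h * (p a * B ^ 2) <= 1/4\<close>; together
    with the error 1/4 at \<open>t\<close>, the mean at \<open>r\<close> stays within 1/2 of
    1.\<close>
  define h where "h = min (1/2) (1 / (8 * (p a * B\<^sup>2 + 1)))"
  have L: "0 \<le> p a * B\<^sup>2" by (simp add: p_nonneg)
  have h: "0 < h" "h \<le> 1/2" using L by (auto simp: h_def)
  have "h \<le> 1 / (8 * (p a * B\<^sup>2 + 1))" by (simp add: h_def)
  then have "h * (8 * (p a * B\<^sup>2 + 1)) \<le> 1" using L by (subst (asm) pos_le_divide_eq) auto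
  then have h3: "2 * h * (p a * B\<^sup>2) \<le> 1/4" using h(1) by (simp add: algebra_simps)
  \<comment> \<open>Submultiplicativity supplies the initial rate; descending from it by
    \<open>h\<close> reaches \<open>q\<close> after finitely many steps.\<close>
  have start: "power_bound s"
    unfolding power_bound_def
  proof (intro exI allI)
    fix n
    have "p (a ^ n) \<le> p 1 * p a ^ n"
    proof (induction n)
      case (Suc n)
      have "p (a ^ Suc n) \<le> p a * p (a ^ n)" by (simp add: p_mult)
      also have "\<dots> \<le> p a * (p 1 * p a ^ n)" using Suc p_nonneg by (intro mult_left_mono)
      finally show ?case by (simp add: mult_ac)
    qed simp
    also have "\<dots> \<le> p 1 * s ^ n" by (intro mult_left_mono power_mono) (auto simp: s_def p_nonneg)
    finally show "p (a ^ n) \<le> p 1 * s ^ n" .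
  qed
  have "power_bound (max q (s - real k * h))" for k
  proof (induction k)
    case 0
    then show ?case using start by (simp add: s_def)
  next
    case (Suc k)
    show ?case
      by (rule power_bound_step[OF B(2,1) h h3 Suc]) (use h(1) in \<open>auto simp: s_def algebra_simps add_increasing add_increasing2\<close>)
  qed
  moreover obtain k :: nat where "real k * h > s" using reals_Archimedean3[OF h(1)] by blast
  ultimately show ?thesis using q
    by (metis diff_less_0_iff_less less_eq_real_def less_trans max.absorb1)
qed

end

section \<open>The Calkin algebra\<close>

lemma compact_ops_add: "S \<in> compact_ops \<Longrightarrow> T \<in> compact_ops \<Longrightarrow> (\<lambda>x. S x + T x) \<in> compact_ops"
  unfolding compact_ops_iff
  using noncompactness_add[of S T] noncompactness_nonneg[of "\<lambda>x. S x + T x"]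
  by (auto intro!: bounded_ops_intros antisym dest: bounded_ops_bounded_linear intro: bounded_linear_add)

lemma noncompactness_scaleC:
  assumes "T \<in> bounded_ops"
  shows "noncompactness (\<lambda>x. c *\<^sub>C T x) \<le> cmod c * noncompactness T"
proof -
  have bl: "bounded_linear T" using assms by (rule bounded_ops_bounded_linear)
  have "onorm ((*\<^sub>C) c :: 'a \<Rightarrow> 'a) \<le> cmod c" by (rule onorm_bound) (simp_all add: norm_scaleC)
  moreover have "noncompactness ((*\<^sub>C) c \<circ> T) \<le> onorm ((*\<^sub>C) c :: 'a \<Rightarrow> 'a) * noncompactness T"
    by (rule noncompactness_scale[OF bounded_linear_scaleC bl])
  ultimately show ?thesis
    using noncompactness_nonneg[OF bl] by (simp add: comp_def) (meson mult_right_mono order_trans)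
qed

lemma uminus_eq_scaleC: "- x = (- 1) *\<^sub>C (x::'l::complex_banach)"
  using scaleC_of_real[of "- 1" x] by simp

lemma bounded_ops_uminus: "T \<in> bounded_ops \<Longrightarrow> (\<lambda>x. - T x) \<in> bounded_ops"
  unfolding uminus_eq_scaleC by (rule bounded_ops_intros)

lemma noncompactness_uminus_le: "T \<in> bounded_ops \<Longrightarrow> noncompactness (\<lambda>x. - T x) \<le> noncompactness T"
  unfolding uminus_eq_scaleC using noncompactness_scaleC[of T "- 1"] by simp

lemma noncompactness_uminus: "T \<in> bounded_ops \<Longrightarrow> noncompactness (\<lambda>x. - T x) = noncompactness T"
  using noncompactness_uminus_le[of T] noncompactness_uminus_le[OF bounded_ops_uminus, of T] by simp

lemma compact_ops_uminus: "T \<in> compact_ops \<Longrightarrow> (\<lambda>x. - T x) \<in> compact_ops"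
  by (simp add: compact_ops_iff bounded_ops_uminus noncompactness_uminus)

lemma compact_ops_zero: "(\<lambda>x. 0) \<in> compact_ops"
proof -
  have "noncompactness (\<lambda>x::'a. 0::'a) \<le> 0"
    by (rule noncompactness_le) (auto simp: finitely_covered_def intro!: exI[of _ "{0}"])
  then show ?thesis
    using noncompactness_nonneg[OF bounded_linear_zero[where 'a='a and 'b='a]]
    by (simp add: compact_ops_iff bounded_ops_intros)
qed

lemma compact_ops_compose:
  assumes "S \<in> bounded_ops" "T \<in> bounded_ops" "S \<in> compact_ops \<or> T \<in> compact_ops"
  shows "S \<circ> T \<in> compact_ops"
proof -
  have ST: "S \<circ> T \<in> bounded_ops" using assms(1,2) by (rule bounded_ops_intros)
  have "noncompactness (S \<circ> T) \<le> noncompactness S * noncompactness T"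
    using assms(1,2) by (intro noncompactness_compose bounded_ops_bounded_linear)
  also have "\<dots> = 0" using assms(3) by (auto simp: compact_ops_iff)
  finally show ?thesis
    using ST noncompactness_nonneg[OF bounded_ops_bounded_linear[OF ST]] by (simp add: compact_ops_iff)
qed

lemma ring_bounded_op_ring: "ring (bounded_op_ring :: ('l::complex_banach \<Rightarrow> 'l) ring)"
proof (intro ringI abelian_groupI monoidI)
  fix T :: "'l \<Rightarrow> 'l" assume "T \<in> carrier bounded_op_ring"
  then show "\<exists>S\<in>carrier bounded_op_ring. S \<oplus>\<^bsub>bounded_op_ring\<^esub> T = \<zero>\<^bsub>bounded_op_ring\<^esub>"
    by (intro bexI[of _ "\<lambda>x. - T x"]) (auto simp: bounded_op_ring_def bounded_ops_uminus)
qed (auto simp: bounded_op_ring_def bounded_ops_intros fun_eq_iff bounded_ops_add)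

lemma bounded_op_ring_a_inv:
  assumes "T \<in> bounded_ops"
  shows "\<ominus>\<^bsub>bounded_op_ring\<^esub> T = (\<lambda>x. - T x)"
proof -
  interpret ring "bounded_op_ring :: ('a \<Rightarrow> 'a) ring" by (rule ring_bounded_op_ring)
  show ?thesis
    by (rule minus_equality) (use assms in \<open>auto simp: bounded_op_ring_def bounded_ops_uminus\<close>)
qed

lemma ideal_compact_ops: "ideal (compact_ops :: ('l::complex_banach \<Rightarrow> 'l) set) bounded_op_ring"
proof (rule idealI[OF ring_bounded_op_ring])
  have inv: "inv\<^bsub>add_monoid bounded_op_ring\<^esub> T = (\<lambda>x. - T x)" if "T \<in> compact_ops" for T :: "'l \<Rightarrow> 'l"
    using bounded_op_ring_a_inv[of T] that by (simp add: a_inv_def compact_ops_iff)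
  show "subgroup (compact_ops :: ('l \<Rightarrow> 'l) set) (add_monoid bounded_op_ring)"
  proof
    show "(compact_ops :: ('l \<Rightarrow> 'l) set) \<subseteq> carrier (add_monoid bounded_op_ring)"
      by (auto simp: bounded_op_ring_def compact_ops_iff)
    show "inv\<^bsub>add_monoid bounded_op_ring\<^esub> T \<in> compact_ops" if "T \<in> compact_ops" for T :: "'l \<Rightarrow> 'l"
      using that by (simp only: inv compact_ops_uminus)
  qed (simp_all add: compact_ops_zero compact_ops_add bounded_op_ring_def)
next
  fix S T :: "'l \<Rightarrow> 'l" assume "T \<in> compact_ops" "S \<in> carrier bounded_op_ring"
  then have "T \<in> compact_ops" "T \<in> bounded_ops" "S \<in> bounded_ops"
    by (auto simp: bounded_op_ring_def compact_ops_iff)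
  then show "S \<otimes>\<^bsub>bounded_op_ring\<^esub> T \<in> compact_ops" "T \<otimes>\<^bsub>bounded_op_ring\<^esub> S \<in> compact_ops"
    by (simp_all add: bounded_op_ring_def compact_ops_compose)
qed

lemma calkin_class_eq_iff:
  assumes "S \<in> bounded_ops" "T \<in> bounded_ops"
  shows "calkin_class S = calkin_class T \<longleftrightarrow> (\<lambda>x. S x - T x) \<in> compact_ops"
proof -
  have "S \<ominus>\<^bsub>bounded_op_ring\<^esub> T = (\<lambda>x. S x - T x)"
    unfolding a_minus_def bounded_op_ring_a_inv[OF assms(2)] by (simp add: bounded_op_ring_def)
  then show ?thesis
    using ring.quotient_eq_iff_same_a_r_cos[OF ring_bounded_op_ring ideal_compact_ops, of S T] assms
    by (simp add: calkin_class_def) (simp add: bounded_op_ring_def)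
qed

lemma carrier_calkin_algebra: "carrier calkin_algebra = calkin_class ` bounded_ops"
  by (auto simp: calkin_algebra_def FactRing_def A_RCOSETS_def' calkin_class_def bounded_op_ring_def)

lemma one_calkin_algebra: "\<one>\<^bsub>calkin_algebra\<^esub> = calkin_class (id :: 'l::complex_banach \<Rightarrow> 'l)"
proof -
  interpret ideal "compact_ops :: ('l \<Rightarrow> 'l) set" bounded_op_ring by (rule ideal_compact_ops)
  have "calkin_class id = (compact_ops :: ('l \<Rightarrow> 'l) set) +>\<^bsub>bounded_op_ring\<^esub> \<one>\<^bsub>bounded_op_ring\<^esub>"
    by (simp add: calkin_class_def) (simp add: bounded_op_ring_def)
  then show ?thesis by (simp add: calkin_algebra_def FactRing_def)
qed

lemma mult_calkin_algebra:
  fixes S T :: "'l::complex_banach \<Rightarrow> 'l"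
  assumes "S \<in> bounded_ops" "T \<in> bounded_ops"
  shows "calkin_class S \<otimes>\<^bsub>calkin_algebra\<^esub> calkin_class T = calkin_class (S \<circ> T)"
proof -
  interpret ideal "compact_ops :: ('l \<Rightarrow> 'l) set" bounded_op_ring by (rule ideal_compact_ops)
  show ?thesis
    using rcoset_mult_add[of S T] assms
    by (simp add: calkin_algebra_def FactRing_def calkin_class_def) (simp add: bounded_op_ring_def)
qed

lemma calkin_class_Units_iff:
  assumes T: "T \<in> bounded_ops"
  shows "calkin_class T \<in> Units calkin_algebra \<longleftrightarrow> invertible_mod_compact T"
proof -
  have "calkin_class R \<otimes>\<^bsub>calkin_algebra\<^esub> calkin_class S = \<one>\<^bsub>calkin_algebra\<^esub> \<longleftrightarrow> (\<lambda>x. R (S x) - x) \<in> compact_ops"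
    if "R \<in> bounded_ops" "S \<in> bounded_ops" for R S :: "'a \<Rightarrow> 'a"
    using that by (simp add: mult_calkin_algebra one_calkin_algebra calkin_class_eq_iff bounded_ops_intros)
  then show ?thesis
    using T unfolding Units_def invertible_mod_compact_def by (auto simp: carrier_calkin_algebra)
qed

lemma essential_spectrum_iff:
  assumes "T \<in> bounded_ops"
  shows "c \<in> essential_spectrum T \<longleftrightarrow> \<not> invertible_mod_compact (\<lambda>x. c *\<^sub>C x - T x)"
  unfolding essential_spectrum_def
  by (simp add: calkin_class_Units_iff assms bounded_ops_intros)

text \<open>The case \<open>n = 1\<close> of the invertibility criterion. The bound gives content to
  the supremum that defines the radius.\<close>

lemma bdd_above_essential_spectrum:
  assumes T: "T \<in> bounded_ops"
  shows "bdd_above (insert 0 (cmod ` essential_spectrum T))"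
proof -
  have "cmod d \<le> 4 * noncompactness T" if "d \<in> essential_spectrum T" for d
    using that invertible_mod_compact_of_noncompactness[OF T, of 1 d] T
    by (auto simp: essential_spectrum_iff not_less[symmetric])
  then show ?thesis by (auto intro!: bdd_aboveI2)
qed

lemma invertible_outside_essential_spectral_radius:
  assumes T: "T \<in> bounded_ops" and c: "essential_spectral_radius T < cmod c"
  shows "invertible_mod_compact (\<lambda>x. c *\<^sub>C x - T x)"
proof (rule ccontr)
  assume "\<not> ?thesis"
  then have "c \<in> essential_spectrum T" using T by (simp add: essential_spectrum_iff)
  then have "cmod c \<le> essential_spectral_radius T"
    unfolding essential_spectral_radius_def by (intro cSup_upper bdd_above_essential_spectrum[OF T]) auto
  then show False using c by simp
qed

lemma essential_spectral_radius_le: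
  assumes T: "T \<in> bounded_ops" and "0 \<le> q"
    and "\<And>c. q < cmod c \<Longrightarrow> invertible_mod_compact (\<lambda>x. c *\<^sub>C x - T x)"
  shows "essential_spectral_radius T \<le> q"
  unfolding essential_spectral_radius_def
proof (rule cSup_least)
  fix x assume "x \<in> insert 0 (cmod ` essential_spectrum T)"
  then show "x \<le> q" using assms by (auto simp: essential_spectrum_iff intro: leI)
qed simp

lemma essential_spectral_radius_nonneg: "T \<in> bounded_ops \<Longrightarrow> 0 \<le> essential_spectral_radius T"
  unfolding essential_spectral_radius_def by (intro cSup_upper bdd_above_essential_spectrum) auto

lemma essential_spectral_radius_le_of_powers:
  assumes T: "T \<in> bounded_ops" and q: "0 \<le> q"
    and "\<And>c. q < c \<Longrightarrow> \<exists>n. 4 * noncompactness (T ^^ n) < c ^ n"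
  shows "essential_spectral_radius T \<le> q"
  by (rule essential_spectral_radius_le[OF T q])
    (use assms(3) invertible_mod_compact_of_noncompactness[OF T] in blast)

section \<open>The bounded operators as a seminormed algebra\<close>

typedef (overloaded) 'l bounded_op = "bounded_ops :: ('l::complex_banach \<Rightarrow> 'l) set"
  morphisms apply_op Bounded_op
  using bounded_ops_intros(1) by blast

setup_lifting type_definition_bounded_op

instantiation bounded_op :: (complex_banach) "{ring, monoid_mult}"
begin

lift_definition zero_bounded_op :: "'a bounded_op" is "\<lambda>_. 0" by (rule bounded_ops_intros)
lift_definition one_bounded_op :: "'a bounded_op" is id by (rule bounded_ops_intros)
lift_definition plus_bounded_op :: "'a bounded_op \<Rightarrow> 'a bounded_op \<Rightarrow> 'a bounded_op"
  is "\<lambda>S T x. S x + T x" by (rule bounded_ops_intros)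
lift_definition minus_bounded_op :: "'a bounded_op \<Rightarrow> 'a bounded_op \<Rightarrow> 'a bounded_op"
  is "\<lambda>S T x. S x - T x" by (rule bounded_ops_intros)
lift_definition uminus_bounded_op :: "'a bounded_op \<Rightarrow> 'a bounded_op"
  is "\<lambda>T x. - T x" by (rule bounded_ops_uminus)
lift_definition times_bounded_op :: "'a bounded_op \<Rightarrow> 'a bounded_op \<Rightarrow> 'a bounded_op"
  is "(\<circ>)" by (rule bounded_ops_intros)

instance
  by standard (transfer; auto simp: fun_eq_iff bounded_ops_add)+

end

lemma apply_op_power: "apply_op (T ^ n) = apply_op T ^^ n"
  by (induction n) (auto simp: one_bounded_op.rep_eq times_bounded_op.rep_eq)

lift_definition scalar_op :: "complex \<Rightarrow> 'l::complex_banach bounded_op" is "\<lambda>c x. c *\<^sub>C x"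
  using bounded_ops_intros(2) by (rule bounded_ops_intros)

text \<open>The null ideal of this seminorm consists of the compact operators, by
  \<open>compact_ops_iff\<close>; so congruence here is equality in the Calkin algebra.\<close>

interpretation noncompactness_seminorm:
  seminormed_complex_algebra "\<lambda>T. noncompactness (apply_op T)" scalar_op
proof
  fix S T :: "'a bounded_op" and c d :: complex
  note bl = apply_op[THEN bounded_ops_bounded_linear]
  show "0 \<le> noncompactness (apply_op T)" by (rule noncompactness_nonneg[OF bl])
  show "noncompactness (apply_op (0 :: 'a bounded_op)) = 0"
    unfolding zero_bounded_op.rep_eq using compact_ops_zero compact_ops_iff by blast
  show "noncompactness (apply_op (S + T)) \<le> noncompactness (apply_op S) + noncompactness (apply_op T)"
    unfolding plus_bounded_op.rep_eq by (rule noncompactness_add[OF bl bl])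
  show "noncompactness (apply_op (- T)) = noncompactness (apply_op T)"
    unfolding uminus_bounded_op.rep_eq by (rule noncompactness_uminus[OF apply_op])
  show "noncompactness (apply_op (S * T)) \<le> noncompactness (apply_op S) * noncompactness (apply_op T)"
    unfolding times_bounded_op.rep_eq by (rule noncompactness_compose[OF bl bl])
  show "noncompactness (apply_op (scalar_op c * T)) \<le> cmod c * noncompactness (apply_op T)"
    unfolding times_bounded_op.rep_eq scalar_op.rep_eq comp_def by (rule noncompactness_scaleC[OF apply_op])
  show "scalar_op (c + d) = (scalar_op c + scalar_op d :: 'a bounded_op)"
    by transfer (simp add: fun_eq_iff scaleC_add_left)
  show "scalar_op (c * d) = (scalar_op c * scalar_op d :: 'a bounded_op)"
    by transfer (simp add: fun_eq_iff scaleC_scaleC)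
  show "scalar_op 1 = (1 :: 'a bounded_op)" by transfer (simp add: fun_eq_iff scaleC_one)
  show "T * scalar_op c = scalar_op c * T"
    by transfer (simp add: fun_eq_iff bounded_ops_scaleC)
qed

text \<open>The strict inequality keeps the closed region \<open>cmod c >= q\<close> away from the
  essential spectrum. There some inverse of \<open>c - T\<close> modulo compact operators exists for
  each \<open>c\<close>, and an arbitrary choice of them is all that the locale asks for.\<close>

theorem noncompactness_power_bound:
  assumes T: "T \<in> bounded_ops" and q: "essential_spectral_radius T < q"
  shows "\<exists>C. \<forall>n. noncompactness (T ^^ n) \<le> C * q ^ n"
proof -
  define a where "a = Bounded_op T"
  have a: "apply_op a = T" using T by (simp add: a_def Bounded_op_inverse)
  have q0: "q > 0" using essential_spectral_radius_nonneg[OF T] q by linarith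
  have "\<exists>R. q \<le> cmod c \<longrightarrow> noncompactness_seminorm.eqv ((scalar_op c - a) * R) 1 \<and>
      noncompactness_seminorm.eqv (R * (scalar_op c - a)) 1" for c
  proof (cases "q \<le> cmod c")
    case True
    then obtain R where R: "R \<in> bounded_ops" "(\<lambda>x. (c *\<^sub>C R x - T (R x)) - x) \<in> compact_ops"
      "(\<lambda>x. R (c *\<^sub>C x - T x) - x) \<in> compact_ops"
      using invertible_outside_essential_spectral_radius[OF T, of c] q by (auto simp: invertible_mod_compact_def)
    have "apply_op (Bounded_op R) = R" using R(1) by (rule Bounded_op_inverse)
    then show ?thesis
      using R(2,3) by (intro exI[of _ "Bounded_op R"])
        (simp add: noncompactness_seminorm.eqv_def minus_bounded_op.rep_eq times_bounded_op.rep_eq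
          one_bounded_op.rep_eq scalar_op.rep_eq a compact_ops_iff)
  qed auto
  then obtain R where R: "\<And>c. q \<le> cmod c \<Longrightarrow> noncompactness_seminorm.eqv ((scalar_op c - a) * R c) 1"
      "\<And>c. q \<le> cmod c \<Longrightarrow> noncompactness_seminorm.eqv (R c * (scalar_op c - a)) 1" by metis
  interpret resolvent_outside_disc "\<lambda>T. noncompactness (apply_op T)" scalar_op a q R
    by unfold_locales (use q0 R in auto)
  show ?thesis using power_bound_q by (simp add: power_bound_def apply_op_power a)
qed

section \<open>Kernel operators on Banach function spaces\<close>

lemma nonneg_Reals_iff_cmod: "z \<in> \<real>\<^sub>\<ge>\<^sub>0 \<longleftrightarrow> z = of_real (cmod z)"
  by (metis complex_eq_iff complex_is_Real_iff complex_nonneg_Reals_iff norm_ge_zero norm_of_real abs_of_nonneg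
      nonneg_Reals_of_real_iff of_real_Re)

text \<open>An infinite \<open>a\<close> is compatible with the premises only for
  \<open>r = 0\<close>, where both sides vanish.\<close>

lemma ennreal_mult_enn2real_eq:
  "a * ennreal r < \<infinity> \<Longrightarrow> 0 \<le> r \<Longrightarrow> ennreal (enn2real a * r) = a * ennreal r"
  by (cases a) (auto simp: ennreal_mult ennreal_top_mult split: if_splits)

section \<open>The order structure of a Banach function space\<close>

context banach_function_space
begin

interpretation MM: pair_sigma_finite M M ..

abbreviation P :: "'l set" where "P \<equiv> positive_cone M rep"

text \<open>Values in \<open>[0, \<infinity>]\<close>, although always finite, can be integrated
  against kernels and compared a.e. without integrability conditions.\<close>

definition modulus :: "'l \<Rightarrow> 'a \<Rightarrow> ennreal" where "modulus f x = ennreal (cmod (rep f x))"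

declare rep_measurable [measurable]

lemma modulus_measurable [measurable]: "modulus f \<in> borel_measurable M"
  unfolding modulus_def[abs_def] by measurable

lemma rep_0: "AE x in M. rep 0 x = 0"
  using rep_scaleC[of 0 0] by (simp add: scaleC_zero_left)

lemma rep_scaleR: "AE x in M. rep (r *\<^sub>R f) x = of_real r * rep f x"
  using rep_scaleC[of "of_real r" f] by (simp add: scaleC_of_real)

lemma rep_uminus: "AE x in M. rep (- f) x = - rep f x"
  using rep_scaleC[of "- 1" f] by (simp flip: uminus_eq_scaleC)

lemma rep_diff: "AE x in M. rep (f - g) x = rep f x - rep g x"
  using rep_add[of f "- g"] rep_uminus[of g] by eventually_elim simp

lemma norm_mono: "AE x in M. modulus g x \<le> modulus f x \<Longrightarrow> norm g \<le> norm f"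
proof -
  assume "AE x in M. modulus g x \<le> modulus f x"
  then have "AE x in M. cmod (rep g x) \<le> cmod (rep f x)" by (simp add: modulus_def)
  from solid[OF rep_measurable this] obtain h where "AE x in M. rep h x = rep g x" "norm h \<le> norm f" by blast
  with rep_inject show ?thesis by blast
qed

lemma positive_cone_iff: "f \<in> P \<longleftrightarrow> (AE x in M. rep f x = of_real (cmod (rep f x)))"
  by (simp add: positive_cone_def nonneg_Reals_iff_cmod)

lemma positive_cone_add:
  assumes "f \<in> P" "g \<in> P" shows "f + g \<in> P"
  unfolding positive_cone_def mem_Collect_eq
  using rep_add[of f g] assms[unfolded positive_cone_def mem_Collect_eq] by eventually_elim (simp add: nonneg_Reals_add_I)

lemma positive_cone_scaleR:
  assumes "f \<in> P" "0 \<le> r" shows "r *\<^sub>R f \<in> P"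
  unfolding positive_cone_def mem_Collect_eq
  using rep_scaleR[of r f] assms(1)[unfolded positive_cone_def mem_Collect_eq]
  by eventually_elim (simp add: nonneg_Reals_mult_I assms(2))

lemma positive_cone_0: "0 \<in> P"
  unfolding positive_cone_def mem_Collect_eq using rep_0 by eventually_elim simp

lemma positive_cone_sum: "(\<And>i. i \<in> I \<Longrightarrow> f i \<in> P) \<Longrightarrow> sum f I \<in> P"
  by (induction I rule: infinite_finite_induct) (auto simp: positive_cone_0 positive_cone_add)

lemma modulus_add_le: "AE x in M. modulus (f + g) x \<le> modulus f x + modulus g x"
  using rep_add[of f g]
  by eventually_elim (simp add: modulus_def norm_triangle_ineq flip: ennreal_plus)

lemma modulus_add:
  assumes "f \<in> P" "g \<in> P"
  shows "AE x in M. modulus (f + g) x = modulus f x + modulus g x"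
  using rep_add[of f g] assms[unfolded positive_cone_iff]
proof eventually_elim
  case (elim x)
  have "cmod (rep f x + rep g x) = cmod (of_real (cmod (rep f x) + cmod (rep g x)))"
    using elim by simp
  then show ?case using elim(1) by (simp add: modulus_def flip: ennreal_plus del: of_real_add)
qed

lemma modulus_scaleR: "AE x in M. modulus (r *\<^sub>R f) x = ennreal \<bar>r\<bar> * modulus f x"
  using rep_scaleR[of r f] by eventually_elim (simp add: modulus_def norm_mult ennreal_mult)

lemma modulus_sum:
  assumes "finite I" "\<And>i. i \<in> I \<Longrightarrow> f i \<in> P"
  shows "AE x in M. modulus (sum f I) x = (\<Sum>i\<in>I. modulus (f i) x)"
  using assms
proof (induction I rule: finite_induct)
  case empty
  show ?case using rep_0 by eventually_elim (simp add: modulus_def)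
next
  case (insert i I)
  then have "AE x in M. modulus (sum f I) x = (\<Sum>i\<in>I. modulus (f i) x)" by blast
  moreover have "AE x in M. modulus (f i + sum f I) x = modulus (f i) x + modulus (sum f I) x"
    using insert.prems by (intro modulus_add positive_cone_sum) auto
  ultimately show ?case unfolding sum.insert[OF insert.hyps] by eventually_elim simp
qed

lemma positive_cone_diff_iff:
  assumes "f \<in> P" "g \<in> P"
  shows "g - f \<in> P \<longleftrightarrow> (AE x in M. modulus f x \<le> modulus g x)"
proof -
  have "AE x in M. rep (g - f) x \<in> \<real>\<^sub>\<ge>\<^sub>0 \<longleftrightarrow> modulus f x \<le> modulus g x"
    using rep_diff[of g f] assms[unfolded positive_cone_iff]
  proof eventually_elim
    case (elim x)
    have "rep (g - f) x = of_real (cmod (rep g x) - cmod (rep f x))"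
      using elim by simp
    then show ?case by (simp add: modulus_def del: of_real_diff)
  qed
  then show ?thesis
    unfolding positive_cone_def mem_Collect_eq by (auto elim: eventually_elim2)
qed

text \<open>Solidity for extended functions: \<open>u\<close> is finite a.e. because it is
  dominated, so passing to \<open>enn2real\<close> loses nothing.\<close>

lemma positive_element:
  assumes u: "u \<in> borel_measurable M" and le: "AE x in M. u x \<le> modulus f x"
  obtains g where "g \<in> P" "AE x in M. modulus g x = u x"
proof -
  let ?u = "\<lambda>x. complex_of_real (enn2real (u x))"
  have fin: "AE x in M. u x < \<infinity>" using le by eventually_elim (auto simp: modulus_def le_less_trans)
  have "?u \<in> borel_measurable M" using u by measurable
  moreover have "AE x in M. cmod (?u x) \<le> cmod (rep f x)"
    using le by eventually_elim (auto simp: modulus_def intro: enn2real_leI)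
  ultimately obtain g where g: "AE x in M. rep g x = ?u x" using solid by blast
  show ?thesis
  proof (rule that)
    show "g \<in> P" unfolding positive_cone_iff using g by eventually_elim simp
    show "AE x in M. modulus g x = u x" using g fin by eventually_elim (simp add: modulus_def)
  qed
qed

lemma absolute_value:
  obtains g where "g \<in> P" "AE x in M. modulus g x = modulus f x" "norm g = norm f"
proof -
  obtain g where g: "g \<in> P" "AE x in M. modulus g x = modulus f x"
    using positive_element[OF modulus_measurable, of f f] by auto
  have "norm g = norm f"
    using g(2) by (intro antisym norm_mono) (auto elim: eventually_mono)
  with g that show ?thesis by blast
qed

lemma positive_decomposition:
  obtains f1 f2 f3 f4 where "f1 \<in> P" "f2 \<in> P" "f3 \<in> P" "f4 \<in> P" "f = f1 - f2 + \<i> *\<^sub>C (f3 - f4)"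
    "norm f1 \<le> norm f" "norm f2 \<le> norm f" "norm f3 \<le> norm f" "norm f4 \<le> norm f"
    "\<And>g. g \<in> {f1, f2, f3, f4} \<Longrightarrow> AE x in M. modulus g x \<le> modulus f x"
proof -
  have *: "\<exists>g\<in>P. (AE x in M. rep g x = of_real (max 0 (h (rep f x)))) \<and> norm g \<le> norm f \<and>
      (AE x in M. modulus g x \<le> modulus f x)"
    if h: "h \<in> borel_measurable borel" "\<And>z. \<bar>h z\<bar> \<le> cmod z" for h :: "complex \<Rightarrow> real"
  proof -
    have hz: "h z \<le> cmod z" for z using h(2)[of z] by linarith
    then have bnd: "max 0 (h z) \<le> cmod z" for z by simp
    have "(\<lambda>x. complex_of_real (max 0 (h (rep f x)))) \<in> borel_measurable M" using h(1) by measurable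
    moreover have "AE x in M. cmod (of_real (max 0 (h (rep f x)))) \<le> cmod (rep f x)" using bnd by simp
    ultimately obtain g where g: "AE x in M. rep g x = of_real (max 0 (h (rep f x)))" "norm g \<le> norm f"
      using solid by blast
    have "g \<in> P" unfolding positive_cone_iff using g(1) by eventually_elim simp
    moreover have "AE x in M. modulus g x \<le> modulus f x"
      using g(1) by eventually_elim (simp add: modulus_def hz)
    ultimately show ?thesis using g by blast
  qed
  obtain f1 where f1: "f1 \<in> P" "AE x in M. rep f1 x = of_real (max 0 (Re (rep f x)))" "norm f1 \<le> norm f"
    "AE x in M. modulus f1 x \<le> modulus f x" using *[of Re] by (auto simp: abs_Re_le_cmod)
  obtain f2 where f2: "f2 \<in> P" "AE x in M. rep f2 x = of_real (max 0 (- Re (rep f x)))" "norm f2 \<le> norm f"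
    "AE x in M. modulus f2 x \<le> modulus f x" using *[of "\<lambda>z. - Re z"] by (auto simp: abs_Re_le_cmod)
  obtain f3 where f3: "f3 \<in> P" "AE x in M. rep f3 x = of_real (max 0 (Im (rep f x)))" "norm f3 \<le> norm f"
    "AE x in M. modulus f3 x \<le> modulus f x" using *[of Im] by (auto simp: abs_Im_le_cmod)
  obtain f4 where f4: "f4 \<in> P" "AE x in M. rep f4 x = of_real (max 0 (- Im (rep f x)))" "norm f4 \<le> norm f"
    "AE x in M. modulus f4 x \<le> modulus f x" using *[of "\<lambda>z. - Im z"] by (auto simp: abs_Im_le_cmod)
  have "f = f1 - f2 + \<i> *\<^sub>C (f3 - f4)"
  proof (rule rep_inject)
    show "AE x in M. rep f x = rep (f1 - f2 + \<i> *\<^sub>C (f3 - f4)) x"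
      using rep_add[of "f1 - f2" "\<i> *\<^sub>C (f3 - f4)"] rep_diff[of f1 f2] rep_diff[of f3 f4]
        rep_scaleC[of \<i> "f3 - f4"] f1(2) f2(2) f3(2) f4(2)
      by eventually_elim (auto simp: complex_eq_iff max_def)
  qed
  with f1 f2 f3 f4 that[of f1 f2 f3 f4] show ?thesis by auto
qed

text \<open>The point \<open>max 0 (Re z)\<close> is the nearest one to \<open>z\<close> on the
  half-line of nonnegative reals, so \<open>?u\<close> is dominated by every \<open>l - f n\<close>.
  By solidity it represents an element of norm at most \<open>norm (l - f n)\<close> for all
  \<open>n\<close>, hence zero. No a.e. convergent subsequence has to be extracted.\<close>

lemma closed_positive_cone: "closed P"
  unfolding closed_sequential_limits
proof (intro allI impI, elim conjE)
  fix f l assume f: "\<forall>n. f n \<in> P" and lim: "f \<longlonglongrightarrow> l"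
  let ?u = "\<lambda>x. rep l x - of_real (max 0 (Re (rep l x)))"
  have um: "?u \<in> borel_measurable M" by measurable
  have dist: "cmod (z - of_real (max 0 (Re z))) \<le> cmod (z - of_real r)" if "0 \<le> r" for z r
    using that by (auto simp: cmod_def max_def intro!: real_sqrt_le_mono power_mono abs_le_square_iff[THEN iffD1])
  have le: "AE x in M. cmod (?u x) \<le> cmod (rep (l - f n) x)" for n
    using rep_diff[of l "f n"] f[rule_format, of n, unfolded positive_cone_iff]
  proof eventually_elim
    case (elim x)
    have "cmod (?u x) \<le> cmod (rep l x - of_real (cmod (rep (f n) x)))" by (rule dist) simp
    also have "\<dots> = cmod (rep (l - f n) x)" using elim by simp
    finally show ?case .
  qed
  obtain h where h: "AE x in M. rep h x = ?u x" using solid[OF um le[of 0]] by blast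
  have "norm h \<le> norm (l - f n)" for n
  proof (rule norm_mono)
    show "AE x in M. modulus h x \<le> modulus (l - f n) x"
      using h le[of n] by eventually_elim (simp add: modulus_def)
  qed
  moreover have "(\<lambda>n. norm (l - f n)) \<longlonglongrightarrow> norm (l - l)" by (intro tendsto_intros lim)
  ultimately have "norm h \<le> norm (l - l)" by (intro LIMSEQ_le_const) auto
  then have "h = 0" by simp
  with h rep_0 have "AE x in M. rep l x = of_real (max 0 (Re (rep l x)))"
    by (auto elim: eventually_elim2)
  then show "l \<in> P" unfolding positive_cone_iff by eventually_elim (metis max.cobounded1 norm_of_real abs_of_nonneg)
qed

text \<open>Kernels take values in \<open>[0, \<infinity>]\<close>, so that they can be composed without any finiteness argument.\<close>

definition kernel_operator :: "('a \<times> 'a \<Rightarrow> ennreal) \<Rightarrow> ('l \<Rightarrow> 'l) \<Rightarrow> bool"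
  where "kernel_operator k T \<longleftrightarrow> k \<in> borel_measurable (M \<Otimes>\<^sub>M M) \<and> clinear T \<and>
    (\<forall>f\<in>P. T f \<in> P \<and> (AE x in M. modulus (T f) x = (\<integral>\<^sup>+ y. k (x, y) * modulus f y \<partial>M)))"

lemma kernel_operator_measurable: "kernel_operator k T \<Longrightarrow> k \<in> borel_measurable (M \<Otimes>\<^sub>M M)"
  and kernel_operator_clinear: "kernel_operator k T \<Longrightarrow> clinear T"
  and kernel_operator_positive: "kernel_operator k T \<Longrightarrow> f \<in> P \<Longrightarrow> T f \<in> P"
  and kernel_operator_modulus: "kernel_operator k T \<Longrightarrow> f \<in> P \<Longrightarrow>
    AE x in M. modulus (T f) x = (\<integral>\<^sup>+ y. k (x, y) * modulus f y \<partial>M)"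
  by (auto simp: kernel_operator_def)

section \<open>Kernel representation, boundedness and composition\<close>

lemma clinear_add: "clinear T \<Longrightarrow> T (x + y) = T x + T y"
  and clinear_scaleC: "clinear T \<Longrightarrow> T (c *\<^sub>C x) = c *\<^sub>C T x"
  by (auto simp: clinear_iff)

text \<open>Every element is a complex combination of four positive ones, and the elements that
  satisfy the integral formula off a null set form a complex subspace.\<close>

lemma kernel_integral_combination:
  assumes a[measurable]: "a \<in> borel_measurable (M \<Otimes>\<^sub>M M)" and T: "clinear T"
    and base: "\<And>f. f \<in> P \<Longrightarrow> AE x in M. integrable M (\<lambda>y. a (x, y) * rep f y) \<and>
      rep (T f) x = (\<integral>y. a (x, y) * rep f y \<partial>M)"
  shows "has_kernel M rep T a"
proof -
  define Q where "Q f \<longleftrightarrow> (AE x in M. integrable M (\<lambda>y. a (x, y) * rep f y) \<and>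
      rep (T f) x = (\<integral>y. a (x, y) * rep f y \<partial>M))" for f
  have Q_add: "Q (f + g)" if "Q f" "Q g" for f g
    using that[unfolded Q_def] rep_add[of "T f" "T g"] AE_space unfolding Q_def
  proof eventually_elim
    case (elim x)
    have ae: "AE y in M. a (x, y) * rep f y + a (x, y) * rep g y = a (x, y) * rep (f + g) y"
      using rep_add[of f g] by eventually_elim (simp add: algebra_simps)
    have m[measurable]: "(\<lambda>y. a (x, y)) \<in> borel_measurable M"
      using elim by (intro measurable_Pair2[OF a])
    have i: "integrable M (\<lambda>y. a (x, y) * rep f y + a (x, y) * rep g y)" using elim by simp
    then have "integrable M (\<lambda>y. a (x, y) * rep (f + g) y)"
      by (subst integrable_cong_AE[OF _ _ ae, symmetric]) (auto)
    moreover have "(\<integral>y. a (x, y) * rep (f + g) y \<partial>M) = (\<integral>y. a (x, y) * rep f y + a (x, y) * rep g y \<partial>M)"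
      by (rule integral_cong_AE[OF _ _ ae, symmetric]) auto
    ultimately show ?case using elim by (simp add: clinear_add[OF T])
  qed
  have Q_scale: "Q (c *\<^sub>C f)" if "Q f" for f c
    using that[unfolded Q_def] rep_scaleC[of c "T f"] AE_space unfolding Q_def
  proof eventually_elim
    case (elim x)
    have ae: "AE y in M. c * (a (x, y) * rep f y) = a (x, y) * rep (c *\<^sub>C f) y"
      using rep_scaleC[of c f] by eventually_elim (simp add: algebra_simps)
    have m[measurable]: "(\<lambda>y. a (x, y)) \<in> borel_measurable M"
      using elim by (intro measurable_Pair2[OF a])
    have i: "integrable M (\<lambda>y. c * (a (x, y) * rep f y))" using elim by simp
    then have "integrable M (\<lambda>y. a (x, y) * rep (c *\<^sub>C f) y)"
      by (subst integrable_cong_AE[OF _ _ ae, symmetric]) (auto)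
    moreover have "(\<integral>y. a (x, y) * rep (c *\<^sub>C f) y \<partial>M) = (\<integral>y. c * (a (x, y) * rep f y) \<partial>M)"
      by (rule integral_cong_AE[OF _ _ ae, symmetric]) auto
    ultimately show ?case using elim by (simp add: clinear_scaleC[OF T])
  qed
  have "Q f" for f
  proof -
    obtain f1 f2 f3 f4 where f: "f1 \<in> P" "f2 \<in> P" "f3 \<in> P" "f4 \<in> P" "f = f1 - f2 + \<i> *\<^sub>C (f3 - f4)"
      by (rule positive_decomposition)
    have "f = (f1 + (- 1) *\<^sub>C f2) + \<i> *\<^sub>C (f3 + (- 1) *\<^sub>C f4)" by (simp add: f(5) flip: uminus_eq_scaleC)
    moreover have "Q f1" "Q f2" "Q f3" "Q f4" using base f(1-4) by (auto simp: Q_def)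
    ultimately show ?thesis using Q_add Q_scale by metis
  qed
  then show ?thesis using a by (simp add: has_kernel_def Q_def)
qed

text \<open>Where \<open>k (x, y)\<close> is infinite, finiteness of the integral forces
  \<open>f y = 0\<close> for almost all such \<open>y\<close>; so \<open>enn2real\<close> may send
  the value to 0.\<close>

lemma kernel_operator_has_kernel:
  assumes k: "kernel_operator k T"
  shows "has_kernel M rep T (\<lambda>z. complex_of_real (enn2real (k z)))"
proof (rule kernel_integral_combination)
  note km[measurable] = kernel_operator_measurable[OF k]
  show "(\<lambda>z. complex_of_real (enn2real (k z))) \<in> borel_measurable (M \<Otimes>\<^sub>M M)" by measurable
  fix f assume f: "f \<in> P"
  show "AE x in M. integrable M (\<lambda>y. complex_of_real (enn2real (k (x, y))) * rep f y) \<and>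
      rep (T f) x = (\<integral>y. complex_of_real (enn2real (k (x, y))) * rep f y \<partial>M)"
    using kernel_operator_modulus[OF k f] kernel_operator_positive[OF k f, unfolded positive_cone_iff] AE_space
  proof eventually_elim
    case (elim x)
    have m[measurable]: "(\<lambda>y. k (x, y)) \<in> borel_measurable M"
      using elim by (intro measurable_Pair2[OF km])
    let ?r = "\<lambda>y. enn2real (k (x, y)) * cmod (rep f y)"
    have fin: "(\<integral>\<^sup>+ y. k (x, y) * modulus f y \<partial>M) < \<infinity>" using elim(1)[symmetric] by (simp add: modulus_def)
    then have "AE y in M. k (x, y) * modulus f y < \<infinity>"
      using nn_integral_PInf_AE[of "\<lambda>y. k (x, y) * modulus f y" M] by (auto simp: less_top[symmetric])
    then have eq: "AE y in M. ennreal (?r y) = k (x, y) * modulus f y"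
      by eventually_elim (simp add: modulus_def ennreal_mult_enn2real_eq)
    have nn: "(\<integral>\<^sup>+ y. ennreal (?r y) \<partial>M) = modulus (T f) x" using nn_integral_cong_AE[OF eq] elim(1) by simp
    have int: "integrable M ?r" by (rule integrableI_nonneg) (use nn in \<open>auto simp: modulus_def\<close>)
    have "(\<integral>y. ?r y \<partial>M) = cmod (rep (T f) x)"
      by (subst integral_eq_nn_integral) (use nn in \<open>auto simp: modulus_def\<close>)
    moreover have ae: "AE y in M. complex_of_real (?r y) = complex_of_real (enn2real (k (x, y))) * rep f y"
      using f[unfolded positive_cone_iff] by eventually_elim simp
    have "integrable M (\<lambda>y. complex_of_real (enn2real (k (x, y))) * rep f y)"
      by (subst integrable_cong_AE[OF _ _ ae, symmetric]) (use int in \<open>auto simp del: of_real_mult\<close>)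
    moreover have "(\<integral>y. complex_of_real (enn2real (k (x, y))) * rep f y \<partial>M) = (\<integral>y. complex_of_real (?r y) \<partial>M)"
      by (rule integral_cong_AE[OF _ _ ae, symmetric]) auto
    ultimately show ?case using elim(2) by (simp del: of_real_mult)
  qed
qed (rule kernel_operator_clinear[OF k])

lemma has_kernel_kernel_operator:
  assumes hk: "has_kernel M rep T (\<lambda>z. complex_of_real (a z))" and pos: "AE z in M \<Otimes>\<^sub>M M. 0 \<le> a z" and T: "clinear T"
  shows "kernel_operator (\<lambda>z. ennreal (a z)) T"
  unfolding kernel_operator_def
proof (intro conjI ballI T)
  have "(\<lambda>z. Re (complex_of_real (a z))) \<in> borel_measurable (M \<Otimes>\<^sub>M M)"
    using hk unfolding has_kernel_def by (intro measurable_compose[OF _ borel_measurable_Re]) auto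
  then have am[measurable]: "a \<in> borel_measurable (M \<Otimes>\<^sub>M M)" by simp
  show "(\<lambda>z. ennreal (a z)) \<in> borel_measurable (M \<Otimes>\<^sub>M M)" by measurable
  fix f assume f: "f \<in> P"
  have "AE x in M. rep (T f) x = of_real (cmod (rep (T f) x)) \<and>
      modulus (T f) x = (\<integral>\<^sup>+ y. ennreal (a (x, y)) * modulus f y \<partial>M)"
    using hk[unfolded has_kernel_def, THEN conjunct2, rule_format, of f] MM.AE_pair[OF pos] AE_space
  proof eventually_elim
    case (elim x)
    have m[measurable]: "(\<lambda>y. a (x, y)) \<in> borel_measurable M"
      using elim by (intro measurable_Pair2[OF am])
    let ?r = "\<lambda>y. a (x, y) * cmod (rep f y)"
    have ae: "AE y in M. complex_of_real (a (x, y)) * rep f y = complex_of_real (?r y)"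
      using f[unfolded positive_cone_iff] by eventually_elim simp
    have "integrable M (\<lambda>y. complex_of_real (?r y))"
      by (subst integrable_cong_AE[OF _ _ ae, symmetric]) (use elim in auto)
    then have int: "integrable M ?r" by (simp only: complex_of_real_integrable_eq)
    have nn: "AE y in M. 0 \<le> ?r y" using elim(2) by eventually_elim simp
    have "rep (T f) x = (\<integral>y. complex_of_real (?r y) \<partial>M)"
      using elim(1) integral_cong_AE[OF _ _ ae] by simp
    also have "\<dots> = complex_of_real (\<integral>y. ?r y \<partial>M)" by (rule integral_complex_of_real)
    finally have rep: "rep (T f) x = complex_of_real (\<integral>y. ?r y \<partial>M)" .
    have ge: "0 \<le> (\<integral>y. ?r y \<partial>M)" by (rule integral_nonneg_AE[OF nn])
    have "(\<integral>\<^sup>+ y. ennreal (a (x, y)) * modulus f y \<partial>M) = (\<integral>\<^sup>+ y. ennreal (?r y) \<partial>M)"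
      by (intro nn_integral_cong_AE) (use elim(2) in eventually_elim, simp add: modulus_def ennreal_mult)
    also have "\<dots> = ennreal (\<integral>y. ?r y \<partial>M)" by (rule nn_integral_eq_integral[OF int nn])
    finally show ?case using rep ge by (simp add: modulus_def)
  qed
  then show "T f \<in> P" "AE x in M. modulus (T f) x = (\<integral>\<^sup>+ y. ennreal (a (x, y)) * modulus f y \<partial>M)"
    unfolding positive_cone_iff by (auto elim: eventually_mono)
qed

lemma kernel_operator_modulus_le:
  assumes k: "kernel_operator k T"
  shows "AE x in M. modulus (T f) x \<le> (\<integral>\<^sup>+ y. k (x, y) * modulus f y \<partial>M)"
  using kernel_operator_has_kernel[OF k, unfolded has_kernel_def, THEN conjunct2, rule_format, of f]
proof eventually_elim
  case (elim x)
  have "modulus (T f) x \<le> (\<integral>\<^sup>+ y. ennreal (cmod (complex_of_real (enn2real (k (x, y))) * rep f y)) \<partial>M)"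
    using elim integral_norm_bound_ennreal[of M "\<lambda>y. complex_of_real (enn2real (k (x, y))) * rep f y"]
    by (simp add: modulus_def)
  also have "\<dots> \<le> (\<integral>\<^sup>+ y. k (x, y) * modulus f y \<partial>M)"
    by (intro nn_integral_mono)
      (auto simp: modulus_def norm_mult ennreal_mult ennreal_enn2real_if intro!: mult_right_mono)
  finally show ?case .
qed

lemma kernel_operator_modulus_mono:
  assumes k: "kernel_operator k T" and g: "g \<in> P" and le: "AE x in M. modulus f x \<le> modulus g x"
  shows "AE x in M. modulus (T f) x \<le> modulus (T g) x"
  using kernel_operator_modulus_le[OF k, of f] kernel_operator_modulus[OF k g]
proof eventually_elim
  case (elim x)
  have "(\<integral>\<^sup>+ y. k (x, y) * modulus f y \<partial>M) \<le> (\<integral>\<^sup>+ y. k (x, y) * modulus g y \<partial>M)"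
    by (intro nn_integral_mono_AE) (use le in eventually_elim, simp add: mult_left_mono)
  with elim show ?case by simp
qed

text \<open>Automatic boundedness of positive operators. If \<open>T\<close> were unbounded on the
  cone, there would be positive \<open>g n\<close> with summable norms and
  \<open>norm (T (g n)) > n\<close>. Their sum dominates each of them, because the cone is closed,
  so the norm of its image would exceed every \<open>n\<close>.\<close>

lemma kernel_operator_bounded:
  assumes k: "kernel_operator k T"
  shows "T \<in> bounded_ops"
proof -
  note T = kernel_operator_clinear[OF k]
  have T_scaleR: "T (r *\<^sub>R f) = r *\<^sub>R T f" for r f
    using clinear_scaleC[OF T, of "of_real r" f] by (simp add: scaleC_of_real)
  have "\<exists>K. \<forall>f\<in>P. norm (T f) \<le> K * norm f"
  proof (rule ccontr)
    assume contra: "\<not> ?thesis"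
    have "\<exists>g\<in>P. norm g \<le> (1/2) ^ n \<and> norm (T g) > real n" for n
    proof -
      obtain f where f: "f \<in> P" "norm (T f) > (real n * 2 ^ n) * norm f" using contra by (meson not_le)
      have "f \<noteq> 0" using f(2) T_scaleR[of 0 0] by auto
      then show ?thesis
        using f by (intro bexI[of _ "(1 / (2 ^ n * norm f)) *\<^sub>R f"])
          (auto simp: T_scaleR field_simps power_divide intro!: positive_cone_scaleR)
    qed
    then obtain g where g: "\<And>n. g n \<in> P" "\<And>n. norm (g n) \<le> (1/2) ^ n" "\<And>n. norm (T (g n)) > real n" by metis
    have "summable (\<lambda>n. (1/2 :: real) ^ n)" by (rule summable_geometric) simp
    then have sm: "summable (\<lambda>n. norm (g n))" by (rule summable_comparison_test'[of _ 0]) (use g(2) in auto)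
    then have sums: "(\<lambda>n. \<Sum>i<n. g i) \<longlonglongrightarrow> suminf g" using summable_norm_cancel summable_LIMSEQ by blast
    have ge: "suminf g - g n \<in> P" for n
    proof (rule closed_sequentially[OF closed_positive_cone])
      show "(\<Sum>i<Suc n + m. g i) - g n \<in> P" for m
      proof -
        have "(\<Sum>i<Suc n + m. g i) - g n = (\<Sum>i\<in>{..<Suc n + m} - {n}. g i)" by (simp add: sum_diff1)
        then show ?thesis using g(1) by (simp only: positive_cone_sum)
      qed
      have "(\<lambda>m. \<Sum>i<m + Suc n. g i) \<longlonglongrightarrow> suminf g" using sums by (rule LIMSEQ_ignore_initial_segment)
      then show "(\<lambda>m. (\<Sum>i<Suc n + m. g i) - g n) \<longlonglongrightarrow> suminf g - g n"
        by (intro tendsto_intros) (simp only: add.commute)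
    qed
    have G: "suminf g \<in> P" using positive_cone_add[OF ge[of 0] g(1)[of 0]] by simp
    have "norm (T (g n)) \<le> norm (T (suminf g))" for n
      using ge[of n] positive_cone_diff_iff[OF g(1) G] by (intro norm_mono kernel_operator_modulus_mono[OF k G]) simp
    then have "real n < norm (T (suminf g))" for n using g(3)[of n] by (meson less_le_trans)
    then show False using reals_Archimedean2[of "norm (T (suminf g))"] by (meson less_asym)
  qed
  then obtain K where K: "\<And>f. f \<in> P \<Longrightarrow> norm (T f) \<le> K * norm f" by blast
  show ?thesis
  proof (rule bounded_opsI)
    fix f
    obtain g where g: "g \<in> P" "AE x in M. modulus g x = modulus f x" "norm g = norm f" by (rule absolute_value)
    have "norm (T f) \<le> norm (T g)"
      by (intro norm_mono kernel_operator_modulus_mono[OF k g(1)]) (use g(2) in eventually_elim, simp)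
    also have "\<dots> \<le> K * norm f" using K[OF g(1)] g(3) by simp
    finally show "norm (T f) \<le> K * norm f" .
  qed (simp_all add: clinear_add[OF T] clinear_scaleC[OF T])
qed

lemma kernel_operator_compose:
  assumes k: "kernel_operator k S" and l: "kernel_operator l T"
  shows "kernel_operator (\<lambda>z. \<integral>\<^sup>+ w. k (fst z, w) * l (w, snd z) \<partial>M) (S \<circ> T)"
  unfolding kernel_operator_def
proof (intro conjI ballI)
  note [measurable] = kernel_operator_measurable[OF k] kernel_operator_measurable[OF l]
  show "(\<lambda>z. \<integral>\<^sup>+ w. k (fst z, w) * l (w, snd z) \<partial>M) \<in> borel_measurable (M \<Otimes>\<^sub>M M)" by measurable
  show "clinear (S \<circ> T)"
    using kernel_operator_clinear[OF k] kernel_operator_clinear[OF l] by (simp add: clinear_iff)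
  fix f assume f: "f \<in> P"
  note Tf = kernel_operator_positive[OF l f]
  show "(S \<circ> T) f \<in> P" using kernel_operator_positive[OF k Tf] by simp
  show "AE x in M. modulus ((S \<circ> T) f) x =
      (\<integral>\<^sup>+ y. (\<integral>\<^sup>+ w. k (fst (x, y), w) * l (w, snd (x, y)) \<partial>M) * modulus f y \<partial>M)"
    using kernel_operator_modulus[OF k Tf] AE_space
  proof eventually_elim
    case (elim x)
    note km[measurable] = measurable_Pair2[OF kernel_operator_measurable[OF k] elim(2)]
    have "modulus ((S \<circ> T) f) x = (\<integral>\<^sup>+ w. k (x, w) * modulus (T f) w \<partial>M)" using elim by simp
    also have "\<dots> = (\<integral>\<^sup>+ w. k (x, w) * (\<integral>\<^sup>+ y. l (w, y) * modulus f y \<partial>M) \<partial>M)"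
      by (intro nn_integral_cong_AE) (use kernel_operator_modulus[OF l f] in eventually_elim, simp)
    also have "\<dots> = (\<integral>\<^sup>+ w. \<integral>\<^sup>+ y. k (x, w) * (l (w, y) * modulus f y) \<partial>M \<partial>M)"
      by (intro nn_integral_cong nn_integral_cmult[symmetric]) measurable
    also have "\<dots> = (\<integral>\<^sup>+ y. \<integral>\<^sup>+ w. k (x, w) * (l (w, y) * modulus f y) \<partial>M \<partial>M)"
      by (rule MM.Fubini') measurable
    also have "\<dots> = (\<integral>\<^sup>+ y. (\<integral>\<^sup>+ w. k (x, w) * l (w, y) \<partial>M) * modulus f y \<partial>M)"
      by (intro nn_integral_cong) (subst nn_integral_multc[symmetric], auto simp: mult.assoc)
    finally show ?case by simp
  qed
qed

end

section \<open>Positivity and uniqueness of kernels, Hadamard means\<close>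

text \<open>Countable unions of rectangles \<open>F i \<times> {y. k y = i}\<close> over a partition
  of the second factor. Coding the partition by \<open>k\<close> makes the family an algebra:
  complements keep \<open>k\<close>, and unions take a common refinement. Since only countably many
  sets of the second factor occur, the exceptional null sets can be united.\<close>

definition grid_sets :: "'a measure \<Rightarrow> 'b measure \<Rightarrow> ('a \<times> 'b) set set"
  where "grid_sets M N = {A. \<exists>F k. (\<forall>i. F i \<in> sets M) \<and> k \<in> measurable N (count_space (UNIV :: nat set)) \<and>
    A = {z \<in> space (M \<Otimes>\<^sub>M N). fst z \<in> F (k (snd z))}}"

lemma grid_setsE:
  assumes "A \<in> grid_sets M N"
  obtains F k where "\<And>i. F i \<in> sets M" "k \<in> measurable N (count_space (UNIV :: nat set))"
    "A = {z \<in> space (M \<Otimes>\<^sub>M N). fst z \<in> F (k (snd z))}"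
  using assms by (auto simp: grid_sets_def)

lemma grid_sets_sets: "A \<in> grid_sets M N \<Longrightarrow> A \<in> sets (M \<Otimes>\<^sub>M N)"
proof (erule grid_setsE)
  fix F k assume [measurable]: "\<And>i. F i \<in> sets M" "k \<in> measurable N (count_space (UNIV :: nat set))"
    and A: "A = {z \<in> space (M \<Otimes>\<^sub>M N). fst z \<in> F (k (snd z))}"
  have "A = (\<Union>i. {z \<in> space (M \<Otimes>\<^sub>M N). fst z \<in> F i \<and> k (snd z) = i})" by (auto simp: A)
  also have "\<dots> \<in> sets (M \<Otimes>\<^sub>M N)" by measurable
  finally show ?thesis .
qed

lemma rectangle_in_grid_sets:
  assumes "a \<in> sets M" "b \<in> sets N" shows "a \<times> b \<in> grid_sets M N"
proof -
  note [measurable] = assms(2)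
  have "(\<lambda>y. if y \<in> b then 1 else (0::nat)) \<in> measurable N (count_space UNIV)" by measurable
  moreover have "a \<times> b = {z \<in> space (M \<Otimes>\<^sub>M N). fst z \<in> (if (if snd z \<in> b then 1 else (0::nat)) = 1 then a else {})}"
    using assms[THEN sets.sets_into_space] by (auto simp: space_pair_measure split: if_splits)
  ultimately show ?thesis
    unfolding grid_sets_def mem_Collect_eq using assms(1)
    by (intro exI[of _ "\<lambda>i::nat. if i = 1 then a else {}"] exI[of _ "\<lambda>y. if y \<in> b then 1 else (0::nat)"]) auto
qed

lemma grid_sets_Compl: "A \<in> grid_sets M N \<Longrightarrow> space (M \<Otimes>\<^sub>M N) - A \<in> grid_sets M N"
proof (erule grid_setsE)
  fix F k assume Fk: "\<And>i. F i \<in> sets M" "k \<in> measurable N (count_space (UNIV :: nat set))"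
    and A: "A = {z \<in> space (M \<Otimes>\<^sub>M N). fst z \<in> F (k (snd z))}"
  then show ?thesis
    unfolding grid_sets_def mem_Collect_eq
    by (intro exI[of _ "\<lambda>i. space M - F i"] exI[of _ k]) (auto simp: space_pair_measure)
qed

text \<open>The map \<open>prod_encode (k y, l y)\<close> indexes the common refinement of the two
  partitions.\<close>

lemma grid_sets_Un:
  assumes "A \<in> grid_sets M N" "B \<in> grid_sets M N" shows "A \<union> B \<in> grid_sets M N"
proof -
  obtain F k where A: "\<And>i. F i \<in> sets M" "k \<in> measurable N (count_space (UNIV :: nat set))"
    "A = {z \<in> space (M \<Otimes>\<^sub>M N). fst z \<in> F (k (snd z))}" using assms(1) unfolding grid_sets_def by blast
  obtain G l where B: "\<And>i. G i \<in> sets M" "l \<in> measurable N (count_space (UNIV :: nat set))"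
    "B = {z \<in> space (M \<Otimes>\<^sub>M N). fst z \<in> G (l (snd z))}" using assms(2) unfolding grid_sets_def by blast
  note [measurable] = A(2) B(2)
  have "(\<lambda>y. prod_encode (k y, l y)) \<in> measurable N (count_space UNIV)" by measurable
  then show ?thesis
    unfolding grid_sets_def mem_Collect_eq using A B
    by (intro exI[of _ "\<lambda>i. F (fst (prod_decode i)) \<union> G (snd (prod_decode i))"]
        exI[of _ "\<lambda>y. prod_encode (k y, l y)"]) auto
qed

lemma grid_sets_empty: "{} \<in> grid_sets M N"
  using rectangle_in_grid_sets[of "{}" M "{}" N] by simp

text \<open>The sets with this property form a sigma-algebra: complements keep the symmetric
  difference, and a countable union is first cut off at a finite stage, which is possible because
  \<nu> is finite.\<close>

lemma grid_sets_approximate: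
  assumes "finite_measure \<nu>" and sets: "sets \<nu> = sets (M \<Otimes>\<^sub>M N)" and E: "E \<in> sets (M \<Otimes>\<^sub>M N)" and "e > 0"
  shows "\<exists>A\<in>grid_sets M N. measure \<nu> ((E - A) \<union> (A - E)) < e"
proof -
  interpret finite_measure \<nu> by fact
  note gs = grid_sets_sets[of _ M N, folded sets]
  have "E \<in> sigma_sets (space M \<times> space N) {a \<times> b | a b. a \<in> sets M \<and> b \<in> sets N}"
    using E by (simp add: sets_pair_measure)
  then show ?thesis using \<open>e > 0\<close>
  proof (induction E arbitrary: e rule: sigma_sets.induct)
    case (Basic E)
    then show ?case by (auto intro!: bexI[of _ E] rectangle_in_grid_sets)
  next
    case Empty
    then show ?case by (intro bexI[of _ "{}"] grid_sets_empty) simp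
  next
    case (Compl E)
    then obtain A where A: "A \<in> grid_sets M N" "measure \<nu> ((E - A) \<union> (A - E)) < e" by blast
    let ?X = "space (M \<Otimes>\<^sub>M N)"
    have "E \<subseteq> ?X" using Compl.hyps sigma_sets_into_sp[of "{a \<times> b | a b. a \<in> sets M \<and> b \<in> sets N}" "space M \<times> space N"]
      sets.sets_into_space[of _ M] sets.sets_into_space[of _ N] by (fastforce simp: space_pair_measure)
    moreover have "A \<subseteq> ?X" using A(1) grid_sets_sets sets.sets_into_space by blast
    ultimately have "((?X - E) - (?X - A)) \<union> ((?X - A) - (?X - E)) = (E - A) \<union> (A - E)" by auto
    then show ?case using A by (intro bexI[of _ "?X - A"] grid_sets_Compl) (auto simp: space_pair_measure)
  next
    case (Union E)
    have Es: "E i \<in> sets \<nu>" for i using Union.hyps[of i] by (simp add: sets sets_pair_measure)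
    have "(\<lambda>n. measure \<nu> (\<Union>i<n. E i)) \<longlonglongrightarrow> measure \<nu> (\<Union>n. \<Union>i<n. E i)"
    proof (rule finite_Lim_measure_incseq)
      show "range (\<lambda>n. \<Union>i<n. E i) \<subseteq> sets \<nu>" using Es by auto
      show "incseq (\<lambda>n. \<Union>i<n. E i)" by (auto simp: incseq_def) (meson lessThan_iff less_le_trans)
    qed
    moreover have "(\<Union>n. \<Union>i<n. E i) = (\<Union>i. E i)" by auto
    ultimately have "eventually (\<lambda>n. measure \<nu> (\<Union>i. E i) - e/2 < measure \<nu> (\<Union>i<n. E i)) sequentially"
      using Union.prems by (intro order_tendstoD) auto
    then obtain n where n: "measure \<nu> (\<Union>i. E i) - e/2 < measure \<nu> (\<Union>i<n. E i)" by (auto simp: eventually_sequentially)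
    \<comment> \<open>Half of \<open>e\<close> is spent on the tail of the union and half on the
      \<open>n\<close> members kept; \<open>n + 1\<close> covers the case
      \<open>n = 0\<close>.\<close>
    have "\<exists>A\<in>grid_sets M N. measure \<nu> ((E i - A) \<union> (A - E i)) < e / (2 * (real n + 1))" for i
      using Union.prems by (intro Union.IH) simp
    then obtain A where A: "\<And>i. A i \<in> grid_sets M N"
      "\<And>i. measure \<nu> ((E i - A i) \<union> (A i - E i)) < e / (2 * (real n + 1))" by metis
    have AU: "(\<Union>i<m. A i) \<in> grid_sets M N" for m
      by (induction m) (auto simp: lessThan_Suc grid_sets_empty intro: grid_sets_Un A)
    let ?U = "\<Union>i. E i" and ?V = "\<Union>i<n. A i" and ?W = "\<Union>i<n. (E i - A i) \<union> (A i - E i)"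
    have meas: "?U \<in> sets \<nu>" "?V \<in> sets \<nu>" "?W \<in> sets \<nu>" "(\<Union>i<n. E i) \<in> sets \<nu>"
      using Es gs[OF AU] gs[OF A(1)] by auto
    have "measure \<nu> ((?U - ?V) \<union> (?V - ?U)) \<le> measure \<nu> ((?U - (\<Union>i<n. E i)) \<union> ?W)"
      using meas by (intro finite_measure_mono) auto
    also have "\<dots> \<le> measure \<nu> (?U - (\<Union>i<n. E i)) + measure \<nu> ?W"
      using meas by (intro measure_Un_le) auto
    also have "measure \<nu> (?U - (\<Union>i<n. E i)) = measure \<nu> ?U - measure \<nu> (\<Union>i<n. E i)"
      using meas by (intro finite_measure_Diff) auto
    also have "measure \<nu> ?W \<le> (\<Sum>i<n. measure \<nu> ((E i - A i) \<union> (A i - E i)))"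
      using Es gs[OF A(1)] by (intro measure_UNION_le) auto
    also have "(\<Sum>i<n. measure \<nu> ((E i - A i) \<union> (A i - E i))) \<le> (\<Sum>i<n. e / (2 * (real n + 1)))"
      by (intro sum_mono less_imp_le A)
    also have "\<dots> \<le> e/2" using Union.prems by (simp add: field_simps)
    finally have "measure \<nu> ((?U - ?V) \<union> (?V - ?U)) < e" using n by linarith
    then show ?case using AU by blast
  qed
qed

context banach_function_space
begin

interpretation MM: pair_sigma_finite M M ..

text \<open>The hypothesis for single sets \<open>G\<close> gives the integral inequality over all grid sets,
  and these approximate \<open>{c < 0}\<close>.\<close>

lemma AE_pair_nonneg:
  fixes c :: "'a \<times> 'a \<Rightarrow> real"
  assumes c[measurable]: "c \<in> borel_measurable (M \<Otimes>\<^sub>M M)"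
    and int: "AE x in M. integrable M (\<lambda>y. c (x, y))"
    and pos: "\<And>G. G \<in> sets M \<Longrightarrow> AE x in M. 0 \<le> (\<integral>y. indicator G y * c (x, y) \<partial>M)"
  shows "AE z in M \<Otimes>\<^sub>M M. 0 \<le> c z"
proof -
  obtain p where p[measurable]: "p \<in> borel_measurable M" and pint: "integral\<^sup>N M p \<noteq> \<infinity>"
    and p0: "\<And>x. x \<in> space M \<Longrightarrow> 0 < p x \<and> p x < \<infinity>"
    using Ex_finite_integrable_function by blast
  \<comment> \<open>\<open>c\<close> need not be integrable over the product, only along almost
    every \<open>x\<close>. The weight \<open>W\<close> makes \<open>W\<close> times
    \<open>|c|\<close> integrable and vanishes only where \<open>I\<close> is infinite.\<close>
  define I where "I x = (\<integral>\<^sup>+ y. ennreal \<bar>c (x, y)\<bar> \<partial>M)" for x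
  have [measurable]: "I \<in> borel_measurable M" unfolding I_def[abs_def] by measurable
  define W where "W x = p x * inverse (1 + I x)" for x
  have [measurable]: "W \<in> borel_measurable M" unfolding W_def[abs_def] by measurable
  have WI: "W x * I x \<le> p x" for x
  proof -
    have "inverse (1 + I x) * I x \<le> 1"
    proof (cases "I x")
      case (real r)
      then have "inverse (1 + I x) * I x = ennreal (inverse (1 + r) * r)"
        by (simp add: ennreal_mult inverse_ennreal add_pos_nonneg flip: ennreal_1 ennreal_plus)
      also have "\<dots> \<le> 1" using real by (simp add: field_simps)
      finally show ?thesis .
    qed simp
    then have "p x * (inverse (1 + I x) * I x) \<le> p x * 1" by (rule mult_left_mono) simp
    then show ?thesis by (simp add: W_def mult.assoc)
  qed
  define \<nu> where "\<nu> = density (M \<Otimes>\<^sub>M M) (\<lambda>z. W (fst z) * ennreal \<bar>c z\<bar>)"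
  have sets_nu: "sets \<nu> = sets (M \<Otimes>\<^sub>M M)" by (simp add: \<nu>_def)
  have nu: "emeasure \<nu> A = (\<integral>\<^sup>+ x. W x * (\<integral>\<^sup>+ y. ennreal \<bar>c (x, y)\<bar> * indicator A (x, y) \<partial>M) \<partial>M)"
    if [measurable]: "A \<in> sets (M \<Otimes>\<^sub>M M)" for A
  proof -
    have "emeasure \<nu> A = (\<integral>\<^sup>+ z. W (fst z) * ennreal \<bar>c z\<bar> * indicator A z \<partial>(M \<Otimes>\<^sub>M M))"
      unfolding \<nu>_def by (rule emeasure_density) measurable
    also have "\<dots> = (\<integral>\<^sup>+ x. \<integral>\<^sup>+ y. W x * (ennreal \<bar>c (x, y)\<bar> * indicator A (x, y)) \<partial>M \<partial>M)"
      by (subst nn_integral_fst[symmetric]) (simp_all add: mult.assoc)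
    also have "\<dots> = (\<integral>\<^sup>+ x. W x * (\<integral>\<^sup>+ y. ennreal \<bar>c (x, y)\<bar> * indicator A (x, y) \<partial>M) \<partial>M)"
      by (intro nn_integral_cong nn_integral_cmult) simp
    finally show ?thesis .
  qed
  have "finite_measure \<nu>"
  proof
    have "emeasure \<nu> (space \<nu>) = (\<integral>\<^sup>+ x. W x * I x \<partial>M)"
      by (subst sets_eq_imp_space_eq[OF sets_nu], subst nu)
        (auto simp: I_def space_pair_measure intro!: nn_integral_cong arg_cong2[where f="(*)"])
    also have "\<dots> \<le> integral\<^sup>N M p" using WI by (intro nn_integral_mono)
    finally show "emeasure \<nu> (space \<nu>) \<noteq> \<infinity>" using pint by (auto simp: top_unique)
  qed
  interpret nu: finite_measure \<nu> by fact
  define E where "E = {z \<in> space (M \<Otimes>\<^sub>M M). c z < 0}"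
  have [measurable]: "E \<in> sets (M \<Otimes>\<^sub>M M)" unfolding E_def by measurable
  \<comment> \<open>The hypothesis for one set \<open>G\<close>, in terms of the positive and
    negative parts of \<open>c\<close>, so that countably many such inequalities can be
    added.\<close>
  have part: "AE x in M. (\<integral>\<^sup>+ y. ennreal (- c (x, y)) * indicator G y \<partial>M) \<le> (\<integral>\<^sup>+ y. ennreal (c (x, y)) * indicator G y \<partial>M)"
    if G[measurable]: "G \<in> sets M" for G
    using int pos[OF G] 
  proof eventually_elim
    case (elim x)
    let ?h = "\<lambda>y. indicator G y * c (x, y)"
    have h: "integrable M ?h" using integrable_mult_indicator[OF G elim(1)] by simp
    have fin: "(\<integral>\<^sup>+ y. ennreal (?h y) \<partial>M) \<noteq> \<infinity>" "(\<integral>\<^sup>+ y. ennreal (- ?h y) \<partial>M) \<noteq> \<infinity>"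
      using h unfolding real_integrable_def by auto
    have "enn2real (\<integral>\<^sup>+ y. ennreal (- ?h y) \<partial>M) \<le> enn2real (\<integral>\<^sup>+ y. ennreal (?h y) \<partial>M)"
      using elim(2) real_lebesgue_integral_def[OF h] by simp
    then have "(\<integral>\<^sup>+ y. ennreal (- ?h y) \<partial>M) \<le> (\<integral>\<^sup>+ y. ennreal (?h y) \<partial>M)"
      using fin by (metis ennreal_enn2real ennreal_leI infinity_ennreal_def less_top)
    moreover have "ennreal (- ?h y) = ennreal (- c (x, y)) * indicator G y"
      "ennreal (?h y) = ennreal (c (x, y)) * indicator G y" for y by (auto simp: indicator_def)
    ultimately show ?case by simp
  qed
  \<comment> \<open>One null set of \<open>x\<close> serves for all the sets
    \<open>{y. k y = i}\<close>, as they are countably many; the sets \<open>F i\<close> contribute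
    only an indicator in \<open>x\<close>.\<close>
  have grid: "emeasure \<nu> (E \<inter> A) \<le> emeasure \<nu> (A - E)" if A: "A \<in> grid_sets M M" for A
  proof -
    obtain F k where F[measurable]: "\<And>i. F i \<in> sets M" and k[measurable]: "k \<in> measurable M (count_space (UNIV :: nat set))"
      and A_eq: "A = {z \<in> space (M \<Otimes>\<^sub>M M). fst z \<in> F (k (snd z))}" using A unfolding grid_sets_def by blast
    note [measurable] = grid_sets_sets[OF A]
    have AE: "AE x in M. \<forall>i. (\<integral>\<^sup>+ y. ennreal (- c (x, y)) * indicator {y\<in>space M. k y = i} y \<partial>M)
        \<le> (\<integral>\<^sup>+ y. ennreal (c (x, y)) * indicator {y\<in>space M. k y = i} y \<partial>M)"
      unfolding AE_all_countable by (intro allI part) measurable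
    have split: "(\<integral>\<^sup>+ y. ennreal (s * c (x, y)) * indicator A (x, y) \<partial>M) =
        (\<Sum>i. indicator (F i) x * (\<integral>\<^sup>+ y. ennreal (s * c (x, y)) * indicator {y\<in>space M. k y = i} y \<partial>M))"
      if x: "x \<in> space M" for x s
    proof -
      have [measurable]: "(\<lambda>y. c (x, y)) \<in> borel_measurable M" using x by (intro measurable_Pair2[OF c])
      have "(\<integral>\<^sup>+ y. ennreal (s * c (x, y)) * indicator A (x, y) \<partial>M) =
        (\<integral>\<^sup>+ y. (\<Sum>i. indicator (F i) x * (ennreal (s * c (x, y)) * indicator {y\<in>space M. k y = i} y)) \<partial>M)"
      proof (intro nn_integral_cong)
        fix y assume y: "y \<in> space M"
        have "(\<Sum>i. indicator (F i) x * (ennreal (s * c (x, y)) * indicator {y\<in>space M. k y = i} y)) =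
          (\<Sum>i\<in>{k y}. indicator (F i) x * (ennreal (s * c (x, y)) * indicator {y\<in>space M. k y = i} y))"
          by (intro suminf_finite) (auto simp: indicator_def)
        then show "ennreal (s * c (x, y)) * indicator A (x, y) =
          (\<Sum>i. indicator (F i) x * (ennreal (s * c (x, y)) * indicator {y\<in>space M. k y = i} y))"
          using x y by (auto simp: A_eq space_pair_measure indicator_def)
      qed
      also have "\<dots> = (\<Sum>i. \<integral>\<^sup>+ y. indicator (F i) x * (ennreal (s * c (x, y)) * indicator {y\<in>space M. k y = i} y) \<partial>M)"
        by (intro nn_integral_suminf) measurable
      also have "\<dots> = (\<Sum>i. indicator (F i) x * (\<integral>\<^sup>+ y. ennreal (s * c (x, y)) * indicator {y\<in>space M. k y = i} y \<partial>M))"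
        by (intro suminf_cong nn_integral_cmult) measurable
      finally show ?thesis .
    qed
    have le: "AE x in M. (\<integral>\<^sup>+ y. ennreal (- c (x, y)) * indicator A (x, y) \<partial>M) \<le> (\<integral>\<^sup>+ y. ennreal (c (x, y)) * indicator A (x, y) \<partial>M)"
      using AE AE_space
    proof eventually_elim
      case (elim x)
      then show ?case
        using split[of x 1] split[of x "- 1"] by (auto intro!: suminf_le mult_left_mono)
    qed
    have p1: "ennreal \<bar>c (x, y)\<bar> * indicator (E \<inter> A) (x, y) = ennreal (- c (x, y)) * indicator A (x, y)"
      "ennreal (c (x, y)) * indicator A (x, y) = ennreal \<bar>c (x, y)\<bar> * indicator (A - E) (x, y)"
      if "x \<in> space M" "y \<in> space M" for x y
      using that by (cases "c (x, y) < 0"; auto simp: E_def space_pair_measure ennreal_neg split: split_indicator)+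
    have "emeasure \<nu> (E \<inter> A) = (\<integral>\<^sup>+ x. W x * (\<integral>\<^sup>+ y. ennreal (- c (x, y)) * indicator A (x, y) \<partial>M) \<partial>M)"
      by (subst nu) (simp_all add: p1 cong: nn_integral_cong_simp)
    also have "\<dots> \<le> (\<integral>\<^sup>+ x. W x * (\<integral>\<^sup>+ y. ennreal (c (x, y)) * indicator A (x, y) \<partial>M) \<partial>M)"
      by (intro nn_integral_mono_AE) (use le in eventually_elim, simp add: mult_left_mono)
    also have "\<dots> = emeasure \<nu> (A - E)"
      by (subst nu) (simp_all add: p1 cong: nn_integral_cong_simp)
    finally show ?thesis .
  qed
  \<comment> \<open>If \<open>A\<close> approximates \<open>E\<close>, then \<open>E - A\<close> and
    \<open>A - E\<close> are small, and the grid inequality bounds the measure of the intersection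
    by that of \<open>A - E\<close>. So \<open>E\<close> itself is small.\<close>
  have "measure \<nu> E \<le> 0 + e" if e: "e > 0" for e
  proof -
    obtain A where A: "A \<in> grid_sets M M" "measure \<nu> ((E - A) \<union> (A - E)) < e/2"
      using grid_sets_approximate[OF \<open>finite_measure \<nu>\<close> sets_nu, of E "e/2"] e by auto
    have [measurable]: "A \<in> sets \<nu>" "E \<in> sets \<nu>" using grid_sets_sets[OF A(1)] by (simp_all add: sets_nu)
    have "measure \<nu> E = measure \<nu> ((E \<inter> A) \<union> (E - A))" by (simp add: Un_Diff_Int Un_commute)
    also have "\<dots> \<le> measure \<nu> (E \<inter> A) + measure \<nu> (E - A)" by (intro measure_Un_le) auto
    also have "measure \<nu> (E \<inter> A) \<le> measure \<nu> (A - E)" using grid[OF A(1)] by (simp add: nu.emeasure_eq_measure)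
    also have "measure \<nu> (A - E) \<le> measure \<nu> ((E - A) \<union> (A - E))" by (intro nu.finite_measure_mono) auto
    also have "measure \<nu> (E - A) \<le> measure \<nu> ((E - A) \<union> (A - E))" by (intro nu.finite_measure_mono) auto
    finally show ?thesis using A(2) by simp
  qed
  then have "measure \<nu> E \<le> 0" by (rule field_le_epsilon)
  then have "emeasure \<nu> E = 0" by (simp add: nu.emeasure_eq_measure measure_le_0_iff)
  then have "(\<integral>\<^sup>+ z. W (fst z) * ennreal \<bar>c z\<bar> * indicator E z \<partial>(M \<Otimes>\<^sub>M M)) = 0"
    unfolding \<nu>_def by (subst (asm) emeasure_density) measurable
  then have ae0: "AE z in M \<Otimes>\<^sub>M M. W (fst z) * ennreal \<bar>c z\<bar> * indicator E z = 0"
    by (subst (asm) nn_integral_0_iff_AE) measurable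
  have "AE x in M. W x \<noteq> 0" using int AE_space
  proof eventually_elim
    case (elim x)
    then have "I x < \<infinity>" unfolding I_def using elim(1) by (auto simp: integrable_iff_bounded)
    then have "1 + I x < \<infinity>" by (simp add: less_top)
    then show ?case using p0[OF elim(2)] by (auto simp: W_def ennreal_inverse_eq_0_iff)
  qed
  then have "AE z in M \<Otimes>\<^sub>M M. W (fst z) \<noteq> 0" by (intro MM.AE_pair_measure) auto
  with ae0 AE_space show ?thesis
    by eventually_elim (auto simp: E_def indicator_def split: if_splits)
qed

section \<open>Kernels of positive operators and their uniqueness\<close>

lemma has_kernelD:
  "has_kernel M rep T a \<Longrightarrow> AE x in M. integrable M (\<lambda>y. a (x, y) * rep f y) \<and>
      rep (T f) x = (\<integral>y. a (x, y) * rep f y \<partial>M)"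
  by (simp add: has_kernel_def)

text \<open>Multiplying the kernel by a fixed positive \<open>f\<close> makes it integrable along
  almost every \<open>x\<close>, and a test set \<open>G\<close> corresponds to the positive element
  represented by \<open>indicator G\<close> times \<open>f\<close>. \<open>AE_pair_nonneg\<close> is
  applied to the real part and to the imaginary part with both signs.\<close>

lemma positive_operator_kernel_nonneg:
  assumes hk: "has_kernel M rep T a" and T: "T ` P \<subseteq> P" and f: "f \<in> P"
  shows "AE z in M \<Otimes>\<^sub>M M. a z * rep f (snd z) \<in> \<real>\<^sub>\<ge>\<^sub>0"
proof -
  have a[measurable]: "a \<in> borel_measurable (M \<Otimes>\<^sub>M M)" using hk by (simp add: has_kernel_def)
  have *: "AE z in M \<Otimes>\<^sub>M M. 0 \<le> h (a z * rep f (snd z))"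
    if h: "bounded_linear h" "\<And>z. z \<in> \<real>\<^sub>\<ge>\<^sub>0 \<Longrightarrow> 0 \<le> h z" for h :: "complex \<Rightarrow> real"
  proof (rule AE_pair_nonneg)
    have [measurable]: "h \<in> borel_measurable borel"
      using h(1) by (intro borel_measurable_continuous_onI linear_continuous_on)
    show "(\<lambda>z. h (a z * rep f (snd z))) \<in> borel_measurable (M \<Otimes>\<^sub>M M)" by measurable
    show "AE x in M. integrable M (\<lambda>y. h (a (x, y) * rep f (snd (x, y))))"
      using has_kernelD[OF hk, of f] by eventually_elim (auto intro: integrable_bounded_linear[OF h(1)])
    fix G assume G[measurable]: "G \<in> sets M"
    have "(\<lambda>x. indicator G x * rep f x) \<in> borel_measurable M" by measurable
    moreover have "AE x in M. cmod (indicator G x * rep f x) \<le> cmod (rep f x)"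
      by (simp add: norm_mult indicator_def)
    ultimately obtain g where g: "AE x in M. rep g x = indicator G x * rep f x" using solid by blast
    have "g \<in> P" unfolding positive_cone_def mem_Collect_eq
      using g f[unfolded positive_cone_def mem_Collect_eq] by eventually_elim (auto simp: indicator_def)
    then have "T g \<in> P" using T by blast
    from has_kernelD[OF hk, of f] has_kernelD[OF hk, of g] this[unfolded positive_cone_def mem_Collect_eq] AE_space
    show "AE x in M. 0 \<le> (\<integral>y. indicator G y * h (a (x, y) * rep f (snd (x, y))) \<partial>M)"
    proof eventually_elim
      case (elim x)
      have [measurable]: "(\<lambda>y. a (x, y)) \<in> borel_measurable M" using elim by (intro measurable_Pair2[OF a])
      have "(\<integral>y. indicator G y * h (a (x, y) * rep f y) \<partial>M) = (\<integral>y. h (a (x, y) * rep g y) \<partial>M)"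
      proof (intro integral_cong_AE)
        show "AE y in M. indicator G y * h (a (x, y) * rep f y) = h (a (x, y) * rep g y)"
          using g by eventually_elim (auto simp: indicator_def linear_0 h(1) bounded_linear.linear)
      qed measurable
      also have "\<dots> = h (rep (T g) x)"
        using elim by (subst integral_bounded_linear[OF h(1)]) auto
      also have "\<dots> \<ge> 0" using elim by (intro h(2)) auto
      finally show ?case by simp
    qed
  qed
  have "AE z in M \<Otimes>\<^sub>M M. 0 \<le> Re (a z * rep f (snd z))"
    by (rule *) (auto simp: bounded_linear_Re complex_nonneg_Reals_iff)
  moreover have "AE z in M \<Otimes>\<^sub>M M. 0 \<le> Im (a z * rep f (snd z))"
    by (rule *) (auto simp: bounded_linear_Im complex_nonneg_Reals_iff)
  moreover have "AE z in M \<Otimes>\<^sub>M M. 0 \<le> - Im (a z * rep f (snd z))"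
    by (rule *) (auto simp: bounded_linear_minus[OF bounded_linear_Im] complex_nonneg_Reals_iff)
  ultimately show ?thesis by eventually_elim (auto simp: complex_nonneg_Reals_iff)
qed

text \<open>Both \<open>a - b\<close> and \<open>b - a\<close> are kernels of the zero operator,
  which is positive, so both are nonnegative against \<open>f\<close>. Equality where
  \<open>f\<close> does not vanish is what the uniqueness of Hadamard means needs.\<close>

lemma kernel_unique:
  assumes a: "has_kernel M rep T a" and b: "has_kernel M rep T b" and f: "f \<in> P"
  shows "AE x in M. AE y in M. a (x, y) * rep f y = b (x, y) * rep f y"
proof -
  have diff: "has_kernel M rep (\<lambda>_. 0) (\<lambda>z. a z - b z)" if "has_kernel M rep T a" "has_kernel M rep T b" for a b
    unfolding has_kernel_def
  proof (intro conjI allI)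
    show "(\<lambda>z. a z - b z) \<in> borel_measurable (M \<Otimes>\<^sub>M M)"
      using that unfolding has_kernel_def by (intro borel_measurable_diff) auto
    fix f show "AE x in M. integrable M (\<lambda>y. (a (x, y) - b (x, y)) * rep f y) \<and>
        rep 0 x = (\<integral>y. (a (x, y) - b (x, y)) * rep f y \<partial>M)"
      using has_kernelD[OF that(1), of f] has_kernelD[OF that(2), of f] rep_0
      by eventually_elim (auto simp: left_diff_distrib)
  qed
  have zero: "(\<lambda>_. 0) ` P \<subseteq> P" using positive_cone_0 by auto
  have "AE z in M \<Otimes>\<^sub>M M. a z * rep f (snd z) = b z * rep f (snd z)"
    using positive_operator_kernel_nonneg[OF diff[OF a b] zero f] positive_operator_kernel_nonneg[OF diff[OF b a] zero f]
    by eventually_elim (auto simp: complex_nonneg_Reals_iff complex_eq_iff algebra_simps)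
  from MM.AE_pair[OF this] show ?thesis by simp
qed

text \<open>The kernel \<open>max 0 (Re a)\<close> agrees a.e. with \<open>a\<close> wherever
  \<open>a\<close> meets a nonzero value of \<open>f\<close>, and it is nonnegative without
  exception.\<close>

lemma positive_kernel_operator_kernel:
  assumes "positive_kernel_operator M rep T"
  obtains k where "kernel_operator k T"
proof -
  obtain a where hk: "has_kernel M rep T a" and T: "clinear T" "T ` P \<subseteq> P"
    using assms by (auto simp: positive_kernel_operator_def)
  have a[measurable]: "a \<in> borel_measurable (M \<Otimes>\<^sub>M M)" using hk by (simp add: has_kernel_def)
  let ?b = "\<lambda>z. max 0 (Re (a z))"
  have "has_kernel M rep T (\<lambda>z. complex_of_real (?b z))"
  proof (rule kernel_integral_combination[OF _ T(1)])
    fix f assume f: "f \<in> P"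
    show "AE x in M. integrable M (\<lambda>y. complex_of_real (?b (x, y)) * rep f y) \<and>
        rep (T f) x = (\<integral>y. complex_of_real (?b (x, y)) * rep f y \<partial>M)"
      using has_kernelD[OF hk, of f] MM.AE_pair[OF positive_operator_kernel_nonneg[OF hk T(2) f]] AE_space
    proof eventually_elim
      case (elim x)
      have [measurable]: "(\<lambda>y. a (x, y)) \<in> borel_measurable M" using elim by (intro measurable_Pair2[OF a])
      have ae: "AE y in M. a (x, y) * rep f y = complex_of_real (?b (x, y)) * rep f y"
        using elim(2) f[unfolded positive_cone_iff]
      proof eventually_elim
        case (elim y)
        then have "complex_of_real (cmod (rep f y)) * a (x, y) \<in> \<real>\<^sub>\<ge>\<^sub>0" by (simp add: mult.commute)
        then have "rep f y = 0 \<or> a (x, y) \<in> \<real>\<^sub>\<ge>\<^sub>0"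
          by (auto simp: complex_nonneg_Reals_iff zero_le_mult_iff)
        then show ?case by (auto simp: complex_nonneg_Reals_iff complex_eq_iff)
      qed
      have "integrable M (\<lambda>y. complex_of_real (?b (x, y)) * rep f y)"
        by (subst integrable_cong_AE[OF _ _ ae, symmetric]) (use elim in auto)
      moreover have "(\<integral>y. complex_of_real (?b (x, y)) * rep f y \<partial>M) = (\<integral>y. a (x, y) * rep f y \<partial>M)"
        by (rule integral_cong_AE[OF _ _ ae, symmetric]) auto
      ultimately show ?case using elim by simp
    qed
  qed measurable
  then have "kernel_operator (\<lambda>z. ennreal (?b z)) T" by (rule has_kernel_kernel_operator[OF _ _ T(1)]) simp
  then show ?thesis by (rule that)
qed


text \<open>Domination by an element of the space lets solidity turn the integrals into an element.
  Its choice is linear in \<open>f\<close> by \<open>rep_inject\<close>, although \<open>rep\<close>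
  is linear only modulo null sets.\<close>

lemma ex_kernel_operator:
  fixes b :: "'a \<times> 'a \<Rightarrow> real"
  assumes b[measurable]: "b \<in> borel_measurable (M \<Otimes>\<^sub>M M)" and b0: "\<And>z. 0 \<le> b z"
    and dom: "\<And>f. f \<in> P \<Longrightarrow> \<exists>g\<in>P. AE x in M. (\<integral>\<^sup>+ y. ennreal (b (x, y)) * modulus f y \<partial>M) \<le> modulus g x"
  obtains T where "has_kernel M rep T (\<lambda>z. complex_of_real (b z))" "kernel_operator (\<lambda>z. ennreal (b z)) T"
proof -
  let ?I = "\<lambda>f x. \<integral>y. complex_of_real (b (x, y)) * rep f y \<partial>M"
  have *: "\<exists>u. AE x in M. integrable M (\<lambda>y. complex_of_real (b (x, y)) * rep f y) \<and> rep u x = ?I f x" for f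
  proof -
    obtain f0 where f0: "f0 \<in> P" "AE x in M. modulus f0 x = modulus f x" by (rule absolute_value)
    obtain g where g: "g \<in> P" "AE x in M. (\<integral>\<^sup>+ y. ennreal (b (x, y)) * modulus f0 y \<partial>M) \<le> modulus g x"
      using dom[OF f0(1)] by blast
    have ae: "AE x in M. integrable M (\<lambda>y. complex_of_real (b (x, y)) * rep f y) \<and> cmod (?I f x) \<le> cmod (rep g x)"
      using g(2) AE_space
    proof eventually_elim
      case (elim x)
      have [measurable]: "(\<lambda>y. b (x, y)) \<in> borel_measurable M" using elim by (intro measurable_Pair2[OF b])
      have "(\<integral>\<^sup>+ y. ennreal (cmod (complex_of_real (b (x, y)) * rep f y)) \<partial>M) = (\<integral>\<^sup>+ y. ennreal (b (x, y)) * modulus f0 y \<partial>M)"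
        by (intro nn_integral_cong_AE) (use f0(2) in eventually_elim, simp add: modulus_def norm_mult ennreal_mult b0)
      also have "\<dots> \<le> ennreal (cmod (rep g x))" using elim(1) by (simp add: modulus_def)
      finally have le: "(\<integral>\<^sup>+ y. ennreal (cmod (complex_of_real (b (x, y)) * rep f y)) \<partial>M) \<le> ennreal (cmod (rep g x))" .
      then have int: "integrable M (\<lambda>y. complex_of_real (b (x, y)) * rep f y)"
        by (auto simp: integrable_iff_bounded intro: le_less_trans)
      have "ennreal (cmod (?I f x)) \<le> ennreal (cmod (rep g x))"
        by (rule order_trans[OF integral_norm_bound_ennreal[OF int] le])
      then show ?case using int by simp
    qed
    have "?I f \<in> borel_measurable M" by measurable
    moreover have "AE x in M. cmod (?I f x) \<le> cmod (rep g x)" using ae by eventually_elim simp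
    ultimately obtain u where "AE x in M. rep u x = ?I f x" using solid by blast
    with ae have "AE x in M. integrable M (\<lambda>y. complex_of_real (b (x, y)) * rep f y) \<and> rep u x = ?I f x"
      by eventually_elim simp
    then show ?thesis ..
  qed
  define T where "T f = (SOME u. AE x in M. integrable M (\<lambda>y. complex_of_real (b (x, y)) * rep f y) \<and> rep u x = ?I f x)" for f
  have T: "AE x in M. integrable M (\<lambda>y. complex_of_real (b (x, y)) * rep f y) \<and> rep (T f) x = ?I f x" for f
    unfolding T_def by (rule someI_ex[OF *])
  have hk: "has_kernel M rep T (\<lambda>z. complex_of_real (b z))"
    using T unfolding has_kernel_def by (intro conjI allI) (measurable)
  have "clinear T"
    unfolding clinear_iff
  proof (intro conjI allI)
    fix f g
    show "T (f + g) = T f + T g"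
    proof (rule rep_inject)
      show "AE x in M. rep (T (f + g)) x = rep (T f + T g) x"
        using T[of f] T[of g] T[of "f + g"] rep_add[of "T f" "T g"] AE_space
      proof eventually_elim
        case (elim x)
        have [measurable]: "(\<lambda>y. b (x, y)) \<in> borel_measurable M" using elim by (intro measurable_Pair2[OF b])
        have ae: "AE y in M. complex_of_real (b (x, y)) * rep (f + g) y =
            complex_of_real (b (x, y)) * rep f y + complex_of_real (b (x, y)) * rep g y"
          using rep_add[of f g] by eventually_elim (simp add: algebra_simps)
        have "?I (f + g) x = (\<integral>y. complex_of_real (b (x, y)) * rep f y + complex_of_real (b (x, y)) * rep g y \<partial>M)"
          by (rule integral_cong_AE[OF _ _ ae]) measurable
        then show ?case using elim by simp
      qed
    qed
  next
    fix c f
    show "T (c *\<^sub>C f) = c *\<^sub>C T f"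
    proof (rule rep_inject)
      show "AE x in M. rep (T (c *\<^sub>C f)) x = rep (c *\<^sub>C T f) x"
        using T[of f] T[of "c *\<^sub>C f"] rep_scaleC[of c "T f"] AE_space
      proof eventually_elim
        case (elim x)
        have [measurable]: "(\<lambda>y. b (x, y)) \<in> borel_measurable M" using elim by (intro measurable_Pair2[OF b])
        have ae: "AE y in M. complex_of_real (b (x, y)) * rep (c *\<^sub>C f) y = c * (complex_of_real (b (x, y)) * rep f y)"
          using rep_scaleC[of c f] by eventually_elim (simp add: algebra_simps)
        have "?I (c *\<^sub>C f) x = (\<integral>y. c * (complex_of_real (b (x, y)) * rep f y) \<partial>M)"
          by (rule integral_cong_AE[OF _ _ ae]) measurable
        then show ?case using elim by simp
      qed
    qed
  qed
  then show ?thesis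
    using hk by (intro that has_kernel_kernel_operator) (auto simp: b0)
qed

end

section \<open>Geometric means and Hoelder's inequality\<close>

text \<open>An infinite \<open>u j\<close> counts as \<open>0\<close> here.\<close>

definition geometric_mean :: "'i set \<Rightarrow> ('i \<Rightarrow> ennreal) \<Rightarrow> ennreal"
  where "geometric_mean J u = ennreal (\<Prod>j\<in>J. enn2real (u j) powr (1 / real (card J)))"

lemma geometric_mean_mult:
  "geometric_mean J (\<lambda>j. u j * v j) = geometric_mean J u * geometric_mean J v"
  by (simp add: geometric_mean_def enn2real_mult powr_mult prod.distrib ennreal_mult[symmetric] prod_nonneg)

lemma geometric_mean_eq_0: "finite J \<Longrightarrow> j \<in> J \<Longrightarrow> u j = 0 \<Longrightarrow> geometric_mean J u = 0"
  unfolding geometric_mean_def by (subst prod_zero) (auto intro: bexI[of _ j])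

lemma geometric_mean_le_mean:
  assumes J: "finite J" "J \<noteq> {}"
  shows "geometric_mean J u \<le> (\<Sum>j\<in>J. ennreal (1 / real (card J)) * u j)"
proof (cases "\<exists>j\<in>J. u j = \<infinity>")
  case True
  then obtain j where j: "j \<in> J" "u j = \<infinity>" by blast
  have "ennreal (1 / real (card J)) * u j \<le> (\<Sum>j\<in>J. ennreal (1 / real (card J)) * u j)"
    using j J by (intro member_le_sum) auto
  moreover have "ennreal (1 / real (card J)) * u j = \<infinity>"
    using J j by (simp add: ennreal_mult_top card_gt_0_iff)
  ultimately show ?thesis by (simp add: top_unique)
next
  case False
  have "(\<Prod>j\<in>J. enn2real (u j) powr (1 / real (card J))) = (\<Prod>j\<in>J. enn2real (u j)) powr (1 / real (card J))"
    by (rule prod_powr_distrib[symmetric])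
  also have "\<dots> \<le> (\<Sum>j\<in>J. enn2real (u j) / real (card J))" by (rule arith_geom_mean[OF J]) auto
  finally have "geometric_mean J u \<le> ennreal (\<Sum>j\<in>J. 1 / real (card J) * enn2real (u j))"
    unfolding geometric_mean_def by (intro ennreal_leI) simp
  also have "\<dots> = (\<Sum>j\<in>J. ennreal (1 / real (card J)) * u j)"
  proof (subst sum_ennreal[symmetric])
    show "(\<Sum>j\<in>J. ennreal (1 / real (card J) * enn2real (u j))) = (\<Sum>j\<in>J. ennreal (1 / real (card J)) * u j)"
      using False by (intro sum.cong refl, subst ennreal_mult) (auto simp: less_top)
  qed simp
  finally show ?thesis .
qed

text \<open>Hoelder's inequality by normalisation: dividing each \<open>u j\<close> by its integral
  reduces it to the inequality of the means under the integral sign. The integrals have to be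
  finite, as an infinite one would count as 0 on the right.\<close>

lemma nn_integral_geometric_mean:
  assumes J: "finite J" "J \<noteq> {}" and u[measurable]: "\<And>j. j \<in> J \<Longrightarrow> u j \<in> borel_measurable M"
    and fin: "\<And>j. j \<in> J \<Longrightarrow> (\<integral>\<^sup>+ x. u j x \<partial>M) < \<infinity>"
  shows "(\<integral>\<^sup>+ x. geometric_mean J (\<lambda>j. u j x) \<partial>M) \<le> geometric_mean J (\<lambda>j. \<integral>\<^sup>+ x. u j x \<partial>M)"
proof -
  define U where "U j = (\<integral>\<^sup>+ x. u j x \<partial>M)" for j
  have n: "real (card J) > 0" using J by (simp add: card_gt_0_iff)
  show ?thesis
  proof (cases "\<exists>j\<in>J. U j = 0")
    \<comment> \<open>Normalising is impossible here, but one factor is 0 a.e., and so is the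
      mean.\<close>
    case True
    then obtain j where j: "j \<in> J" "U j = 0" by blast
    then have "AE x in M. u j x = 0" unfolding U_def by (subst (asm) nn_integral_0_iff_AE) auto
    then have "AE x in M. geometric_mean J (\<lambda>j. u j x) = 0"
      by eventually_elim (rule geometric_mean_eq_0[OF J(1) j(1)])
    then have "(\<integral>\<^sup>+ x. geometric_mean J (\<lambda>j. u j x) \<partial>M) = (\<integral>\<^sup>+ x. 0 \<partial>M)" by (rule nn_integral_cong_AE)
    then show ?thesis by simp
  next
    case False
    have inv: "U j * inverse (U j) = 1" if "j \<in> J" for j
      using False that fin[OF that] ennreal_divide_self[of "U j"] by (auto simp: U_def divide_ennreal_def)
    have "geometric_mean J (\<lambda>j. u j x) = geometric_mean J U * geometric_mean J (\<lambda>j. inverse (U j) * u j x)" for x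
    proof -
      have "geometric_mean J (\<lambda>j. u j x) = geometric_mean J (\<lambda>j. U j * (inverse (U j) * u j x))"
        unfolding geometric_mean_def by (intro arg_cong[where f=ennreal] prod.cong refl)
          (simp add: mult.assoc[symmetric] inv)
      then show ?thesis by (simp only: geometric_mean_mult)
    qed
    then have "(\<integral>\<^sup>+ x. geometric_mean J (\<lambda>j. u j x) \<partial>M)
        \<le> (\<integral>\<^sup>+ x. geometric_mean J U * (\<Sum>j\<in>J. ennreal (1 / real (card J)) * (inverse (U j) * u j x)) \<partial>M)"
      by (simp add: nn_integral_mono mult_left_mono geometric_mean_le_mean[OF J])
    also have "\<dots> = geometric_mean J U * (\<Sum>j\<in>J. ennreal (1 / real (card J)) * (inverse (U j) * U j))"
      unfolding U_def by (simp add: nn_integral_cmult nn_integral_sum)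
    also have "(\<Sum>j\<in>J. ennreal (1 / real (card J)) * (inverse (U j) * U j)) = (\<Sum>j\<in>J. ennreal (1 / real (card J)))"
      using inv by (intro sum.cong) (auto simp: mult.commute)
    also have "\<dots> = 1" using n by (simp add: ennreal_of_nat_eq_real_of_nat flip: ennreal_mult)
    finally show ?thesis by (simp add: U_def)
  qed
qed

section \<open>Hadamard means as kernel operators\<close>

context banach_function_space
begin

interpretation MM: pair_sigma_finite M M ..

text \<open>Two choices of kernels agree for a.e. \<open>x\<close> at a.e. \<open>y\<close> where
  \<open>f\<close> does not vanish, so the products have the same integrals against
  \<open>f\<close>. This makes the \<open>THE\<close> in \<open>hadamard_mean\<close> well
  defined.\<close>

lemma hadamard_product_unique:
  assumes J: "finite J"
    and a: "\<And>j. j \<in> J \<Longrightarrow> has_kernel M rep (A j) (\<lambda>z. complex_of_real (a j z))"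
    and b: "\<And>j. j \<in> J \<Longrightarrow> has_kernel M rep (A j) (\<lambda>z. complex_of_real (b j z))"
    and H: "has_kernel M rep H (\<lambda>z. complex_of_real (\<Prod>j\<in>J. a j z powr \<alpha> j))"
    and H': "has_kernel M rep H' (\<lambda>z. complex_of_real (\<Prod>j\<in>J. b j z powr \<alpha> j))"
  shows "H = H'"
proof
  fix f
  obtain g where g: "g \<in> P" "AE x in M. modulus g x = modulus f x" by (rule absolute_value)
  have "AE x in M. \<forall>j\<in>J. AE y in M. complex_of_real (a j (x, y)) * rep g y = complex_of_real (b j (x, y)) * rep g y"
    using kernel_unique[OF a b g(1)] by (intro AE_finite_allI J) auto
  then have "AE x in M. rep (H f) x = rep (H' f) x"
    using has_kernelD[OF H, of f] has_kernelD[OF H', of f] AE_space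
  proof eventually_elim
    case (elim x)
    have [measurable]: "(\<lambda>y. complex_of_real (\<Prod>j\<in>J. a j (x, y) powr \<alpha> j)) \<in> borel_measurable M"
      "(\<lambda>y. complex_of_real (\<Prod>j\<in>J. b j (x, y) powr \<alpha> j)) \<in> borel_measurable M"
      using elim(4) H H' unfolding has_kernel_def by (auto dest: measurable_Pair2)
    have "AE y in M. \<forall>j\<in>J. complex_of_real (a j (x, y)) * rep g y = complex_of_real (b j (x, y)) * rep g y"
      using elim(1) by (intro AE_finite_allI J) auto
    with g(2) have "AE y in M. complex_of_real (\<Prod>j\<in>J. a j (x, y) powr \<alpha> j) * rep f y =
        complex_of_real (\<Prod>j\<in>J. b j (x, y) powr \<alpha> j) * rep f y"
    proof eventually_elim
      case (elim y)
      show ?case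
      proof (cases "rep f y = 0")
        case False
        then have "rep g y \<noteq> 0" using elim(1) by (auto simp: modulus_def)
        then have "a j (x, y) = b j (x, y)" if "j \<in> J" for j using elim(2) that by auto
        then show ?thesis by (simp cong: prod.cong)
      qed simp
    qed
    then show ?case using elim(2,3) by (auto intro!: integral_cong_AE)
  qed
  then show "H f = H' f" by (rule rep_inject)
qed

text \<open>The inequality of the means puts the product kernel below the arithmetic mean of the
  kernels. This domination is what makes the product kernel define an operator at all, and it is
  also the second claim.\<close>

lemma
  assumes J: "finite J" "J \<noteq> {}" and k: "\<And>j. j \<in> J \<Longrightarrow> kernel_operator (k j) (A j)"
  shows kernel_operator_hadamard_mean:
      "kernel_operator (\<lambda>z. geometric_mean J (\<lambda>j. k j z)) (hadamard_mean M rep J (\<lambda>_. 1 / real (card J)) A)"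
    and hadamard_mean_le_mean: "f \<in> P \<Longrightarrow>
      AE x in M. modulus (hadamard_mean M rep J (\<lambda>_. 1 / real (card J)) A f) x \<le>
        modulus (\<Sum>j\<in>J. (1 / real (card J)) *\<^sub>R A j f) x"
proof -
  note km[measurable] = kernel_operator_measurable[OF k]
  define b where "b z = (\<Prod>j\<in>J. enn2real (k j z) powr (1 / real (card J)))" for z
  have bm[measurable]: "b \<in> borel_measurable (M \<Otimes>\<^sub>M M)" unfolding b_def[abs_def] by measurable
  have b_eq: "ennreal (b z) = geometric_mean J (\<lambda>j. k j z)" for z by (simp add: b_def geometric_mean_def)
  let ?S = "\<lambda>f. \<Sum>j\<in>J. (1 / real (card J)) *\<^sub>R A j f"
  have dom: "?S f \<in> P \<and> (AE x in M. (\<integral>\<^sup>+ y. ennreal (b (x, y)) * modulus f y \<partial>M) \<le> modulus (?S f) x)" if f: "f \<in> P" for f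
  proof
    have Sj: "(1 / real (card J)) *\<^sub>R A j f \<in> P" if "j \<in> J" for j
      using kernel_operator_positive[OF k[OF that] f] by (intro positive_cone_scaleR) auto
    then show "?S f \<in> P" by (rule positive_cone_sum)
    have "AE x in M. \<forall>j\<in>J. modulus ((1 / real (card J)) *\<^sub>R A j f) x = ennreal (1 / real (card J)) * modulus (A j f) x"
      by (intro AE_finite_allI J) (use modulus_scaleR[of "1 / real (card J)"] in simp)
    moreover have "AE x in M. \<forall>j\<in>J. modulus (A j f) x = (\<integral>\<^sup>+ y. k j (x, y) * modulus f y \<partial>M)"
      using kernel_operator_modulus[OF k f] by (intro AE_finite_allI J) auto
    moreover have "AE x in M. modulus (?S f) x = (\<Sum>j\<in>J. modulus ((1 / real (card J)) *\<^sub>R A j f) x)"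
      by (rule modulus_sum[OF J(1) Sj])
    ultimately show "AE x in M. (\<integral>\<^sup>+ y. ennreal (b (x, y)) * modulus f y \<partial>M) \<le> modulus (?S f) x"
      using AE_space
    proof eventually_elim
      case (elim x)
      have [measurable]: "(\<lambda>y. k j (x, y)) \<in> borel_measurable M" if "j \<in> J" for j
        using elim(4) that by (intro measurable_Pair2[OF km])
      have "(\<integral>\<^sup>+ y. ennreal (b (x, y)) * modulus f y \<partial>M) \<le>
          (\<integral>\<^sup>+ y. (\<Sum>j\<in>J. ennreal (1 / real (card J)) * (k j (x, y) * modulus f y)) \<partial>M)"
      proof (intro nn_integral_mono)
        fix y
        have "ennreal (b (x, y)) * modulus f y \<le> (\<Sum>j\<in>J. ennreal (1 / real (card J)) * k j (x, y)) * modulus f y"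
          unfolding b_eq by (intro mult_right_mono geometric_mean_le_mean J) simp
        then show "ennreal (b (x, y)) * modulus f y \<le> (\<Sum>j\<in>J. ennreal (1 / real (card J)) * (k j (x, y) * modulus f y))"
          by (simp add: sum_distrib_right mult.assoc)
      qed
      also have "\<dots> = (\<Sum>j\<in>J. ennreal (1 / real (card J)) * (\<integral>\<^sup>+ y. k j (x, y) * modulus f y \<partial>M))"
        by (subst nn_integral_sum) (auto intro!: sum.cong nn_integral_cmult)
      also have "\<dots> = modulus (?S f) x" using elim by simp
      finally show ?case .
    qed
  qed
  obtain H where H: "has_kernel M rep H (\<lambda>z. complex_of_real (b z))" "kernel_operator (\<lambda>z. ennreal (b z)) H"
  proof (rule ex_kernel_operator[OF bm])
    show "0 \<le> b z" for z by (simp add: b_def prod_nonneg)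
    show "\<exists>g\<in>P. AE x in M. (\<integral>\<^sup>+ y. ennreal (b (x, y)) * modulus f y \<partial>M) \<le> modulus g x" if "f \<in> P" for f
      using dom[OF that] by blast
  qed
  have "hadamard_mean M rep J (\<lambda>_. 1 / real (card J)) A = H"
    unfolding hadamard_mean_def
  proof (rule the_equality)
    show "\<exists>a. (\<forall>j\<in>J. has_kernel M rep (A j) (\<lambda>z. complex_of_real (a j z)) \<and> (AE z in M \<Otimes>\<^sub>M M. 0 \<le> a j z)) \<and>
        has_kernel M rep H (\<lambda>z. complex_of_real (\<Prod>j\<in>J. a j z powr (1 / real (card J))))"
      using kernel_operator_has_kernel[OF k] H(1)
      by (intro exI[of _ "\<lambda>j z. enn2real (k j z)"]) (auto simp: b_def)
    fix H' assume "\<exists>a. (\<forall>j\<in>J. has_kernel M rep (A j) (\<lambda>z. complex_of_real (a j z)) \<and> (AE z in M \<Otimes>\<^sub>M M. 0 \<le> a j z)) \<and>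
        has_kernel M rep H' (\<lambda>z. complex_of_real (\<Prod>j\<in>J. a j z powr (1 / real (card J))))"
    then obtain a where a: "\<And>j. j \<in> J \<Longrightarrow> has_kernel M rep (A j) (\<lambda>z. complex_of_real (a j z))"
      "has_kernel M rep H' (\<lambda>z. complex_of_real (\<Prod>j\<in>J. a j z powr (1 / real (card J))))" by blast
    show "H' = H"
      using hadamard_product_unique[OF J(1) a(1) kernel_operator_has_kernel[OF k] a(2), of H] H(1)
      by (simp add: b_def)
  qed
  then show kop: "kernel_operator (\<lambda>z. geometric_mean J (\<lambda>j. k j z)) (hadamard_mean M rep J (\<lambda>_. 1 / real (card J)) A)"
    using H(2) by (simp add: b_eq)
  assume f: "f \<in> P"
  show "AE x in M. modulus (hadamard_mean M rep J (\<lambda>_. 1 / real (card J)) A f) x \<le> modulus (?S f) x"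
    using kernel_operator_modulus[OF kop f] dom[OF f, THEN conjunct2] by eventually_elim (simp add: b_eq)
qed

end

section \<open>Semicompactness and the essential spectral radius\<close>

lemma finitely_covered_scaleC:
  fixes S :: "'l::complex_banach set"
  assumes "finitely_covered S e" "cmod c = 1" "0 \<le> e"
  shows "finitely_covered ((*\<^sub>C) c ` S) e"
proof -
  have "onorm ((*\<^sub>C) c :: 'l \<Rightarrow> 'l) \<le> 1" by (rule onorm_bound) (simp_all add: norm_scaleC assms(2))
  then have "finitely_covered ((*\<^sub>C) c ` cball 0 1 :: 'l set) 1"
    using finitely_covered_onorm[OF bounded_linear_scaleC[of c]] finitely_covered_mono by blast
  from finitely_covered_image[OF bounded_linear.linear[OF bounded_linear_scaleC] assms(1) this assms(3)]
  show ?thesis by simp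
qed

lemma finitely_covered_bounded_linear_image:
  assumes T: "bounded_linear T" and S: "\<forall>e>0. finitely_covered S e" and "e > 0"
  shows "finitely_covered (T ` S) e"
proof -
  define d where "d = e / (onorm T + 1)"
  have o: "0 \<le> onorm T" using T by (rule onorm_pos_le)
  then have d: "d > 0" using \<open>e > 0\<close> by (simp add: d_def)
  have "finitely_covered (T ` S) (d * onorm T)"
    using d S by (intro finitely_covered_image bounded_linear.linear[OF T] finitely_covered_onorm[OF T]) auto
  moreover have "d * onorm T \<le> e" using o \<open>e > 0\<close> by (simp add: d_def field_simps)
  ultimately show ?thesis using finitely_covered_mono by blast
qed

lemma finitely_covered_compact: "compact S \<Longrightarrow> e > 0 \<Longrightarrow> finitely_covered S e"
  unfolding compact_eq_totally_bounded finitely_covered_def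
  by (meson SUP_mono ball_subset_cball order_trans)

context banach_function_space
begin

interpretation MM: pair_sigma_finite M M ..

lemma positive_cone_eqI:
  assumes "f \<in> P" "g \<in> P" "AE x in M. modulus f x = modulus g x"
  shows "f = g"
proof (rule rep_inject)
  show "AE x in M. rep f x = rep g x"
    using assms[unfolded positive_cone_iff] by eventually_elim (simp add: modulus_def)
qed

text \<open>The work lies in the greatest lower bound: a lower bound \<open>g\<close> may lie
  outside the cone, but \<open>v n - g\<close> in the cone makes it real with real part below every
  \<open>v n\<close>, hence nonpositive a.e.\<close>

lemma order_continuous_tendsto:
  assumes oc: "order_continuous_norm P" and v: "\<And>n. v n \<in> P"
    and dec: "AE x in M. \<forall>n. modulus (v (Suc n)) x \<le> modulus (v n) x"
    and lim: "AE x in M. (\<lambda>n. modulus (v n) x) \<longlonglongrightarrow> 0"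
  shows "(\<lambda>n. norm (v n)) \<longlonglongrightarrow> 0"
proof (rule oc[unfolded order_continuous_norm_def, rule_format])
  show "v n \<in> P" for n by (rule v)
  show "v n - v (Suc n) \<in> P" for n
    unfolding positive_cone_diff_iff[OF v v] using dec by eventually_elim simp
  fix g assume g: "\<And>n. v n - g \<in> P"
  have "AE x in M. \<forall>n. rep (v n - g) x \<in> \<real>\<^sub>\<ge>\<^sub>0" "AE x in M. \<forall>n. rep (v n - g) x = rep (v n) x - rep g x"
    "AE x in M. \<forall>n. rep (v n) x = of_real (cmod (rep (v n) x))"
    using g v rep_diff unfolding AE_all_countable by (auto simp: positive_cone_def nonneg_Reals_iff_cmod)
  then show "- g \<in> P"
    unfolding positive_cone_def mem_Collect_eq using rep_uminus[of g] lim
  proof eventually_elim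
    case (elim x)
    have *: "Re (rep g x) \<le> cmod (rep (v n) x) \<and> Im (rep g x) = 0" for n
    proof -
      have "of_real (cmod (rep (v n) x)) - rep g x \<in> \<real>\<^sub>\<ge>\<^sub>0" using elim(1-3) by metis
      then show ?thesis by (simp add: complex_nonneg_Reals_iff)
    qed
    have "(\<lambda>n. cmod (rep (v n) x)) \<longlonglongrightarrow> 0"
      using elim(5) unfolding modulus_def by (subst (asm) ennreal_tendsto_0_iff) auto
    then have "Re (rep g x) \<le> 0" using * by (intro LIMSEQ_le_const[of _ 0]) auto
    then show ?case using elim(4) * by (simp add: complex_nonneg_Reals_iff)
  qed
qed

section \<open>Precompact images of order intervals\<close>

text \<open>The image under \<open>b\<close> of all \<open>g\<close> between 0 and 1. The constant 1
  need not represent an element of the space; the majorant of a general order interval is absorbed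
  in the kernel instead.\<close>

definition order_image :: "('a \<times> 'a \<Rightarrow> ennreal) \<Rightarrow> 'l set"
  where "order_image b = {h \<in> P. \<exists>g\<in>borel_measurable M. (\<forall>y. g y \<le> 1) \<and>
    (AE x in M. modulus h x = (\<integral>\<^sup>+ y. b (x, y) * g y \<partial>M))}"

lemma order_imageI:
  "h \<in> P \<Longrightarrow> g \<in> borel_measurable M \<Longrightarrow> (\<And>y. g y \<le> 1) \<Longrightarrow>
    AE x in M. modulus h x = (\<integral>\<^sup>+ y. b (x, y) * g y \<partial>M) \<Longrightarrow> h \<in> order_image b"
  by (auto simp: order_image_def)

definition precompact_kernel :: "('a \<times> 'a \<Rightarrow> ennreal) \<Rightarrow> bool"
  where "precompact_kernel b \<longleftrightarrow> (\<forall>e>0. finitely_covered (order_image b) e)"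

definition dominated_kernel :: "('a \<times> 'a \<Rightarrow> ennreal) \<Rightarrow> bool"
  where "dominated_kernel b \<longleftrightarrow> b \<in> borel_measurable (M \<Otimes>\<^sub>M M) \<and> (\<exists>w\<in>P. AE x in M. (\<integral>\<^sup>+ y. b (x, y) \<partial>M) \<le> modulus w x)"

lemma dominated_kernel_mono:
  assumes "dominated_kernel b" "c \<in> borel_measurable (M \<Otimes>\<^sub>M M)" "\<And>z. c z \<le> b z"
  shows "dominated_kernel c"
proof -
  obtain w where w: "w \<in> P" "AE x in M. (\<integral>\<^sup>+ y. b (x, y) \<partial>M) \<le> modulus w x"
    using assms(1) by (auto simp: dominated_kernel_def)
  have "AE x in M. (\<integral>\<^sup>+ y. c (x, y) \<partial>M) \<le> modulus w x"
    using w(2) by eventually_elim (rule order_trans[OF nn_integral_mono[OF assms(3)]])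
  then show ?thesis using w(1) assms(2) by (auto simp: dominated_kernel_def)
qed

lemma order_image_exists:
  assumes b: "dominated_kernel b" and g[measurable]: "g \<in> borel_measurable M" and g1: "\<And>y. g y \<le> 1"
  obtains h where "h \<in> P" "AE x in M. modulus h x = (\<integral>\<^sup>+ y. b (x, y) * g y \<partial>M)"
proof -
  have [measurable]: "b \<in> borel_measurable (M \<Otimes>\<^sub>M M)" using b by (simp add: dominated_kernel_def)
  obtain w where w: "w \<in> P" "AE x in M. (\<integral>\<^sup>+ y. b (x, y) \<partial>M) \<le> modulus w x"
    using b by (auto simp: dominated_kernel_def)
  have "b z * g y \<le> b z" for z y using mult_left_mono[OF g1, of "b z" y] by simp
  then have "(\<integral>\<^sup>+ y. b (x, y) * g y \<partial>M) \<le> (\<integral>\<^sup>+ y. b (x, y) \<partial>M)" for x by (intro nn_integral_mono)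
  then have "AE x in M. (\<integral>\<^sup>+ y. b (x, y) * g y \<partial>M) \<le> modulus w x"
    using w(2) by (auto elim!: eventually_mono intro: order_trans)
  moreover have "(\<lambda>x. \<integral>\<^sup>+ y. b (x, y) * g y \<partial>M) \<in> borel_measurable M" by measurable
  ultimately show ?thesis using positive_element[of "\<lambda>x. \<integral>\<^sup>+ y. b (x, y) * g y \<partial>M" w] that by blast
qed

lemma order_image_add:
  assumes dom: "dominated_kernel b" "dominated_kernel c" and h: "h \<in> order_image (\<lambda>z. b z + c z)"
  obtains h1 h2 where "h1 \<in> order_image b" "h2 \<in> order_image c" "h = h1 + h2"
proof -
  have bc[measurable]: "b \<in> borel_measurable (M \<Otimes>\<^sub>M M)" "c \<in> borel_measurable (M \<Otimes>\<^sub>M M)"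
    using dom by (auto simp: dominated_kernel_def)
  obtain g where g[measurable]: "g \<in> borel_measurable M" and g1: "\<And>y. g y \<le> 1"
    and hg: "AE x in M. modulus h x = (\<integral>\<^sup>+ y. (b (x, y) + c (x, y)) * g y \<partial>M)" and hP: "h \<in> P"
    using h by (auto simp: order_image_def)
  obtain h1 where h1: "h1 \<in> P" "AE x in M. modulus h1 x = (\<integral>\<^sup>+ y. b (x, y) * g y \<partial>M)"
    using order_image_exists[OF dom(1) g g1] .
  obtain h2 where h2: "h2 \<in> P" "AE x in M. modulus h2 x = (\<integral>\<^sup>+ y. c (x, y) * g y \<partial>M)"
    using order_image_exists[OF dom(2) g g1] .
  have "h = h1 + h2"
  proof (rule positive_cone_eqI[OF hP positive_cone_add[OF h1(1) h2(1)]])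
    show "AE x in M. modulus h x = modulus (h1 + h2) x"
      using hg h1(2) h2(2) modulus_add[OF h1(1) h2(1)] AE_space
    proof eventually_elim
      case (elim x)
      have [measurable]: "(\<lambda>y. b (x, y)) \<in> borel_measurable M" "(\<lambda>y. c (x, y)) \<in> borel_measurable M"
        using elim(5) bc by (auto intro: measurable_Pair2)
      show ?case using elim by (simp add: distrib_right nn_integral_add)
    qed
  qed
  moreover have "h1 \<in> order_image b" "h2 \<in> order_image c"
    using order_imageI[OF h1(1) g g1 h1(2)] order_imageI[OF h2(1) g g1 h2(2)] by auto
  ultimately show ?thesis using that by blast
qed

lemma precompact_kernel_add:
  assumes "dominated_kernel b" "dominated_kernel c" "precompact_kernel b" "precompact_kernel c"
  shows "precompact_kernel (\<lambda>z. b z + c z)"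
  unfolding precompact_kernel_def
proof (intro allI impI)
  fix e :: real assume "e > 0"
  then have "finitely_covered (order_image b) (e/2)" "finitely_covered (order_image c) (e/2)"
    using assms(3,4) by (auto simp: precompact_kernel_def)
  then have "finitely_covered (order_image (\<lambda>z. b z + c z)) (e/2 + e/2)"
  proof (rule finitely_covered_plus)
    fix h assume "h \<in> order_image (\<lambda>z. b z + c z)"
    from order_image_add[OF assms(1,2) this] show "\<exists>x\<in>order_image b. \<exists>y\<in>order_image c. h = x + y" by blast
  qed
  then show "finitely_covered (order_image (\<lambda>z. b z + c z)) e" by simp
qed

lemma precompact_kernel_sum:
  assumes "finite I" "\<And>i. i \<in> I \<Longrightarrow> dominated_kernel (b i)" "\<And>i. i \<in> I \<Longrightarrow> precompact_kernel (b i)"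
  shows "precompact_kernel (\<lambda>z. \<Sum>i\<in>I. b i z) \<and> dominated_kernel (\<lambda>z. \<Sum>i\<in>I. b i z)"
  using assms
proof (induction I rule: finite_induct)
  case empty
  have "order_image (\<lambda>z. 0) \<subseteq> {0}"
  proof
    fix h assume "h \<in> order_image (\<lambda>z. 0)"
    then have "h \<in> P" "AE x in M. modulus h x = 0" by (auto simp: order_image_def)
    moreover have "AE x in M. modulus 0 x = 0" using rep_0 by eventually_elim (simp add: modulus_def)
    ultimately have "h = 0" by (intro positive_cone_eqI positive_cone_0) (auto elim: eventually_elim2)
    then show "h \<in> {0}" by simp
  qed
  then have "precompact_kernel (\<lambda>z. 0)"
    unfolding precompact_kernel_def finitely_covered_def by (auto intro!: exI[of _ "{0}"])
  moreover have "dominated_kernel (\<lambda>z. 0)"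
    unfolding dominated_kernel_def using positive_cone_0 by auto
  ultimately show ?case by simp
next
  case (insert i I)
  have 1: "dominated_kernel (\<lambda>z. b i z + (\<Sum>i\<in>I. b i z))"
  proof -
    obtain w v where w: "w \<in> P" "AE x in M. (\<integral>\<^sup>+ y. b i (x, y) \<partial>M) \<le> modulus w x"
      and v: "v \<in> P" "AE x in M. (\<integral>\<^sup>+ y. (\<Sum>i\<in>I. b i (x, y)) \<partial>M) \<le> modulus v x"
      using insert.IH[OF insert.prems] insert.prems(1)[of i] unfolding dominated_kernel_def by blast
    have bm: "b i \<in> borel_measurable (M \<Otimes>\<^sub>M M)" "(\<lambda>z. \<Sum>i\<in>I. b i z) \<in> borel_measurable (M \<Otimes>\<^sub>M M)"
      using insert by (auto simp: dominated_kernel_def)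
    have "AE x in M. (\<integral>\<^sup>+ y. b i (x, y) + (\<Sum>i\<in>I. b i (x, y)) \<partial>M) \<le> modulus (w + v) x"
      using w(2) v(2) modulus_add[OF w(1) v(1)] AE_space
    proof eventually_elim
      case (elim x)
      have [measurable]: "(\<lambda>y. b i (x, y)) \<in> borel_measurable M" "(\<lambda>y. \<Sum>i\<in>I. b i (x, y)) \<in> borel_measurable M"
        using measurable_Pair2[OF bm(1) elim(4)] measurable_Pair2[OF bm(2) elim(4)] by auto
      show ?case using elim by (simp add: nn_integral_add add_mono)
    qed
    then show ?thesis
      using bm positive_cone_add[OF w(1) v(1)] by (auto simp: dominated_kernel_def)
  qed
  have "precompact_kernel (\<lambda>z. b i z + (\<Sum>i\<in>I. b i z))" using insert by (intro precompact_kernel_add) auto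
  with 1 show ?case using insert.hyps by simp
qed

text \<open>An image under \<open>b\<close> is an image under the sum minus the image of the same
  \<open>g\<close> under \<open>c\<close>. This is the complement step of the induction over
  measurable sets.\<close>

lemma precompact_kernel_diff:
  assumes dom: "dominated_kernel (\<lambda>z. b z + c z)" "dominated_kernel c" "b \<in> borel_measurable (M \<Otimes>\<^sub>M M)"
    and pc: "precompact_kernel (\<lambda>z. b z + c z)" "precompact_kernel c"
  shows "precompact_kernel b"
  unfolding precompact_kernel_def
proof (intro allI impI)
  fix e :: real assume e: "e > 0"
  have bc[measurable]: "b \<in> borel_measurable (M \<Otimes>\<^sub>M M)" "c \<in> borel_measurable (M \<Otimes>\<^sub>M M)"
    using dom by (auto simp: dominated_kernel_def)
  have "finitely_covered (order_image (\<lambda>z. b z + c z)) (e/2)" "finitely_covered ((*\<^sub>C) (- 1) ` order_image c) (e/2)"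
    using pc e by (auto simp: precompact_kernel_def intro!: finitely_covered_scaleC)
  then have "finitely_covered (order_image b) (e/2 + e/2)"
  proof (rule finitely_covered_plus)
    fix h assume "h \<in> order_image b"
    then obtain g where g[measurable]: "g \<in> borel_measurable M" and g1: "\<And>y. g y \<le> 1"
      and hg: "AE x in M. modulus h x = (\<integral>\<^sup>+ y. b (x, y) * g y \<partial>M)" and hP: "h \<in> P"
      by (auto simp: order_image_def)
    obtain h2 where h2: "h2 \<in> P" "AE x in M. modulus h2 x = (\<integral>\<^sup>+ y. c (x, y) * g y \<partial>M)"
      using order_image_exists[OF dom(2) g g1] .
    have "AE x in M. modulus (h + h2) x = (\<integral>\<^sup>+ y. (b (x, y) + c (x, y)) * g y \<partial>M)"
      using hg h2(2) modulus_add[OF hP h2(1)] AE_space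
    proof eventually_elim
      case (elim x)
      have [measurable]: "(\<lambda>y. b (x, y)) \<in> borel_measurable M" "(\<lambda>y. c (x, y)) \<in> borel_measurable M"
        using elim(4) bc by (auto intro: measurable_Pair2)
      show ?case using elim by (simp add: distrib_right nn_integral_add)
    qed
    then have "h + h2 \<in> order_image (\<lambda>z. b z + c z)" "h2 \<in> order_image c"
      using order_imageI[OF positive_cone_add[OF hP h2(1)] g g1] order_imageI[OF h2(1) g g1 h2(2)] by auto
    moreover have "h = (h + h2) + (- 1) *\<^sub>C h2" by (simp flip: uminus_eq_scaleC)
    ultimately show "\<exists>x\<in>order_image (\<lambda>z. b z + c z). \<exists>y\<in>(*\<^sub>C) (- 1) ` order_image c. h = x + y" by blast
  qed
  then show "finitely_covered (order_image b) e" by simp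
qed

lemma precompact_kernel_scale:
  assumes pc: "precompact_kernel b" and b[measurable]: "b \<in> borel_measurable (M \<Otimes>\<^sub>M M)" and r: "0 \<le> r"
  shows "precompact_kernel (\<lambda>z. ennreal r * b z)"
  unfolding precompact_kernel_def
proof (intro allI impI)
  fix e :: real assume e: "e > 0"
  have bl: "bounded_linear ((*\<^sub>R) r :: 'l \<Rightarrow> 'l)" by (rule bounded_linear_scaleR_right)
  have "finitely_covered ((*\<^sub>R) r ` insert 0 (order_image b)) e"
  proof (rule finitely_covered_bounded_linear_image[OF bl _ e], intro allI impI)
    fix e :: real assume "e > 0"
    then obtain F where "finite F" "order_image b \<subseteq> (\<Union>x\<in>F. cball x e)"
      using pc by (auto simp: precompact_kernel_def finitely_covered_def)
    then show "finitely_covered (insert 0 (order_image b)) e"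
      unfolding finitely_covered_def using \<open>e > 0\<close> by (intro exI[of _ "insert 0 F"]) auto
  qed
  moreover have "order_image (\<lambda>z. ennreal r * b z) \<subseteq> (*\<^sub>R) r ` insert 0 (order_image b)"
  proof
    fix h assume "h \<in> order_image (\<lambda>z. ennreal r * b z)"
    then obtain g where g[measurable]: "g \<in> borel_measurable M" and g1: "\<And>y. g y \<le> 1"
      and hg: "AE x in M. modulus h x = (\<integral>\<^sup>+ y. ennreal r * b (x, y) * g y \<partial>M)" and hP: "h \<in> P"
      by (auto simp: order_image_def)
    show "h \<in> (*\<^sub>R) r ` insert 0 (order_image b)"
    proof (cases "r = 0")
      case True
      have "AE x in M. modulus h x = modulus 0 x"
        using hg rep_0 by eventually_elim (simp add: True modulus_def)
      then have "h = 0" by (rule positive_cone_eqI[OF hP positive_cone_0])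
      then show ?thesis by auto
    next
      case False
      have "AE x in M. modulus ((1 / r) *\<^sub>R h) x = (\<integral>\<^sup>+ y. b (x, y) * g y \<partial>M)"
        using hg modulus_scaleR[of "1 / r" h] AE_space
      proof eventually_elim
        case (elim x)
        have [measurable]: "(\<lambda>y. b (x, y)) \<in> borel_measurable M" using elim(3) by (intro measurable_Pair2[OF b])
        have "ennreal (1 / r) * ennreal r = 1" using r False by (simp flip: ennreal_mult)
        then show ?case using elim r by (simp add: mult.assoc nn_integral_cmult) (simp flip: mult.assoc)
      qed
      then have "(1 / r) *\<^sub>R h \<in> order_image b"
        using r by (intro order_imageI[OF positive_cone_scaleR[OF hP] g g1]) auto
      moreover have "h = r *\<^sub>R ((1 / r) *\<^sub>R h)" using False by simp
      ultimately show ?thesis by blast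
    qed
  qed
  ultimately show "finitely_covered (order_image (\<lambda>z. ennreal r * b z)) e"
    using finitely_covered_mono by blast
qed

text \<open>Order continuity of the norm enters here. The integrals \<open>v n\<close> of the
  remainders decrease to 0 a.e. by dominated convergence, so their norms tend to 0; and the image
  under the remainder \<open>r n\<close> lies in the ball of radius
  \<open>norm (v n)\<close>.\<close>

lemma precompact_kernel_limit:
  assumes oc: "order_continuous_norm P" and dom: "dominated_kernel b"
    and split: "\<And>n z. b z = c n z + r n z" and pc: "\<And>n. precompact_kernel (c n)"
    and meas: "\<And>n. c n \<in> borel_measurable (M \<Otimes>\<^sub>M M)" "\<And>n. r n \<in> borel_measurable (M \<Otimes>\<^sub>M M)"
    and dec: "\<And>n z. r (Suc n) z \<le> r n z" and lim: "\<And>z. (\<lambda>n. r n z) \<longlonglongrightarrow> 0"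
  shows "precompact_kernel b"
  unfolding precompact_kernel_def
proof (intro allI impI)
  fix e :: real assume e: "e > 0"
  have bm[measurable]: "b \<in> borel_measurable (M \<Otimes>\<^sub>M M)" using dom by (simp add: dominated_kernel_def)
  have domc: "dominated_kernel (c n)" and domr: "dominated_kernel (r n)" for n
    by (rule dominated_kernel_mono[OF dom]; simp add: meas split[of _ n])+
  obtain w where w: "w \<in> P" "AE x in M. (\<integral>\<^sup>+ y. b (x, y) \<partial>M) \<le> modulus w x"
    using dom by (auto simp: dominated_kernel_def)
  have "\<exists>v\<in>P. AE x in M. modulus v x = (\<integral>\<^sup>+ y. r n (x, y) * 1 \<partial>M)" for n
    by (rule order_image_exists[OF domr[of n], of "\<lambda>_. 1"]) auto
  then obtain v where v: "\<And>n. v n \<in> P" "\<And>n. AE x in M. modulus (v n) x = (\<integral>\<^sup>+ y. r n (x, y) \<partial>M)"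
    unfolding mult_1_right by metis
  have v_all: "AE x in M. \<forall>n. modulus (v n) x = (\<integral>\<^sup>+ y. r n (x, y) \<partial>M)"
    using v(2) by (simp add: AE_all_countable)
  have "(\<lambda>n. norm (v n)) \<longlonglongrightarrow> 0"
  proof (rule order_continuous_tendsto[OF oc v(1)])
    show "AE x in M. \<forall>n. modulus (v (Suc n)) x \<le> modulus (v n) x"
      using v_all by eventually_elim (simp add: nn_integral_mono dec)
    show "AE x in M. (\<lambda>n. modulus (v n) x) \<longlonglongrightarrow> 0"
      using v_all w(2) AE_space
    proof eventually_elim
      case (elim x)
      have [measurable]: "(\<lambda>y. b (x, y)) \<in> borel_measurable M" "\<And>n. (\<lambda>y. r n (x, y)) \<in> borel_measurable M"
        using elim(3) bm meas by (auto intro: measurable_Pair2)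
      have "(\<lambda>n. \<integral>\<^sup>+ y. r n (x, y) \<partial>M) \<longlonglongrightarrow> (\<integral>\<^sup>+ y. 0 \<partial>M)"
      proof (rule nn_integral_dominated_convergence)
        show "(\<integral>\<^sup>+ y. b (x, y) \<partial>M) < \<infinity>" using elim(2) by (auto simp: modulus_def intro: le_less_trans)
        show "AE y in M. r n (x, y) \<le> b (x, y)" for n by (simp add: split[of _ n])
      qed (use lim in auto)
      then show ?case using elim(1) by simp
    qed
  qed
  then have "eventually (\<lambda>n. norm (v n) < e/2) sequentially" using e by (intro order_tendstoD) auto
  then obtain n where n: "norm (v n) < e/2" by (auto simp: eventually_sequentially)
  have "finitely_covered (order_image (c n)) (e/2)" using pc e by (simp add: precompact_kernel_def)
  moreover have "finitely_covered (order_image (r n)) (e/2)"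
    unfolding finitely_covered_def
  proof (intro exI[of _ "{0}"] conjI subsetI)
    fix h assume "h \<in> order_image (r n)"
    then obtain g where g1: "\<And>y. g y \<le> 1"
      and hg: "AE x in M. modulus h x = (\<integral>\<^sup>+ y. r n (x, y) * g y \<partial>M)" by (auto simp: order_image_def)
    have le: "r n z * g y \<le> r n z" for z y using mult_left_mono[OF g1, of "r n z" y] by simp
    have "AE x in M. modulus h x \<le> modulus (v n) x"
      using hg v(2)[of n]
    proof eventually_elim
      case (elim x)
      show ?case unfolding elim by (intro nn_integral_mono le)
    qed
    then have "norm h \<le> norm (v n)" by (rule norm_mono)
    then show "h \<in> (\<Union>x\<in>{0}. cball x (e/2))" using n by simp
  qed simp
  ultimately have "finitely_covered (order_image (\<lambda>z. c n z + r n z)) (e/2 + e/2)"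
    by (rule finitely_covered_plus) (metis order_image_add[OF domc domr])
  moreover have "(\<lambda>z. c n z + r n z) = b" using split[of _ n] by auto
  ultimately show "finitely_covered (order_image b) e" by simp
qed

lemma dominated_rectangle:
  assumes Z[measurable]: "Z \<in> sets M" and z: "z \<in> P" "AE x in M. indicator Z x \<le> modulus z x"
    and Y[measurable]: "Y \<in> sets M" and fin: "emeasure M Y < \<infinity>"
  shows "dominated_kernel (indicator (Z \<times> Y))"
proof -
  define r where "r = enn2real (emeasure M Y)"
  have r: "emeasure M Y = ennreal r" "0 \<le> r" using fin by (auto simp: r_def)
  have "AE x in M. (\<integral>\<^sup>+ y. indicator (Z \<times> Y) (x, y) \<partial>M) \<le> modulus (r *\<^sub>R z) x"
    using z(2) modulus_scaleR[of r z]
  proof eventually_elim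
    case (elim x)
    have "(\<integral>\<^sup>+ y. indicator (Z \<times> Y) (x, y) \<partial>M) = (\<integral>\<^sup>+ y. indicator Z x * indicator Y y \<partial>M)"
      by (intro nn_integral_cong) (simp add: indicator_def)
    also have "\<dots> = indicator Z x * ennreal r" by (simp add: nn_integral_cmult r)
    also have "\<dots> \<le> modulus (r *\<^sub>R z) x" using elim r by (simp add: mult.commute mult_left_mono)
    finally show ?case .
  qed
  then show ?thesis
    unfolding dominated_kernel_def using positive_cone_scaleR[OF z(1) r(2)] by auto
qed

text \<open>All images are multiples of one element \<open>z0\<close> with factors between 0 and the
  measure of \<open>Y\<close>, so they lie in a compact segment.\<close>

lemma precompact_rectangle:
  assumes Z[measurable]: "Z \<in> sets M" and z: "z \<in> P" "AE x in M. indicator Z x \<le> modulus z x"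
    and Y[measurable]: "Y \<in> sets M" and fin: "emeasure M Y < \<infinity>"
  shows "precompact_kernel (indicator (Z \<times> Y))"
proof -
  obtain z0 where z0: "z0 \<in> P" "AE x in M. modulus z0 x = indicator Z x"
    using positive_element[OF _ z(2)] by (metis Z borel_measurable_indicator)
  define r where "r = enn2real (emeasure M Y)"
  have r: "emeasure M Y = ennreal r" "0 \<le> r" using fin by (auto simp: r_def)
  have "order_image (indicator (Z \<times> Y)) \<subseteq> (\<lambda>t. t *\<^sub>R z0) ` {0..r}"
  proof
    fix h assume "h \<in> order_image (indicator (Z \<times> Y))"
    then obtain g where g[measurable]: "g \<in> borel_measurable M" and g1: "\<And>y. g y \<le> 1"
      and hg: "AE x in M. modulus h x = (\<integral>\<^sup>+ y. indicator (Z \<times> Y) (x, y) * g y \<partial>M)" and hP: "h \<in> P"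
      by (auto simp: order_image_def)
    define t where "t = (\<integral>\<^sup>+ y. indicator Y y * g y \<partial>M)"
    have "indicator Y y * g y \<le> indicator Y y" for y using mult_left_mono[OF g1, of "indicator Y y" y] by simp
    then have "t \<le> (\<integral>\<^sup>+ y. indicator Y y \<partial>M)" unfolding t_def by (intro nn_integral_mono)
    then have tr: "t \<le> ennreal r" by (simp add: r)
    then have "t < \<infinity>" by (auto intro: le_less_trans)
    then have t: "t = ennreal (enn2real t)" "enn2real t \<in> {0..r}"
      using r(2) tr by (auto simp: enn2real_leI)
    have "AE x in M. modulus h x = modulus (enn2real t *\<^sub>R z0) x"
      using hg z0(2) modulus_scaleR[of "enn2real t" z0]
    proof eventually_elim
      case (elim x)
      have "(\<integral>\<^sup>+ y. indicator (Z \<times> Y) (x, y) * g y \<partial>M) = (\<integral>\<^sup>+ y. indicator Z x * (indicator Y y * g y) \<partial>M)"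
        by (intro nn_integral_cong) (simp add: indicator_def)
      also have "\<dots> = indicator Z x * t" unfolding t_def by (rule nn_integral_cmult) measurable
      finally show ?case using elim t(1) by (simp add: mult.commute)
    qed
    then have "h = enn2real t *\<^sub>R z0"
      by (intro positive_cone_eqI hP positive_cone_scaleR z0) auto
    then show "h \<in> (\<lambda>t. t *\<^sub>R z0) ` {0..r}" using t(2) by blast
  qed
  moreover have "compact ((\<lambda>t. t *\<^sub>R z0) ` {0..r})"
    by (intro compact_continuous_image continuous_intros) auto
  ultimately show ?thesis
    unfolding precompact_kernel_def using finitely_covered_compact finitely_covered_mono by blast
qed

text \<open>Dynkin's induction from rectangles: complements by
  \<open>precompact_kernel_diff\<close>, disjoint unions by \<open>precompact_kernel_limit\<close>
  along the partial unions. Staying inside \<open>Z \<times> Y\<close> keeps all kernels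
  dominated.\<close>

lemma precompact_indicator:
  assumes oc: "order_continuous_norm P"
    and Z[measurable]: "Z \<in> sets M" and z: "z \<in> P" "AE x in M. indicator Z x \<le> modulus z x"
    and Y[measurable]: "Y \<in> sets M" and fin: "emeasure M Y < \<infinity>" and E: "E \<in> sets (M \<Otimes>\<^sub>M M)"
  shows "precompact_kernel (indicator (E \<inter> Z \<times> Y))"
proof -
  have ZY[measurable]: "Z \<times> Y \<in> sets (M \<Otimes>\<^sub>M M)" by measurable
  have dom: "dominated_kernel (indicator (E \<inter> Z \<times> Y))" if "E \<in> sets (M \<Otimes>\<^sub>M M)" for E
    using that by (intro dominated_kernel_mono[OF dominated_rectangle[OF Z z Y fin]]) (auto simp: indicator_def)
  have sets: "sets (M \<Otimes>\<^sub>M M) = sigma_sets (space M \<times> space M) {a \<times> b | a b. a \<in> sets M \<and> b \<in> sets M}"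
    by (rule sets_pair_measure)
  have sub: "{a \<times> b | a b. a \<in> sets M \<and> b \<in> sets M} \<subseteq> Pow (space M \<times> space M)"
    using sets.sets_into_space by fastforce
  from E[unfolded sets] show ?thesis
  proof (induction E rule: sigma_sets_induct_disjoint[OF Int_stable_pair_measure_generator sub, consumes 1])
    case (1 E)
    then obtain F G where E: "E = F \<times> G" and [measurable]: "F \<in> sets M" "G \<in> sets M" by auto
    have "precompact_kernel (indicator ((F \<inter> Z) \<times> (G \<inter> Y)))"
    proof (rule precompact_rectangle[OF _ z(1)])
      show "AE x in M. indicator (F \<inter> Z) x \<le> modulus z x"
        using z(2) by eventually_elim (auto simp: indicator_def split: if_splits)
      show "emeasure M (G \<inter> Y) < \<infinity>" using fin by (meson Int_lower2 Y emeasure_mono le_less_trans)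
    qed measurable
    then show ?case by (simp add: E Times_Int_Times)
  next
    case 2
    have "precompact_kernel (\<lambda>z. \<Sum>i\<in>{}. indicator (Z \<times> Y) z :: ennreal)"
      by (rule precompact_kernel_sum[THEN conjunct1]) auto
    moreover have "indicator {} = (\<lambda>z. 0 :: ennreal)" by (auto simp: indicator_def)
    ultimately show ?case by simp
  next
    case (3 E)
    have E[measurable]: "E \<in> sets (M \<Otimes>\<^sub>M M)" using 3 by (simp add: sets)
    let ?E' = "space M \<times> space M - E"
    have [measurable]: "?E' \<in> sets (M \<Otimes>\<^sub>M M)" by (simp flip: space_pair_measure)
    have eq: "indicator (Z \<times> Y) = (\<lambda>z. indicator (?E' \<inter> Z \<times> Y) z + indicator (E \<inter> Z \<times> Y) z :: ennreal)"
      using sets.sets_into_space[OF Z] sets.sets_into_space[OF Y] by (auto simp: indicator_def fun_eq_iff)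
    show ?case
      by (rule precompact_kernel_diff[of _ "indicator (E \<inter> Z \<times> Y)"])
        (use 3 dom[OF E] dominated_rectangle[OF Z z Y fin] precompact_rectangle[OF Z z Y fin] in \<open>simp_all flip: eq\<close>)
  next
    case (4 E)
    have E[measurable]: "E i \<in> sets (M \<Otimes>\<^sub>M M)" for i using 4 by (auto simp: sets)
    have disj: "disjoint_family E" using 4 by simp
    have sum: "indicator ((\<Union>i<n. E i) \<inter> Z \<times> Y) = (\<lambda>z. \<Sum>i<n. indicator (E i \<inter> Z \<times> Y) z :: ennreal)" for n
    proof
      fix z
      have "indicator (\<Union>i<n. E i) z = (\<Sum>i<n. indicator (E i) z :: ennreal)"
        using disj by (intro indicator_UN_disjoint) (auto simp: disjoint_family_on_def)
      then show "indicator ((\<Union>i<n. E i) \<inter> Z \<times> Y) z = (\<Sum>i<n. indicator (E i \<inter> Z \<times> Y) z :: ennreal)"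
        by (simp add: indicator_inter_arith sum_distrib_right)
    qed
    let ?R = "\<lambda>n. (\<Union>i. E i) - (\<Union>i<n. E i)"
    show ?case
    proof (rule precompact_kernel_limit[OF oc, where c = "\<lambda>n. indicator ((\<Union>i<n. E i) \<inter> Z \<times> Y)"
          and r = "\<lambda>n. indicator (?R n \<inter> Z \<times> Y)"])
      show "dominated_kernel (indicator (\<Union> (range E) \<inter> Z \<times> Y))" by (intro dom) measurable
      show "precompact_kernel (indicator ((\<Union>i<n. E i) \<inter> Z \<times> Y))" for n
        unfolding sum using precompact_kernel_sum[of "{..<n}" "\<lambda>i. indicator (E i \<inter> Z \<times> Y)"] dom[OF E] 4 by blast
      fix z
      show "(\<lambda>n. indicator (?R n \<inter> Z \<times> Y) z :: ennreal) \<longlonglongrightarrow> 0"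
      proof (cases "z \<in> (\<Union>i. E i)")
        case True
        then obtain i where "z \<in> E i" by blast
        then have "indicator (?R n \<inter> Z \<times> Y) z = (0 :: ennreal)" if "n \<ge> Suc i" for n
          using that by (auto simp: indicator_def)
        then show ?thesis by (intro tendsto_eventually) (auto simp: eventually_sequentially)
      qed (simp add: indicator_def)
    qed (auto simp: indicator_def)
  qed
qed

lemma order_image_subset:
  assumes "AE x in M. \<forall>g\<in>borel_measurable M. (\<integral>\<^sup>+ y. b (x, y) * g y \<partial>M) = (\<integral>\<^sup>+ y. c (x, y) * g y \<partial>M)"
  shows "order_image b \<subseteq> order_image c"
proof
  fix h assume "h \<in> order_image b"
  then obtain g where g: "g \<in> borel_measurable M" "\<forall>y. g y \<le> 1"
    and hg: "AE x in M. modulus h x = (\<integral>\<^sup>+ y. b (x, y) * g y \<partial>M)" and hP: "h \<in> P"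
    by (auto simp: order_image_def)
  have "AE x in M. modulus h x = (\<integral>\<^sup>+ y. c (x, y) * g y \<partial>M)"
    using hg assms by eventually_elim (use g(1) in auto)
  then show "h \<in> order_image c" using g hP by (auto simp: order_image_def)
qed

lemma precompact_simple_kernel:
  assumes oc: "order_continuous_norm P"
    and s: "simple_function (M \<Otimes>\<^sub>M M) s" "\<And>z. s z < \<infinity>"
    and Z[measurable]: "Z \<in> sets M" and z: "z \<in> P" "AE x in M. indicator Z x \<le> modulus z x"
    and Y[measurable]: "Y \<in> sets M" and fin: "emeasure M Y < \<infinity>"
  shows "precompact_kernel (\<lambda>z. s z * indicator (Z \<times> Y) z)"
proof -
  let ?X = "space (M \<Otimes>\<^sub>M M)"
  let ?E = "\<lambda>c. (s -` {c} \<inter> ?X) \<inter> Z \<times> Y"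
  have E: "s -` {c} \<inter> ?X \<in> sets (M \<Otimes>\<^sub>M M)" for c using s(1) by (rule simple_functionD)
  have Em[measurable]: "?E c \<in> sets (M \<Otimes>\<^sub>M M)" for c using E by measurable
  have ds: "dominated_kernel (\<lambda>z. c * indicator (?E c) z)" if "c \<in> s ` ?X" for c
  proof -
    define r where "r = enn2real c"
    have r: "c = ennreal r" "0 \<le> r" using that s(2) by (auto simp: r_def)
    obtain w where w: "w \<in> P" "AE x in M. (\<integral>\<^sup>+ y. indicator (Z \<times> Y) (x, y) \<partial>M) \<le> modulus w x"
      using dominated_rectangle[OF Z z Y fin] by (auto simp: dominated_kernel_def)
    have "AE x in M. (\<integral>\<^sup>+ y. c * indicator (?E c) (x, y) \<partial>M) \<le> modulus (r *\<^sub>R w) x"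
      using w(2) modulus_scaleR[of r w] AE_space
    proof eventually_elim
      case (elim x)
      have "(\<integral>\<^sup>+ y. c * indicator (?E c) (x, y) \<partial>M) \<le> (\<integral>\<^sup>+ y. c * indicator (Z \<times> Y) (x, y) \<partial>M)"
        by (intro nn_integral_mono mult_left_mono) (auto simp: indicator_def)
      also have "\<dots> = c * (\<integral>\<^sup>+ y. indicator (Z \<times> Y) (x, y) \<partial>M)"
        using elim(3) by (intro nn_integral_cmult) measurable
      also have "\<dots> \<le> modulus (r *\<^sub>R w) x" using elim r by (simp add: mult_left_mono)
      finally show ?case .
    qed
    moreover have "(\<lambda>z. c * indicator (?E c) z) \<in> borel_measurable (M \<Otimes>\<^sub>M M)" by measurable
    ultimately show ?thesis using positive_cone_scaleR[OF w(1) r(2)] by (auto simp: dominated_kernel_def)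
  qed
  have ps: "precompact_kernel (\<lambda>z. c * indicator (?E c) z)" if "c \<in> s ` ?X" for c
  proof -
    have "c = ennreal (enn2real c)" using that s(2) by auto
    then show ?thesis
      using precompact_kernel_scale[OF precompact_indicator[OF oc Z z Y fin E[of c]], of "enn2real c"] by simp
  qed
  have "precompact_kernel (\<lambda>z. \<Sum>c\<in>s ` ?X. c * indicator (?E c) z)"
    using precompact_kernel_sum[of "s ` ?X" "\<lambda>c z. c * indicator (?E c) z"] ds ps simple_functionD(1)[OF s(1)] by blast
  moreover have "order_image (\<lambda>z. s z * indicator (Z \<times> Y) z) \<subseteq> order_image (\<lambda>z. \<Sum>c\<in>s ` ?X. c * indicator (?E c) z)"
  proof (rule order_image_subset, use AE_space in eventually_elim, intro ballI nn_integral_cong)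
    fix x g y assume "x \<in> space M" "y \<in> space M"
    then have xy: "(x, y) \<in> ?X" by (simp add: space_pair_measure)
    have "s (x, y) * indicator (Z \<times> Y) (x, y) = (\<Sum>c\<in>s ` ?X. c * indicator (s -` {c} \<inter> ?X) (x, y)) * indicator (Z \<times> Y) (x, y)"
      by (subst simple_function_indicator_representation[OF s(1) xy]) simp
    then show "s (x, y) * indicator (Z \<times> Y) (x, y) * g y = (\<Sum>c\<in>s ` ?X. c * indicator (?E c) (x, y)) * g y"
      by (simp add: sum_distrib_right indicator_inter_arith mult.assoc)
  qed
  ultimately show ?thesis unfolding precompact_kernel_def using finitely_covered_mono by blast
qed

text \<open>Three truncations at once: simple functions below \<open>b\<close>, sets
  \<open>Y n\<close> of finite measure, and sets \<open>Z n\<close> on which a multiple of the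
  majorant \<open>w\<close> is at least 1. The truncated kernels increase to \<open>b\<close> over
  the support of \<open>w\<close>.\<close>

lemma precompact_dominated_kernel:
  assumes oc: "order_continuous_norm P" and dom: "dominated_kernel b" and fin: "\<And>z. b z < \<infinity>"
  shows "precompact_kernel b"
proof -
  have bm[measurable]: "b \<in> borel_measurable (M \<Otimes>\<^sub>M M)" using dom by (simp add: dominated_kernel_def)
  obtain w where w: "w \<in> P" "AE x in M. (\<integral>\<^sup>+ y. b (x, y) \<partial>M) \<le> modulus w x"
    using dom by (auto simp: dominated_kernel_def)
  obtain s where s: "\<And>i. simple_function (M \<Otimes>\<^sub>M M) (s i)" "incseq s" "\<And>i z. s i z < \<infinity>" "\<And>z. (SUP i. s i z) = b z"
    using borel_measurable_implies_simple_function_sequence'[OF bm] by (metis infinity_ennreal_def)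
  have [measurable]: "s i \<in> borel_measurable (M \<Otimes>\<^sub>M M)" for i using s(1) by (rule borel_measurable_simple_function)
  obtain Y :: "nat \<Rightarrow> 'a set" where Y: "range Y \<subseteq> sets M" "(\<Union>i. Y i) = space M" "\<And>i. emeasure M (Y i) \<noteq> \<infinity>" "incseq Y"
    using sigma_finite_incseq by blast
  have [measurable]: "Y i \<in> sets M" for i using Y(1) by blast
  define Z where "Z n = {x \<in> space M. 1 \<le> ennreal (real n) * modulus w x}" for n
  have Zm[measurable]: "Z n \<in> sets M" for n unfolding Z_def by measurable
  define W where "W = {x \<in> space M. modulus w x \<noteq> 0}"
  have Wm[measurable]: "W \<in> sets M" unfolding W_def by measurable
  have Zinc: "Z n \<subseteq> Z (Suc n)" for n
    unfolding Z_def by (auto elim!: order_trans intro!: mult_right_mono simp del: of_nat_Suc)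
  have ZW: "\<exists>n. x \<in> Z n" if "x \<in> W" for x
  proof -
    have pos: "cmod (rep w x) > 0" using that by (simp add: W_def modulus_def)
    obtain n where "1 < real n * cmod (rep w x)" using reals_Archimedean3[OF pos] by blast
    then have "1 \<le> ennreal (real n) * modulus w x"
      unfolding modulus_def by (subst ennreal_mult[symmetric]) auto
    then show ?thesis using that by (auto simp: Z_def W_def)
  qed
  have ZsubW: "Z n \<subseteq> W" for n by (auto simp: Z_def W_def)
  let ?X = "space M"
  \<comment> \<open>No \<open>Z n\<close> reaches a point where \<open>w\<close> vanishes, but for
    almost every such \<open>x\<close> the function \<open>b (x, y)\<close> of \<open>y\<close> is 0
    a.e., so the cut-off does not change the images.\<close>
  define b' where "b' z = b z * indicator (W \<times> ?X) z" for z
  define c where "c n z = s n z * indicator (Z n \<times> Y n) z" for n z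
  have cm[measurable]: "c n \<in> borel_measurable (M \<Otimes>\<^sub>M M)" for n unfolding c_def[abs_def] by measurable
  have b'm[measurable]: "b' \<in> borel_measurable (M \<Otimes>\<^sub>M M)" unfolding b'_def[abs_def] by measurable
  have cb: "c n z \<le> b' z" for n z
  proof -
    have "s n z \<le> b z" using s(4)[of z] SUP_upper[of n UNIV "\<lambda>i. s i z"] by simp
    moreover have "indicator (Z n \<times> Y n) z \<le> (indicator (W \<times> ?X) z :: ennreal)"
      using ZsubW[of n] Y(2) by (auto simp: indicator_def)
    ultimately show ?thesis unfolding c_def b'_def by (intro mult_mono) auto
  qed
  have cinc: "c n z \<le> c (Suc n) z" for n z
    unfolding c_def using s(2) Zinc[of n] Y(4)
    by (intro mult_mono) (cases z; auto simp: indicator_def incseq_Suc_iff le_fun_def)+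
  have clim: "(\<lambda>n. c n z) \<longlonglongrightarrow> b' z" for z
  proof (cases "z \<in> W \<times> ?X")
    case True
    obtain n1 where "fst z \<in> Z n1" using ZW True by (auto simp: mem_Times_iff)
    moreover obtain n2 where "snd z \<in> Y n2" using Y(2) True by (auto simp: mem_Times_iff)
    moreover have "Z n1 \<subseteq> Z n" "Y n2 \<subseteq> Y n" if "n \<ge> max n1 n2" for n
      using that lift_Suc_mono_le[of Z n1 n, OF Zinc] Y(4) by (auto simp: incseq_def)
    ultimately have "eventually (\<lambda>n. s n z = c n z) sequentially"
      unfolding eventually_sequentially c_def
      by (intro exI[of _ "max n1 n2"]) (auto simp: indicator_def mem_Times_iff subset_iff)
    moreover have "(\<lambda>n. s n z) \<longlonglongrightarrow> b z"
      using LIMSEQ_SUP[of "\<lambda>n. s n z"] s(2) s(4)[of z] by (cases z) (simp add: incseq_def le_fun_def)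
    ultimately show ?thesis using True by (auto simp: b'_def intro: Lim_transform_eventually)
  next
    case False
    then have "c n z = 0" "b' z = 0" for n using cb[of n z] by (auto simp: b'_def)
    then show ?thesis by simp
  qed
  have "precompact_kernel b'"
  proof (rule precompact_kernel_limit[OF oc, where c = c and r = "\<lambda>n z. b' z - c n z"])
    show "dominated_kernel b'" by (rule dominated_kernel_mono[OF dom]) (auto simp: b'_def indicator_def)
    have fin': "b' z < \<infinity>" for z using fin[of z] by (auto simp: b'_def indicator_def)
    show "b' z = c n z + (b' z - c n z)" for n z
      using cb[of n z] by (simp add: add_diff_inverse_ennreal)
    show "precompact_kernel (c n)" for n
      unfolding c_def[abs_def]
    proof (rule precompact_simple_kernel[OF oc s(1,3) Zm positive_cone_scaleR[OF w(1)]])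
      show "AE x in M. indicator (Z n) x \<le> modulus (real n *\<^sub>R w) x"
        using modulus_scaleR[of "real n" w] by eventually_elim (auto simp: Z_def indicator_def)
      show "emeasure M (Y n) < \<infinity>" using Y(3)[of n] by (simp add: less_top)
    qed auto
    show "b' z - c (Suc n) z \<le> b' z - c n z" for n z by (rule ennreal_minus_mono[OF order_refl cinc])
    show "(\<lambda>n. b' z - c n z) \<longlonglongrightarrow> 0" for z
      using tendsto_diff_ennreal[OF tendsto_const clim[of z], of "b' z"] fin'[of z] by simp
  qed measurable
  moreover have "order_image b \<subseteq> order_image b'"
  proof (rule order_image_subset)
    show "AE x in M. \<forall>g\<in>borel_measurable M. (\<integral>\<^sup>+ y. b (x, y) * g y \<partial>M) = (\<integral>\<^sup>+ y. b' (x, y) * g y \<partial>M)"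
      using w(2) AE_space
    proof eventually_elim
      case (elim x)
      have [measurable]: "(\<lambda>y. b (x, y)) \<in> borel_measurable M" using elim(2) by (intro measurable_Pair2[OF bm])
      show ?case
      proof (cases "modulus w x = 0")
        case True
        then have "AE y in M. b (x, y) = 0" using elim(1) by (simp add: nn_integral_0_iff_AE)
        then have "AE y in M. b (x, y) * g y = b' (x, y) * g y" for g
          by eventually_elim (simp add: b'_def)
        then show ?thesis by (auto intro: nn_integral_cong_AE)
      next
        case False
        then have "b (x, y) = b' (x, y)" if "y \<in> space M" for y using that elim(2) by (simp add: b'_def W_def)
        then show ?thesis by (auto intro!: nn_integral_cong)
      qed
    qed
  qed
  ultimately show ?thesis unfolding precompact_kernel_def using finitely_covered_mono by blast
qed

text \<open>With the weight \<open>u\<close> moved into the kernel, an \<open>f\<close> between 0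
  and \<open>u\<close> becomes the quotient \<open>f / u\<close> between 0 and 1, and the new kernel
  is dominated by \<open>T u\<close>. A complex \<open>f\<close> is split into four positive
  parts.\<close>

lemma kernel_operator_order_interval_precompact:
  assumes oc: "order_continuous_norm P" and k: "kernel_operator k T" and u: "u \<in> P" and e: "e > 0"
  shows "finitely_covered (T ` {f. AE x in M. modulus f x \<le> modulus u x}) e"
proof -
  let ?b0 = "\<lambda>z. enn2real (k z)"
  have bm[measurable]: "k \<in> borel_measurable (M \<Otimes>\<^sub>M M)" by (rule kernel_operator_measurable[OF k])
  have k': "kernel_operator (\<lambda>z. ennreal (?b0 z)) T"
    by (rule has_kernel_kernel_operator[OF kernel_operator_has_kernel[OF k] _ kernel_operator_clinear[OF k]]) simp
  define b where "b z = ennreal (?b0 z) * modulus u (snd z)" for z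
  have [measurable]: "b \<in> borel_measurable (M \<Otimes>\<^sub>M M)" unfolding b_def[abs_def] by measurable
  have "AE x in M. (\<integral>\<^sup>+ y. b (x, y) \<partial>M) \<le> modulus (T u) x"
    using kernel_operator_modulus[OF k' u] by eventually_elim (simp add: b_def)
  then have "dominated_kernel b"
    unfolding dominated_kernel_def using kernel_operator_positive[OF k u] by auto
  moreover have "b z < \<infinity>" for z
    by (simp add: b_def modulus_def ennreal_mult[symmetric])
  ultimately have pc: "precompact_kernel b" by (rule precompact_dominated_kernel[OF oc])
  let ?I = "order_image b"
  have TI: "T f \<in> ?I" if f: "f \<in> P" and le: "AE x in M. modulus f x \<le> modulus u x" for f
  proof -
    \<comment> \<open>The minimum bounds \<open>g\<close> at every point, not only off a null set.
      Where \<open>u\<close> vanishes, so does \<open>f\<close> a.e., and any value will do.\<close>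
    define g where "g y = min 1 (modulus f y / modulus u y)" for y
    have [measurable]: "g \<in> borel_measurable M" unfolding g_def[abs_def] by measurable
    have fg: "AE y in M. modulus f y = modulus u y * g y"
      using le
    proof eventually_elim
      case (elim y)
      show ?case
      proof (cases "modulus u y = 0")
        case False
        have "modulus u y * (modulus f y / modulus u y) = modulus f y"
          using False by (simp add: ennreal_times_divide modulus_def divide_ennreal flip: ennreal_mult)
        moreover have "modulus f y / modulus u y \<le> 1"
          using elim False by (simp add: modulus_def divide_ennreal)
        ultimately show ?thesis by (simp add: g_def min_def)
      qed (use elim in simp)
    qed
    have "AE x in M. modulus (T f) x = (\<integral>\<^sup>+ y. b (x, y) * g y \<partial>M)"
      using kernel_operator_modulus[OF k' f]
    proof eventually_elim
      case (elim x)
      also have "(\<integral>\<^sup>+ y. ennreal (?b0 (x, y)) * modulus f y \<partial>M) = (\<integral>\<^sup>+ y. b (x, y) * g y \<partial>M)"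
        by (intro nn_integral_cong_AE) (use fg in eventually_elim, simp add: b_def mult.assoc)
      finally show ?case .
    qed
    then show ?thesis by (intro order_imageI kernel_operator_positive[OF k f]) (auto simp: g_def)
  qed
  have lin: "T (x + y) = T x + T y" "T (c *\<^sub>C x) = c *\<^sub>C T x" for x y c
    using kernel_operator_clinear[OF k] by (auto simp: clinear_iff)
  define D where "D = {x + (- 1) *\<^sub>C y | x y. x \<in> ?I \<and> y \<in> ?I}"
  have D: "finitely_covered D (e/4 + e/4)"
    by (rule finitely_covered_plus[of ?I "e/4" "(*\<^sub>C) (- 1) ` ?I" "e/4"])
      (use pc e in \<open>auto simp: precompact_kernel_def D_def intro!: finitely_covered_scaleC\<close>)
  then have iD: "finitely_covered ((*\<^sub>C) \<i> ` D) (e/4 + e/4)" using e by (intro finitely_covered_scaleC) auto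
  have "finitely_covered (T ` {f. AE x in M. modulus f x \<le> modulus u x}) ((e/4 + e/4) + (e/4 + e/4))"
  proof (rule finitely_covered_plus[OF D iD])
    fix z assume "z \<in> T ` {f. AE x in M. modulus f x \<le> modulus u x}"
    then obtain f where f: "AE x in M. modulus f x \<le> modulus u x" "z = T f" by blast
    obtain f1 f2 f3 f4 where p: "f1 \<in> P" "f2 \<in> P" "f3 \<in> P" "f4 \<in> P" "f = f1 - f2 + \<i> *\<^sub>C (f3 - f4)"
      and le: "\<And>g. g \<in> {f1, f2, f3, f4} \<Longrightarrow> AE x in M. modulus g x \<le> modulus f x"
      using positive_decomposition[of f] by metis
    have le_u: "AE x in M. modulus g x \<le> modulus u x" if "g \<in> {f1, f2, f3, f4}" for g
      using le[OF that] f(1) by eventually_elim (rule order_trans)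
    have "f = (f1 + (- 1) *\<^sub>C f2) + \<i> *\<^sub>C (f3 + (- 1) *\<^sub>C f4)" by (simp add: p(5) flip: uminus_eq_scaleC)
    then have "z = (T f1 + (- 1) *\<^sub>C T f2) + \<i> *\<^sub>C (T f3 + (- 1) *\<^sub>C T f4)" by (simp only: f(2) lin)
    moreover have "T f1 + (- 1) *\<^sub>C T f2 \<in> D" "T f3 + (- 1) *\<^sub>C T f4 \<in> D"
      unfolding D_def using TI p le_u by blast+
    ultimately show "\<exists>x\<in>D. \<exists>y\<in>(*\<^sub>C) \<i> ` D. z = x + y" by blast
  qed
  then show ?thesis by simp
qed

section \<open>Semicompactness and the essential spectral radius\<close>

definition semicompact_upto :: "('l \<Rightarrow> 'l) \<Rightarrow> real \<Rightarrow> bool"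
  where "semicompact_upto T d \<longleftrightarrow> (\<exists>u\<in>P. \<forall>f\<in>P. norm f \<le> 1 \<longrightarrow>
    (\<exists>h\<in>P. norm h \<le> d \<and> (AE x in M. modulus (T f) x \<le> modulus u x + modulus h x)))"

text \<open>The moduli of the finitely many centres add up to the majorant \<open>u\<close>, and the
  difference to a suitable centre provides \<open>h\<close>.\<close>

lemma semicompact_upto_noncompactness:
  assumes T: "T \<in> bounded_ops" and less: "noncompactness T < d"
  shows "semicompact_upto T d"
proof -
  obtain F where F: "finite F" "T ` cball 0 1 \<subseteq> (\<Union>x\<in>F. cball x d)"
    using finitely_covered_noncompactness[OF bounded_ops_bounded_linear[OF T], of "d - noncompactness T"] less
    by (auto simp: finitely_covered_def)
  have "\<forall>f. \<exists>g\<in>P. (AE x in M. modulus g x = modulus f x) \<and> norm g = norm f"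
    using absolute_value by metis
  then obtain A where A: "\<And>f. A f \<in> P" "\<And>f. AE x in M. modulus (A f) x = modulus f x" "\<And>f. norm (A f) = norm f"
    by metis
  define u where "u = (\<Sum>x\<in>F. A x)"
  have uP: "u \<in> P" unfolding u_def by (intro positive_cone_sum A)
  show ?thesis
    unfolding semicompact_upto_def
  proof (rule bexI[OF _ uP], intro ballI impI)
    fix f assume f: "f \<in> P" "norm f \<le> 1"
    then have "T f \<in> T ` cball 0 1" by simp
    then obtain w where w: "w \<in> F" "dist w (T f) \<le> d" using F(2) by auto
    have "AE x in M. modulus (A w) x \<le> modulus u x"
      using modulus_sum[OF F(1), of A] A(1) unfolding u_def[symmetric]
      by (auto elim!: eventually_mono intro!: member_le_sum w F)
    moreover have "AE x in M. modulus (T f) x \<le> modulus w x + modulus (T f - w) x"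
      using modulus_add_le[of w "T f - w"] by simp
    ultimately have "AE x in M. modulus (T f) x \<le> modulus u x + modulus (A (T f - w)) x"
      using A(2)[of w] A(2)[of "T f - w"]
      by eventually_elim (metis add_right_mono order_trans)
    moreover have "norm (A (T f - w)) \<le> d" using w(2) by (simp add: A(3) dist_norm norm_minus_commute)
    ultimately show "\<exists>h\<in>P. norm h \<le> d \<and> (AE x in M. modulus (T f) x \<le> modulus u x + modulus h x)"
      using A(1) by blast
  qed
qed

text \<open>A Riesz decomposition for complex functions: \<open>f\<close> is multiplied by the
  measurable ratio of the modulus of \<open>u\<close> to the sum of both moduli. Where this sum is
  0, so is \<open>f\<close> a.e.\<close>

lemma split_below_sum:
  assumes le: "AE x in M. modulus f x \<le> modulus u x + modulus h x"
  obtains g where "AE x in M. modulus g x \<le> modulus u x" "AE x in M. modulus (f - g) x \<le> modulus h x"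
proof -
  define t where "t x = cmod (rep u x) / (cmod (rep u x) + cmod (rep h x))" for x
  have t: "0 \<le> t x" "t x \<le> 1" for x
    using divide_right_mono[of "cmod (rep u x)" "cmod (rep u x) + cmod (rep h x)" "cmod (rep u x) + cmod (rep h x)"]
      divide_self_if[of "cmod (rep u x) + cmod (rep h x)"] by (auto simp: t_def split: if_splits)
  have [measurable]: "t \<in> borel_measurable M" unfolding t_def[abs_def] by measurable
  have "(\<lambda>x. complex_of_real (t x) * rep f x) \<in> borel_measurable M" by measurable
  moreover have "AE x in M. cmod (complex_of_real (t x) * rep f x) \<le> cmod (rep f x)"
    using t by (simp add: norm_mult mult_left_le_one_le)
  ultimately obtain g where g: "AE x in M. rep g x = complex_of_real (t x) * rep f x" using solid by blast
  have le': "AE x in M. cmod (rep f x) \<le> cmod (rep u x) + cmod (rep h x)"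
    using le by eventually_elim (simp add: modulus_def flip: ennreal_plus)
  have *: "a / (a + b) * c \<le> a" if "0 \<le> a" "0 \<le> b" "c \<le> a + b" "0 \<le> c" for a b c :: real
  proof (cases "a + b = 0")
    case False
    then have "a / (a + b) * c \<le> a / (a + b) * (a + b)" using that by (intro mult_left_mono) auto
    then show ?thesis using False by simp
  qed (use that in simp)
  show ?thesis
  proof (rule that[of g])
    show "AE x in M. modulus g x \<le> modulus u x"
      using g le'
    proof eventually_elim
      case (elim x)
      have "t x * cmod (rep f x) \<le> cmod (rep u x)" unfolding t_def using elim(2) by (intro *) auto
      then show ?case using t[of x] by (simp add: modulus_def elim(1) norm_mult)
    qed
    show "AE x in M. modulus (f - g) x \<le> modulus h x"
      using rep_diff[of f g] g le'
    proof eventually_elim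
      case (elim x)
      show ?case
      proof (cases "cmod (rep u x) + cmod (rep h x) = 0")
        case True
        then have "rep f x = 0" using elim(3) by simp
        then show ?thesis using elim by (simp add: modulus_def)
      next
        case False
        have "rep (f - g) x = complex_of_real (1 - t x) * rep f x" using elim by (simp add: algebra_simps)
        moreover have "1 - t x = cmod (rep h x) / (cmod (rep h x) + cmod (rep u x))"
          using False by (simp add: t_def field_simps)
        moreover have "(1 - t x) * cmod (rep f x) \<le> cmod (rep h x)"
          unfolding calculation(2) using elim(3) by (intro *) auto
        ultimately show ?thesis
          using t[of x] by (simp only: modulus_def norm_mult norm_of_real) simp
      qed
    qed
  qed
qed

text \<open>\<open>U\<close> maps the unit ball into an order interval plus a ball of radius
  \<open>d\<close>. One more factor \<open>U\<close> makes the order interval precompact, so only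
  the ball contributes under \<open>U ^^ Suc n\<close>. For this reason at least one factor has to
  remain on the right.\<close>

lemma noncompactness_power_step:
  assumes oc: "order_continuous_norm P" and k: "kernel_operator k U" and sc: "semicompact_upto U d" and d: "0 \<le> d"
  shows "noncompactness (U ^^ Suc (Suc n)) \<le> d * noncompactness (U ^^ Suc n)"
proof (rule noncompactness_le)
  have U: "U \<in> bounded_ops" using k by (rule kernel_operator_bounded)
  let ?V = "U ^^ Suc n"
  have Vb: "?V \<in> bounded_ops" "bounded_linear ?V" "bounded_linear (U ^^ n)"
    using U bounded_ops_funpow bounded_ops_bounded_linear by blast+
  show "0 \<le> d * noncompactness ?V" using d noncompactness_nonneg[OF Vb(2)] by simp
  fix e :: real assume e: "e > 0"
  obtain u where u: "u \<in> P" "\<And>f. f \<in> P \<Longrightarrow> norm f \<le> 1 \<Longrightarrow>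
      \<exists>h\<in>P. norm h \<le> d \<and> (AE x in M. modulus (U f) x \<le> modulus u x + modulus h x)"
    using sc by (auto simp: semicompact_upto_def)
  let ?I = "{f. AE x in M. modulus f x \<le> modulus u x}"
  \<comment> \<open>Half of \<open>e\<close> is for the precompact part, half for the error
    \<open>d * e'\<close> on the ball; \<open>d + 1\<close> covers \<open>d = 0\<close>.\<close>
  define e' where "e' = e / (2 * (d + 1))"
  have e': "e' > 0" "d * e' \<le> e/2" using e d by (auto simp: e'_def field_simps)
  have "finitely_covered ((U ^^ n) ` U ` ?I) (e/2)"
    using kernel_operator_order_interval_precompact[OF oc k u(1)] e
    by (intro finitely_covered_bounded_linear_image[OF Vb(3)]) auto
  then have 1: "finitely_covered (?V ` ?I) (e/2)" by (simp add: image_image funpow_swap1)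
  have "finitely_covered (cball 0 d :: 'l set) d" unfolding finitely_covered_def by (intro exI[of _ "{0}"]) auto
  from finitely_covered_image[OF bounded_linear.linear[OF Vb(2)] this finitely_covered_noncompactness[OF Vb(2) e'(1)] d]
  have 2: "finitely_covered (?V ` cball 0 d) (d * (noncompactness ?V + e'))" .
  have "finitely_covered ((U ^^ Suc (Suc n)) ` cball 0 1) (e/2 + d * (noncompactness ?V + e'))"
  proof (rule finitely_covered_plus[OF 1 2])
    fix z assume "z \<in> (U ^^ Suc (Suc n)) ` cball 0 1"
    then obtain f where f: "norm f \<le> 1" "z = ?V (U f)" by (auto simp: funpow_swap1)
    obtain f0 where f0: "f0 \<in> P" "AE x in M. modulus f0 x = modulus f x" "norm f0 = norm f" by (rule absolute_value)
    obtain h where h: "norm h \<le> d" "AE x in M. modulus (U f0) x \<le> modulus u x + modulus h x"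
      using u(2)[OF f0(1)] f0(3) f(1) by auto
    have "AE x in M. modulus (U f) x \<le> modulus (U f0) x"
      using f0 by (intro kernel_operator_modulus_mono[OF k]) (auto elim: eventually_mono)
    then have "AE x in M. modulus (U f) x \<le> modulus u x + modulus h x" using h(2) by eventually_elim (rule order_trans)
    then obtain g where g: "AE x in M. modulus g x \<le> modulus u x" "AE x in M. modulus (U f - g) x \<le> modulus h x"
      by (rule split_below_sum)
    have "norm (U f - g) \<le> d" using norm_mono[OF g(2)] h(1) by simp
    moreover have "z = ?V g + ?V (U f - g)" using f(2) by (simp only: bounded_ops_diff[OF Vb(1)]) simp
    ultimately show "\<exists>x\<in>?V ` ?I. \<exists>y\<in>?V ` cball 0 d. z = x + y"
      using g(1) by (intro bexI[of _ "?V g"] bexI[of _ "?V (U f - g)"]) auto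
  qed
  then show "finitely_covered ((U ^^ Suc (Suc n)) ` cball 0 1) (d * noncompactness ?V + e)"
    by (rule finitely_covered_mono) (use e'(2) in \<open>simp_all add: algebra_simps\<close>)
qed

lemma kernel_operator_power: "kernel_operator k T \<Longrightarrow> \<exists>l. kernel_operator l (T ^^ Suc n)"
proof (induction n)
  case (Suc n)
  then obtain l where "kernel_operator l (T ^^ Suc n)" by blast
  from kernel_operator_compose[OF Suc.prems this] show ?case unfolding funpow.simps(2)[of "Suc n"] by blast
qed auto

text \<open>The ball measures of the powers of \<open>T ^^ N\<close> are bounded by a multiple of
  \<open>d ^ n\<close> with \<open>d < c ^ N\<close>, so a large power beats the factor 4 of the
  invertibility criterion.\<close>

theorem essential_spectral_radius_le_semicompact:
  assumes oc: "order_continuous_norm P" and k: "kernel_operator k T" and q: "0 \<le> q"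
    and sc: "\<And>c. q < c \<Longrightarrow> \<exists>N d. N \<ge> 1 \<and> 0 \<le> d \<and> d < c ^ N \<and> semicompact_upto (T ^^ N) d"
  shows "essential_spectral_radius T \<le> q"
proof (rule essential_spectral_radius_le_of_powers[OF kernel_operator_bounded[OF k] q])
  fix c assume c: "q < c"
  then obtain N d where N: "N \<ge> 1" "0 \<le> d" "d < c ^ N" "semicompact_upto (T ^^ N) d" using sc by blast
  let ?U = "T ^^ N"
  obtain l where l: "kernel_operator l ?U"
    using kernel_operator_power[OF k, of "N - 1"] N(1) by auto
  have nc: "noncompactness (?U ^^ Suc n) \<le> d ^ n * noncompactness ?U" for n
  proof (induction n)
    case (Suc n)
    have "noncompactness (?U ^^ Suc (Suc n)) \<le> d * noncompactness (?U ^^ Suc n)"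
      by (rule noncompactness_power_step[OF oc l N(4,2)])
    also have "\<dots> \<le> d * (d ^ n * noncompactness ?U)" by (intro mult_left_mono Suc N(2))
    finally show ?case by (simp only: power_Suc mult.assoc)
  qed simp
  have c0: "c \<noteq> 0" and cN: "c ^ N > 0" using c q by simp_all
  have "(\<lambda>n. 4 * noncompactness ?U * (d / c ^ N) ^ n) \<longlonglongrightarrow> 4 * noncompactness ?U * 0"
    using N(2,3) cN by (intro tendsto_intros) auto
  then have "eventually (\<lambda>n. 4 * noncompactness ?U * (d / c ^ N) ^ n < c ^ N) sequentially"
    using cN by (intro order_tendstoD) auto
  then obtain n where n: "4 * noncompactness ?U * (d / c ^ N) ^ n < c ^ N" by (auto simp: eventually_sequentially)
  have "4 * noncompactness (?U ^^ Suc n) \<le> 4 * (d ^ n * noncompactness ?U)" using nc by simp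
  also have "\<dots> = (4 * noncompactness ?U * (d / c ^ N) ^ n) * (c ^ N) ^ n"
    using c0 by (simp add: mult.assoc flip: power_mult_distrib)
  also have "\<dots> < c ^ N * (c ^ N) ^ n" using n cN by simp
  also have "\<dots> = c ^ (N * Suc n)" by (simp flip: power_mult power_add)
  finally have "4 * noncompactness (T ^^ (N * Suc n)) < c ^ (N * Suc n)" by (simp only: funpow_mult)
  then show "\<exists>n. 4 * noncompactness (T ^^ n) < c ^ n" by blast
qed

end

section \<open>Cyclic products\<close>

lemma op_product_Nil: "op_product A [] = id"
  and op_product_Cons: "op_product A (x # xs) = A x \<circ> op_product A xs"
  by (simp_all add: op_product_def)

lemma op_product_append: "op_product A (xs @ ys) = op_product A xs \<circ> op_product A ys"
  by (induction xs) (simp_all add: op_product_Nil op_product_Cons comp_assoc)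

text \<open>This takes a rotation of the factors out of the power, at the cost of one power.\<close>

lemma funpow_compose_swap: "(X \<circ> Y) ^^ Suc n = X \<circ> (Y \<circ> X) ^^ n \<circ> Y"
proof
  fix x show "((X \<circ> Y) ^^ Suc n) x = (X \<circ> (Y \<circ> X) ^^ n \<circ> Y) x"
    by (induction n) simp_all
qed

definition cyclic_succ :: "nat \<Rightarrow> nat \<Rightarrow> nat"
  where "cyclic_succ m j = (if j = m then 1 else Suc j)"

lemma cyclic_succ_bij: "m \<ge> 1 \<Longrightarrow> bij_betw (cyclic_succ m) {1..m} {1..m}"
  by (rule bij_betwI[where g = "\<lambda>j. if j = 1 then m else j - 1"]) (auto simp: cyclic_succ_def)

text \<open>A product of \<open>i\<close> factors that starts with \<open>A j\<close> and runs
  cyclically through the indices 1 to \<open>m\<close>. Length \<open>m\<close> gives the products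
  of the theorem; the other lengths occur in the induction on powers.\<close>

primrec cyclic_product :: "nat \<Rightarrow> (nat \<Rightarrow> 'b \<Rightarrow> 'b) \<Rightarrow> nat \<Rightarrow> nat \<Rightarrow> 'b \<Rightarrow> 'b" where
  "cyclic_product m A 0 j = id"
| "cyclic_product m A (Suc i) j = A j \<circ> cyclic_product m A i (cyclic_succ m j)"

lemma cyclic_product_eq: "cyclic_product m A i j = op_product A (map (\<lambda>k. (cyclic_succ m ^^ k) j) [0..<i])"
proof (induction i arbitrary: j)
  case (Suc i)
  have "[0..<Suc i] = 0 # map Suc [0..<i]" by (simp add: upt_conv_Cons map_Suc_upt)
  then show ?case by (simp add: Suc op_product_Cons comp_def funpow_swap1 del: upt_Suc)
qed (simp add: op_product_Nil)

lemma cyclic_succ_funpow: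
  "j \<in> {1..m} \<Longrightarrow> k < m \<Longrightarrow> (cyclic_succ m ^^ k) j = (if j + k \<le> m then j + k else j + k - m)"
  by (induction k) (auto simp: cyclic_succ_def)

lemma cyclic_product_full:
  assumes "j \<in> {1..m}"
  shows "cyclic_product m A m j = op_product A ([j..<m + 1] @ [1..<j])"
proof -
  have "map (\<lambda>k. (cyclic_succ m ^^ k) j) [0..<m] = [j..<m + 1] @ [1..<j]"
    using assms by (intro nth_equalityI) (auto simp: cyclic_succ_funpow nth_append)
  then show ?thesis by (simp add: cyclic_product_eq)
qed

lemma ex_power_less:
  assumes "0 < q" "q < (c::real)"
  shows "\<exists>n\<ge>1. K * q ^ n < c ^ n"
proof -
  have "(\<lambda>n. K * (q / c) ^ n) \<longlonglongrightarrow> K * 0" using assms by (intro tendsto_intros) auto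
  then have "eventually (\<lambda>n. K * (q / c) ^ n < 1) sequentially" by (intro order_tendstoD) auto
  then have "eventually (\<lambda>n. K * (q / c) ^ n < 1 \<and> n \<ge> 1) sequentially"
    using eventually_ge_at_top by (rule eventually_conj)
  then obtain n where n: "K * (q / c) ^ n < 1" "n \<ge> 1" by (auto simp: eventually_sequentially)
  then have "K * q ^ n < c ^ n" using assms by (simp add: power_divide field_simps)
  with n show ?thesis by blast
qed

section \<open>The order of operators and the stability of semicompactness\<close>

context banach_function_space
begin

definition op_le :: "('l \<Rightarrow> 'l) \<Rightarrow> ('l \<Rightarrow> 'l) \<Rightarrow> bool"
  where "op_le S T \<longleftrightarrow> (\<forall>f\<in>P. AE x in M. modulus (S f) x \<le> modulus (T f) x)"

lemma op_le_refl: "op_le S S"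
  by (simp add: op_le_def)

lemma op_le_trans [trans]:
  assumes "op_le R S" "op_le S T" shows "op_le R T"
  unfolding op_le_def
proof
  fix f assume f: "f \<in> P"
  show "AE x in M. modulus (R f) x \<le> modulus (T f) x"
    using assms[unfolded op_le_def, rule_format, OF f] by eventually_elim (rule order_trans)
qed

text \<open>The outer operators are compared at the positive element \<open>T f\<close>; then
  monotonicity of \<open>S'\<close>, which its kernel provides, compares the inner ones.\<close>

lemma op_le_compose:
  assumes S: "op_le S S'" and T: "op_le T T'" and k: "kernel_operator k S'"
    and P: "T ` P \<subseteq> P" "T' ` P \<subseteq> P"
  shows "op_le (S \<circ> T) (S' \<circ> T')"
  unfolding op_le_def
proof
  fix f assume f: "f \<in> P"
  have "AE x in M. modulus (S (T f)) x \<le> modulus (S' (T f)) x" using S P f by (auto simp: op_le_def)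
  moreover have "AE x in M. modulus (S' (T f)) x \<le> modulus (S' (T' f)) x"
    using T P f by (intro kernel_operator_modulus_mono[OF k]) (auto simp: op_le_def)
  ultimately show "AE x in M. modulus ((S \<circ> T) f) x \<le> modulus ((S' \<circ> T') f) x"
    by eventually_elim simp
qed

lemma op_le_power:
  assumes le: "op_le S T" and k: "kernel_operator k S" and l: "kernel_operator l T"
  shows "op_le (S ^^ n) (T ^^ n)"
proof (induction n)
  case (Suc n)
  have "(R ^^ n) ` P \<subseteq> P" if "R ` P \<subseteq> P" for R n using that by (induction n) auto
  then have "op_le (S \<circ> S ^^ n) (T \<circ> T ^^ n)"
    using kernel_operator_positive[OF k] kernel_operator_positive[OF l] by (intro op_le_compose[OF le Suc.IH l]) auto
  then show ?case by (simp only: funpow.simps)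
qed (simp add: op_le_refl)

lemma op_le_of_kernels:
  assumes k: "kernel_operator k S" and l: "kernel_operator l T" and le: "\<And>z. k z \<le> l z"
  shows "op_le S T"
  unfolding op_le_def
proof
  fix f assume f: "f \<in> P"
  show "AE x in M. modulus (S f) x \<le> modulus (T f) x"
    using kernel_operator_modulus[OF k f] kernel_operator_modulus[OF l f]
    by eventually_elim (simp add: nn_integral_mono mult_right_mono le)
qed

lemma semicompact_upto_op_le:
  assumes le: "op_le S T" and sc: "semicompact_upto T d"
  shows "semicompact_upto S d"
proof -
  obtain u where u: "u \<in> P" "\<And>f. f \<in> P \<Longrightarrow> norm f \<le> 1 \<Longrightarrow>
      \<exists>h\<in>P. norm h \<le> d \<and> (AE x in M. modulus (T f) x \<le> modulus u x + modulus h x)"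
    using sc by (auto simp: semicompact_upto_def)
  have "\<exists>h\<in>P. norm h \<le> d \<and> (AE x in M. modulus (S f) x \<le> modulus u x + modulus h x)"
    if f: "f \<in> P" "norm f \<le> 1" for f
  proof -
    obtain h where h: "h \<in> P" "norm h \<le> d" "AE x in M. modulus (T f) x \<le> modulus u x + modulus h x"
      using u(2)[OF f] by blast
    have "AE x in M. modulus (S f) x \<le> modulus u x + modulus h x"
      using le[unfolded op_le_def, rule_format, OF f(1)] h(3) by eventually_elim (rule order_trans)
    with h show ?thesis by blast
  qed
  with u(1) show ?thesis unfolding semicompact_upto_def by blast
qed

lemma semicompact_upto_mono: "semicompact_upto T d \<Longrightarrow> d \<le> d' \<Longrightarrow> semicompact_upto T d'"
  unfolding semicompact_upto_def by (meson order_trans)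

lemma semicompact_upto_compose_left:
  assumes k: "kernel_operator k S" and C: "\<And>f. norm (S f) \<le> C * norm f" "0 \<le> C" and sc: "semicompact_upto T d"
  shows "semicompact_upto (S \<circ> T) (C * d)"
proof -
  obtain u where u: "u \<in> P" "\<And>f. f \<in> P \<Longrightarrow> norm f \<le> 1 \<Longrightarrow>
      \<exists>h\<in>P. norm h \<le> d \<and> (AE x in M. modulus (T f) x \<le> modulus u x + modulus h x)"
    using sc by (auto simp: semicompact_upto_def)
  have "\<exists>h\<in>P. norm h \<le> C * d \<and> (AE x in M. modulus ((S \<circ> T) f) x \<le> modulus (S u) x + modulus h x)"
    if f: "f \<in> P" "norm f \<le> 1" for f
  proof -
    obtain h where h: "h \<in> P" "norm h \<le> d" "AE x in M. modulus (T f) x \<le> modulus u x + modulus h x"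
      using u(2)[OF f] by blast
    have "AE x in M. modulus (T f) x \<le> modulus (u + h) x"
      using h(3) modulus_add[OF u(1) h(1)] by eventually_elim simp
    from kernel_operator_modulus_mono[OF k positive_cone_add[OF u(1) h(1)] this]
    have "AE x in M. modulus (S (T f)) x \<le> modulus (S u + S h) x"
      by (simp add: clinear_add[OF kernel_operator_clinear[OF k]])
    then have "AE x in M. modulus ((S \<circ> T) f) x \<le> modulus (S u) x + modulus (S h) x"
      using modulus_add_le[of "S u" "S h"] by eventually_elim (simp add: order_trans)
    moreover have "norm (S h) \<le> C * d" using C(1)[of h] mult_left_mono[OF h(2) C(2)] by linarith
    ultimately show ?thesis using kernel_operator_positive[OF k h(1)] by blast
  qed
  with kernel_operator_positive[OF k u(1)] show ?thesis unfolding semicompact_upto_def by blast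
qed

text \<open>\<open>T\<close> maps the positive part of the unit ball into \<open>C\<close> times
  itself. Dividing by \<open>C\<close> returns to the ball, and both majorants are multiplied by
  \<open>C\<close> afterwards.\<close>

lemma semicompact_upto_compose_right:
  assumes S: "clinear S" and T: "T ` P \<subseteq> P" and C: "\<And>f. norm (T f) \<le> C * norm f" "0 < C" and sc: "semicompact_upto S d"
  shows "semicompact_upto (S \<circ> T) (C * d)"
proof -
  obtain u where u: "u \<in> P" "\<And>f. f \<in> P \<Longrightarrow> norm f \<le> 1 \<Longrightarrow>
      \<exists>h\<in>P. norm h \<le> d \<and> (AE x in M. modulus (S f) x \<le> modulus u x + modulus h x)"
    using sc by (auto simp: semicompact_upto_def)
  have "\<exists>h\<in>P. norm h \<le> C * d \<and> (AE x in M. modulus ((S \<circ> T) f) x \<le> modulus (C *\<^sub>R u) x + modulus h x)"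
    if f: "f \<in> P" "norm f \<le> 1" for f
  proof -
    let ?g = "(1 / C) *\<^sub>R T f"
    have g: "?g \<in> P" using T f C(2) by (intro positive_cone_scaleR) auto
    have "norm (T f) \<le> C" using C(1)[of f] mult_left_le[OF f(2), of C] C(2) by linarith
    then have "norm ?g \<le> 1" using C(2) by simp
    then obtain h where h: "h \<in> P" "norm h \<le> d" "AE x in M. modulus (S ?g) x \<le> modulus u x + modulus h x"
      using u(2)[OF g] by blast
    have "S (T f) = C *\<^sub>R S ?g"
      using clinear_scaleC[OF S, of "of_real (1 / C)" "T f"] C(2) by (simp only: scaleC_of_real) simp
    then have "AE x in M. modulus ((S \<circ> T) f) x \<le> modulus (C *\<^sub>R u) x + modulus (C *\<^sub>R h) x"
      using h(3) modulus_scaleR[of C u] modulus_scaleR[of C h] modulus_scaleR[of C "S ?g"]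
    proof (elim eventually_rev_mp, intro always_eventually allI impI)
      fix x assume *: "modulus (C *\<^sub>R S ?g) x = ennreal \<bar>C\<bar> * modulus (S ?g) x"
        "modulus (C *\<^sub>R h) x = ennreal \<bar>C\<bar> * modulus h x" "modulus (C *\<^sub>R u) x = ennreal \<bar>C\<bar> * modulus u x"
        "modulus (S ?g) x \<le> modulus u x + modulus h x"
      then show "modulus ((S \<circ> T) f) x \<le> modulus (C *\<^sub>R u) x + modulus (C *\<^sub>R h) x"
        using mult_left_mono[OF *(4), of "ennreal \<bar>C\<bar>"] \<open>S (T f) = C *\<^sub>R S ?g\<close> by (simp add: distrib_left)
    qed
    moreover have "norm (C *\<^sub>R h) \<le> C * d" using h(2) C(2) by simp
    moreover have "C *\<^sub>R h \<in> P" using h(1) C(2) by (simp add: positive_cone_scaleR)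
    ultimately show ?thesis by blast
  qed
  moreover have "C *\<^sub>R u \<in> P" using u(1) C(2) by (simp add: positive_cone_scaleR)
  ultimately show ?thesis unfolding semicompact_upto_def by blast
qed

text \<open>The means of the \<open>u j\<close> and of the \<open>h j\<close> are majorants for the
  arithmetic mean of the operators, and convexity of the norm keeps the bound \<open>d\<close>
  without loss.\<close>

lemma semicompact_upto_hadamard_mean:
  assumes J: "finite J" "J \<noteq> {}" and k: "\<And>j. j \<in> J \<Longrightarrow> kernel_operator (k j) (A j)"
    and sc: "\<And>j. j \<in> J \<Longrightarrow> semicompact_upto (A j) d"
  shows "semicompact_upto (hadamard_mean M rep J (\<lambda>_. 1 / real (card J)) A) d"
proof -
  let ?n = "real (card J)"
  have n: "?n > 0" using J by (simp add: card_gt_0_iff)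
  have "\<forall>j\<in>J. \<exists>u\<in>P. \<forall>f\<in>P. norm f \<le> 1 \<longrightarrow>
      (\<exists>h\<in>P. norm h \<le> d \<and> (AE x in M. modulus (A j f) x \<le> modulus u x + modulus h x))"
    using sc by (simp add: semicompact_upto_def)
  then obtain u where u: "\<And>j. j \<in> J \<Longrightarrow> u j \<in> P" "\<And>j f. j \<in> J \<Longrightarrow> f \<in> P \<Longrightarrow> norm f \<le> 1 \<Longrightarrow>
      \<exists>h\<in>P. norm h \<le> d \<and> (AE x in M. modulus (A j f) x \<le> modulus (u j) x + modulus h x)" by metis
  let ?S = "\<lambda>v. \<Sum>j\<in>J. (1 / ?n) *\<^sub>R v j"
  have SP: "(1 / ?n) *\<^sub>R v j \<in> P" if "\<And>j. j \<in> J \<Longrightarrow> v j \<in> P" "j \<in> J" for v j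
    using that by (intro positive_cone_scaleR) auto
  have mod_S: "AE x in M. modulus (?S v) x = (\<Sum>j\<in>J. ennreal (1 / ?n) * modulus (v j) x)"
    if v: "\<And>j. j \<in> J \<Longrightarrow> v j \<in> P" for v
  proof -
    have "AE x in M. \<forall>j\<in>J. modulus ((1 / ?n) *\<^sub>R v j) x = ennreal (1 / ?n) * modulus (v j) x"
      by (intro AE_finite_allI J) (use modulus_scaleR[of "1 / ?n"] in simp)
    moreover have "AE x in M. modulus (?S v) x = (\<Sum>j\<in>J. modulus ((1 / ?n) *\<^sub>R v j) x)"
      by (rule modulus_sum[OF J(1) SP[OF v]])
    ultimately show ?thesis by eventually_elim simp
  qed
  have "\<exists>h\<in>P. norm h \<le> d \<and>
      (AE x in M. modulus (hadamard_mean M rep J (\<lambda>_. 1 / ?n) A f) x \<le> modulus (?S u) x + modulus h x)"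
    if f: "f \<in> P" "norm f \<le> 1" for f
  proof -
    obtain h where h: "\<And>j. j \<in> J \<Longrightarrow> h j \<in> P" "\<And>j. j \<in> J \<Longrightarrow> norm (h j) \<le> d"
      "\<And>j. j \<in> J \<Longrightarrow> AE x in M. modulus (A j f) x \<le> modulus (u j) x + modulus (h j) x"
      using u(2)[OF _ f] by metis
    have "AE x in M. \<forall>j\<in>J. modulus (A j f) x \<le> modulus (u j) x + modulus (h j) x"
      using h(3) by (intro AE_finite_allI J)
    moreover have "AE x in M. modulus (hadamard_mean M rep J (\<lambda>_. 1 / ?n) A f) x \<le> modulus (?S (\<lambda>j. A j f)) x"
      using hadamard_mean_le_mean[OF J k f(1)] .
    moreover have "AE x in M. modulus (?S (\<lambda>j. A j f)) x = (\<Sum>j\<in>J. ennreal (1 / ?n) * modulus (A j f) x)"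
      using kernel_operator_positive[OF k f(1)] by (rule mod_S)
    moreover have "AE x in M. modulus (?S u) x = (\<Sum>j\<in>J. ennreal (1 / ?n) * modulus (u j) x)"
      using u(1) by (rule mod_S)
    moreover have "AE x in M. modulus (?S h) x = (\<Sum>j\<in>J. ennreal (1 / ?n) * modulus (h j) x)"
      using h(1) by (rule mod_S)
    ultimately have "AE x in M. modulus (hadamard_mean M rep J (\<lambda>_. 1 / ?n) A f) x \<le> modulus (?S u) x + modulus (?S h) x"
    proof eventually_elim
      case (elim x)
      have "(\<Sum>j\<in>J. ennreal (1 / ?n) * modulus (A j f) x) \<le> (\<Sum>j\<in>J. ennreal (1 / ?n) * (modulus (u j) x + modulus (h j) x))"
        using elim(1) by (intro sum_mono mult_left_mono) auto
      with elim show ?case by (simp add: distrib_left sum.distrib)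
    qed
    moreover have "?S h \<in> P" using SP[of h] h(1) by (intro positive_cone_sum) auto
    moreover have "norm (?S h) \<le> d"
    proof -
      have "norm (?S h) \<le> (\<Sum>j\<in>J. 1 / ?n * d)"
        using h(2) n by (intro order_trans[OF norm_sum] sum_mono) (auto intro!: divide_right_mono)
      also have "\<dots> = d" using n by simp
      finally show ?thesis .
    qed
    ultimately show ?thesis by blast
  qed
  moreover have "?S u \<in> P" using SP[of u] u(1) by (intro positive_cone_sum) auto
  ultimately show ?thesis unfolding semicompact_upto_def by blast
qed

section \<open>Products and powers of Hadamard means\<close>

text \<open>Hoelder's inequality in the intermediate variable \<open>w\<close>, for fixed
  \<open>x\<close> and \<open>y\<close>.\<close>

lemma hadamard_mean_compose_le:
  assumes J: "finite J" "J \<noteq> {}" and k: "\<And>j. j \<in> J \<Longrightarrow> kernel_operator (k j) (A j)"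
    and l: "\<And>j. j \<in> J \<Longrightarrow> kernel_operator (l j) (B j)"
  shows "op_le (hadamard_mean M rep J (\<lambda>_. 1 / real (card J)) A \<circ> hadamard_mean M rep J (\<lambda>_. 1 / real (card J)) B)
    (hadamard_mean M rep J (\<lambda>_. 1 / real (card J)) (\<lambda>j. A j \<circ> B j))"
  unfolding op_le_def
proof
  fix f assume f: "f \<in> P"
  note kc = kernel_operator_compose[OF k l]
  note km = kernel_operator_measurable[OF k] and lm = kernel_operator_measurable[OF l]
  let ?kl = "\<lambda>j z. \<integral>\<^sup>+ w. k j (fst z, w) * l j (w, snd z) \<partial>M"
  \<comment> \<open>An infinite composed kernel would count as 0 in the geometric mean. As
    \<open>A j\<close> after \<open>B j\<close> sends \<open>f\<close> to an a.e. finite function,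
    such values can occur only where \<open>f\<close> vanishes, up to null sets.\<close>
  have fin: "AE x in M. \<forall>j\<in>J. (\<integral>\<^sup>+ y. ?kl j (x, y) * modulus f y \<partial>M) < \<infinity>"
  proof (intro AE_finite_allI J)
    fix j assume j: "j \<in> J"
    show "AE x in M. (\<integral>\<^sup>+ y. ?kl j (x, y) * modulus f y \<partial>M) < \<infinity>"
      using kernel_operator_modulus[OF kc[OF j j] f]
      by eventually_elim (simp add: modulus_def, metis ennreal_less_top infinity_ennreal_def)
  qed
  let ?H = "\<lambda>A. hadamard_mean M rep J (\<lambda>_. 1 / real (card J)) A"
  have 1: "AE x in M. modulus ((?H A \<circ> ?H B) f) x =
      (\<integral>\<^sup>+ y. (\<integral>\<^sup>+ w. geometric_mean J (\<lambda>j. k j (x, w)) * geometric_mean J (\<lambda>j. l j (w, y)) \<partial>M) * modulus f y \<partial>M)"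
    using kernel_operator_modulus[OF kernel_operator_compose[OF kernel_operator_hadamard_mean[OF J k]
      kernel_operator_hadamard_mean[OF J l]] f] by simp
  have 2: "AE x in M. modulus (?H (\<lambda>j. A j \<circ> B j) f) x =
      (\<integral>\<^sup>+ y. geometric_mean J (\<lambda>j. ?kl j (x, y)) * modulus f y \<partial>M)"
    using kernel_operator_modulus[OF kernel_operator_hadamard_mean[OF J kc] f] .
  show "AE x in M. modulus ((?H A \<circ> ?H B) f) x \<le> modulus (?H (\<lambda>j. A j \<circ> B j) f) x"
    using 1 2 fin AE_space
  proof eventually_elim
    case (elim x)
    have kx[measurable]: "(\<lambda>w. k j (x, w)) \<in> borel_measurable M" if "j \<in> J" for j
      using elim(4) km[OF that] by (rule measurable_Pair2[rotated])
    have klx: "(\<lambda>y. ?kl j (x, y)) \<in> borel_measurable M" if "j \<in> J" for j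
      using elim(4) kernel_operator_measurable[OF kc[OF that that]] by (rule measurable_Pair2[rotated])
    have "AE y in M. \<forall>j\<in>J. ?kl j (x, y) * modulus f y \<noteq> \<infinity>"
    proof (intro AE_finite_allI J)
      fix j assume j: "j \<in> J"
      show "AE y in M. ?kl j (x, y) * modulus f y \<noteq> \<infinity>"
        using elim(3) j klx[OF j] by (intro nn_integral_PInf_AE) auto
    qed
    then have "AE y in M. (\<integral>\<^sup>+ w. geometric_mean J (\<lambda>j. k j (x, w)) * geometric_mean J (\<lambda>j. l j (w, y)) \<partial>M) * modulus f y
        \<le> geometric_mean J (\<lambda>j. ?kl j (x, y)) * modulus f y"
      using AE_space
    proof eventually_elim
      case (elim y)
      show ?case
      proof (cases "modulus f y = 0")
        case False
        have ly[measurable]: "(\<lambda>w. l j (w, y)) \<in> borel_measurable M" if "j \<in> J" for j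
          using elim(2) lm[OF that] by (rule measurable_Pair1[rotated])
        have "?kl j (x, y) < \<infinity>" if "j \<in> J" for j
          using elim(1) that False by (auto simp: ennreal_mult_eq_top_iff less_top)
        then have "(\<integral>\<^sup>+ w. geometric_mean J (\<lambda>j. k j (x, w) * l j (w, y)) \<partial>M) \<le> geometric_mean J (\<lambda>j. ?kl j (x, y))"
          using nn_integral_geometric_mean[OF J, of "\<lambda>j w. k j (x, w) * l j (w, y)" M] by auto
        then show ?thesis by (simp add: geometric_mean_mult mult_right_mono)
      qed simp
    qed
    then show ?case unfolding elim(1,2) by (rule nn_integral_mono_AE)
  qed
qed


text \<open>The product in the geometric mean is commutative, so relabelling does not change the
  kernel.\<close>

lemma op_le_hadamard_mean_permute:
  assumes J: "finite J" "J \<noteq> {}" and k: "\<And>j. j \<in> J \<Longrightarrow> kernel_operator (k j) (A j)" and bij: "bij_betw \<sigma> J J"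
  shows "op_le (hadamard_mean M rep J (\<lambda>_. 1 / real (card J)) A)
    (hadamard_mean M rep J (\<lambda>_. 1 / real (card J)) (\<lambda>j. A (\<sigma> j)))"
proof (rule op_le_of_kernels[OF kernel_operator_hadamard_mean[OF J k] kernel_operator_hadamard_mean[OF J]])
  show "kernel_operator (k (\<sigma> j)) (A (\<sigma> j))" if "j \<in> J" for j using bij_betwE[OF bij] that by (intro k) auto
  show "geometric_mean J (\<lambda>j. k j z) \<le> geometric_mean J (\<lambda>j. k (\<sigma> j) z)" for z
    unfolding geometric_mean_def
    by (subst prod.reindex_bij_betw[OF bij, of "\<lambda>j. enn2real (k j z) powr (1 / real (card J))"]) simp
qed auto

lemma kernel_operator_cyclic_product:
  assumes k: "\<And>j. j \<in> {1..m} \<Longrightarrow> \<exists>k. kernel_operator k (A j)" and j: "j \<in> {1..m}"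
  shows "\<exists>k. kernel_operator k (cyclic_product m A (Suc i) j)"
  using j
proof (induction i arbitrary: j)
  case 0
  then show ?case using k by simp
next
  case (Suc i)
  have "cyclic_succ m j \<in> {1..m}" using Suc.prems by (auto simp: cyclic_succ_def)
  then obtain l where l: "kernel_operator l (cyclic_product m A (Suc i) (cyclic_succ m j))" using Suc.IH by blast
  obtain k' where "kernel_operator k' (A j)" using k Suc.prems by blast
  from kernel_operator_compose[OF this l] show ?case
    unfolding cyclic_product.simps(2)[of m A "Suc i" j] by blast
qed

text \<open>Before the next mean is multiplied on the left, the mean of the products is relabelled
  by the cyclic successor. Hoelder's inequality then joins \<open>A j\<close> to the product that
  starts at the successor of \<open>j\<close>.\<close>

lemma hadamard_mean_power_le_cyclic:
  assumes m: "m \<ge> 1" and k: "\<And>j. j \<in> {1..m} \<Longrightarrow> \<exists>k. kernel_operator k (A j)"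
  shows "op_le (hadamard_mean M rep {1..m} (\<lambda>_. 1 / real m) A ^^ Suc i)
    (hadamard_mean M rep {1..m} (\<lambda>_. 1 / real m) (cyclic_product m A (Suc i)))"
proof (induction i)
  case 0
  have "cyclic_product m A (Suc 0) = A" by (simp add: fun_eq_iff)
  then show ?case by (simp add: op_le_refl)
next
  case (Suc i)
  let ?H = "hadamard_mean M rep {1..m} (\<lambda>_. 1 / real m)"
  let ?C = "cyclic_product m A (Suc i)" and ?\<sigma> = "cyclic_succ m"
  have J: "finite {1..m}" "{1..m} \<noteq> {}" and card: "card {1..m} = m" using m by auto
  have \<sigma>: "?\<sigma> j \<in> {1..m}" if "j \<in> {1..m}" for j using that by (auto simp: cyclic_succ_def)
  obtain a where a: "\<And>j. j \<in> {1..m} \<Longrightarrow> kernel_operator (a j) (A j)" using k by metis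
  obtain c where c: "\<And>j. j \<in> {1..m} \<Longrightarrow> kernel_operator (c j) (?C j)"
  proof -
    have "\<forall>j\<in>{1..m}. \<exists>c. kernel_operator c (?C j)"
      using kernel_operator_cyclic_product[where m = m and A = A and i = i, OF k] by blast
    from bchoice[OF this] that show ?thesis by blast
  qed
  have c': "kernel_operator (c (?\<sigma> j)) (?C (?\<sigma> j))" if "j \<in> {1..m}" for j using c \<sigma> that by blast
  note kA = kernel_operator_hadamard_mean[where k = a and A = A, OF J a, unfolded card]
    note kC' = kernel_operator_hadamard_mean[where k = "\<lambda>j. c (?\<sigma> j)" and A = "\<lambda>j. ?C (?\<sigma> j)", OF J c', unfolded card]
  obtain h where kH: "kernel_operator h (?H A ^^ Suc i)" using kernel_operator_power[OF kA] by blast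
  have pos: "T ` P \<subseteq> P" if "kernel_operator l T" for l T using kernel_operator_positive[OF that] by blast
  have "op_le (?H A \<circ> ?H A ^^ Suc i) (?H A \<circ> ?H (\<lambda>j. ?C (?\<sigma> j)))"
    using op_le_trans[OF Suc op_le_hadamard_mean_permute[where k = c and A = ?C, OF J c cyclic_succ_bij[OF m], unfolded card]]
    by (rule op_le_compose[OF op_le_refl _ kA pos[OF kH] pos[OF kC']])
  also have "op_le (?H A \<circ> ?H (\<lambda>j. ?C (?\<sigma> j))) (?H (\<lambda>j. A j \<circ> ?C (?\<sigma> j)))"
    by (rule hadamard_mean_compose_le[where k = a and A = A and l = "\<lambda>j. c (?\<sigma> j)" and B = "\<lambda>j. ?C (?\<sigma> j)",
          OF J a c', unfolded card])
  finally have "op_le (?H A \<circ> ?H A ^^ Suc i) (?H (\<lambda>j. A j \<circ> ?C (?\<sigma> j)))" .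
  moreover have "cyclic_product m A (Suc (Suc i)) = (\<lambda>j. A j \<circ> ?C (?\<sigma> j))" by (rule ext) (rule cyclic_product.simps)
  ultimately show ?case by (simp only: funpow.simps(2)[of "Suc i"])
qed

lemma hadamard_mean_power_le:
  assumes J: "finite J" "J \<noteq> {}" and k: "\<And>j. j \<in> J \<Longrightarrow> kernel_operator (k j) (A j)"
  shows "op_le (hadamard_mean M rep J (\<lambda>_. 1 / real (card J)) A ^^ Suc n)
    (hadamard_mean M rep J (\<lambda>_. 1 / real (card J)) (\<lambda>j. A j ^^ Suc n))"
proof (induction n)
  case 0
  show ?case by (simp add: op_le_refl)
next
  case (Suc n)
  let ?H = "hadamard_mean M rep J (\<lambda>_. 1 / real (card J))"
  have "\<exists>l. kernel_operator l (A j ^^ Suc n)" if "j \<in> J" for j using kernel_operator_power[OF k[OF that]] .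
  then obtain l where l: "\<And>j. j \<in> J \<Longrightarrow> kernel_operator (l j) (A j ^^ Suc n)" by metis
  note kA = kernel_operator_hadamard_mean[where k = k and A = A, OF J k]
  obtain h where kH: "kernel_operator h (?H A ^^ Suc n)" using kernel_operator_power[OF kA] by blast
  have pos: "T ` P \<subseteq> P" if "kernel_operator l T" for l T using kernel_operator_positive[OF that] by blast
  have "op_le (?H A \<circ> ?H A ^^ Suc n) (?H A \<circ> ?H (\<lambda>j. A j ^^ Suc n))"
    by (rule op_le_compose[OF op_le_refl Suc kA pos[OF kH]
          pos[OF kernel_operator_hadamard_mean[where k = l and A = "\<lambda>j. A j ^^ Suc n", OF J l]]])
  also have "op_le (?H A \<circ> ?H (\<lambda>j. A j ^^ Suc n)) (?H (\<lambda>j. A j \<circ> A j ^^ Suc n))"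
    by (rule hadamard_mean_compose_le[where k = k and A = A and l = l and B = "\<lambda>j. A j ^^ Suc n", OF J k l])
  finally show ?case by (simp only: funpow.simps(2)[of "Suc n"])
qed

lemma kernel_operator_op_product:
  assumes "\<And>j. j \<in> set js \<Longrightarrow> \<exists>k. kernel_operator k (A j)" "js \<noteq> []"
  shows "\<exists>k. kernel_operator k (op_product A js)"
  using assms
proof (induction js)
  case (Cons j js)
  obtain k where k: "kernel_operator k (A j)" using Cons.prems by force
  show ?case
  proof (cases "js = []")
    case True
    then show ?thesis using k by (auto simp: op_product_Cons op_product_Nil)
  next
    case False
    then obtain l where "kernel_operator l (op_product A js)" using Cons by force
    from kernel_operator_compose[OF k this] show ?thesis unfolding op_product_Cons by blast
  qed
qed simp

section \<open>Growth of powers and the comparison of the radii\<close>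

lemma bounded_ops_bound:
  assumes "T \<in> bounded_ops"
  obtains C where "C > 0" "\<And>f. norm (T f) \<le> C * norm f"
  using bounded_linear.pos_bounded[OF bounded_ops_bounded_linear[OF assms]] by (metis mult.commute)

text \<open>The outer factors cost only their norms, and the offset between \<open>Suc n\<close> and
  \<open>n\<close> changes only a constant; so the rate \<open>q\<close> survives the
  rotation.\<close>

lemma semicompact_powers_rotate:
  assumes X: "kernel_operator k X" and Y: "Y \<in> bounded_ops" "Y ` P \<subseteq> P" and YX: "Y \<circ> X \<in> bounded_ops"
    and sc: "\<And>n. semicompact_upto ((Y \<circ> X) ^^ n) (C * q ^ n)"
  shows "\<exists>C'. \<forall>n. semicompact_upto ((X \<circ> Y) ^^ Suc n) (C' * q ^ n)"
proof -
  obtain a where a: "a > 0" "\<And>f. norm (X f) \<le> a * norm f" using bounded_ops_bound[OF kernel_operator_bounded[OF X]] by blast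
  obtain b where b: "b > 0" "\<And>f. norm (Y f) \<le> b * norm f" using bounded_ops_bound[OF Y(1)] by blast
  have "semicompact_upto ((X \<circ> Y) ^^ Suc n) (b * (a * (C * q ^ n)))" for n
    unfolding funpow_compose_swap
  proof (rule semicompact_upto_compose_right[OF _ Y(2) b(2,1)])
    have "X \<circ> (Y \<circ> X) ^^ n \<in> bounded_ops"
      using kernel_operator_bounded[OF X] bounded_ops_funpow[OF YX] by (rule bounded_ops_intros)
    then show "clinear (X \<circ> (Y \<circ> X) ^^ n)" by (simp add: bounded_ops_def)
    show "semicompact_upto (X \<circ> (Y \<circ> X) ^^ n) (a * (C * q ^ n))"
      using a by (intro semicompact_upto_compose_left[OF X _ _ sc]) auto
  qed
  then have "semicompact_upto ((X \<circ> Y) ^^ Suc n) ((b * a * C) * q ^ n)" for n by (simp only: mult.assoc)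
  then show ?thesis by blast
qed

lemma semicompact_powers:
  assumes "T \<in> bounded_ops" "essential_spectral_radius T < q"
  shows "\<exists>C\<ge>0. \<forall>n. semicompact_upto (T ^^ n) (C * q ^ n)"
proof -
  obtain C where C: "\<And>n. noncompactness (T ^^ n) \<le> C * q ^ n" using noncompactness_power_bound[OF assms] by blast
  have q: "q > 0" using essential_spectral_radius_nonneg[OF assms(1)] assms(2) by linarith
  \<comment> \<open>Adding 1 to the constant makes the bound strict, as
    \<open>semicompact_upto_noncompactness\<close> demands.\<close>
  have "semicompact_upto (T ^^ n) ((\<bar>C\<bar> + 1) * q ^ n)" for n
  proof (rule semicompact_upto_noncompactness[OF bounded_ops_funpow[OF assms(1)]])
    have "C * q ^ n < (\<bar>C\<bar> + 1) * q ^ n" using q by (intro mult_strict_right_mono) auto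
    then show "noncompactness (T ^^ n) < (\<bar>C\<bar> + 1) * q ^ n" using C[of n] by linarith
  qed
  then show ?thesis by (intro exI[of _ "\<bar>C\<bar> + 1"]) auto
qed

text \<open>Both inequalities follow one pattern: take any \<open>q\<close> above the larger radius,
  turn it into semicompactness of powers, transfer this to the mean on the left, and return to the
  radius.\<close>

theorem essential_spectral_radius_cyclic_means:
  assumes oc: "order_continuous_norm P" and m: "m \<ge> 1"
    and A: "\<And>j. j \<in> {1..m} \<Longrightarrow> positive_kernel_operator M rep (A j)"
    and Pj: "\<And>j. j \<in> {1..m} \<Longrightarrow> Q j = op_product A ([j..<m + 1] @ [1..<j])"
  shows "essential_spectral_radius (hadamard_mean M rep {1..m} (\<lambda>_. 1 / real m) A)
      \<le> essential_spectral_radius (hadamard_mean M rep {1..m} (\<lambda>_. 1 / real m) Q) powr (1 / real m)"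
    and "essential_spectral_radius (hadamard_mean M rep {1..m} (\<lambda>_. 1 / real m) Q)
      \<le> essential_spectral_radius (op_product A [1..<m + 1])"
proof -
  let ?H = "hadamard_mean M rep {1..m} (\<lambda>_. 1 / real m)"
  let ?\<rho> = essential_spectral_radius
  have J: "finite {1..m}" "{1..m} \<noteq> {}" and card: "card {1..m} = m" using m by auto
  have exA: "\<exists>k. kernel_operator k (A j)" if "j \<in> {1..m}" for j
    using positive_kernel_operator_kernel[OF A[OF that]] by blast
  then obtain a where a: "\<And>j. j \<in> {1..m} \<Longrightarrow> kernel_operator (a j) (A j)" by metis
  have QC: "Q j = cyclic_product m A m j" if "j \<in> {1..m}" for j using Pj[OF that] cyclic_product_full[OF that, of A] by simp
  have m': "m = Suc (m - 1)" using m by simp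
  have "\<exists>k. kernel_operator k (Q j)" if "j \<in> {1..m}" for j
    using kernel_operator_cyclic_product[where m = m and A = A and i = "m - 1", OF exA that] m' QC[OF that] by simp
  then obtain c where c: "\<And>j. j \<in> {1..m} \<Longrightarrow> kernel_operator (c j) (Q j)" by metis
  note kA = kernel_operator_hadamard_mean[where k = a and A = A, OF J a, unfolded card]
  note kQ = kernel_operator_hadamard_mean[where k = c and A = Q, OF J c, unfolded card]
  \<comment> \<open>The mean depends only on the operators with index from 1 to \<open>m\<close>,
    and there both families agree.\<close>
  have "?H (cyclic_product m A m) = ?H Q"
    unfolding hadamard_mean_def using QC by (simp cong: conj_cong)
  then have power_le: "op_le (?H A ^^ m) (?H Q)"
    using hadamard_mean_power_le_cyclic[where A = A and i = "m - 1", OF m exA] m' by simp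
  obtain k where kp: "kernel_operator k (?H A ^^ m)" using kernel_operator_power[where n = "m - 1", OF kA] m' by metis
  have nonneg: "0 \<le> ?\<rho> (?H Q)" "0 \<le> ?\<rho> (?H A)"
    using kernel_operator_bounded kA kQ by (auto intro: essential_spectral_radius_nonneg)
  have "?\<rho> (?H A) ^ m \<le> ?\<rho> (?H Q)"
  proof (rule dense_ge)
    fix q assume q: "?\<rho> (?H Q) < q"
    then have q0: "q > 0" using nonneg by linarith
    obtain C where C: "C \<ge> 0" "\<And>n. semicompact_upto (?H Q ^^ n) (C * q ^ n)"
      using semicompact_powers[OF kernel_operator_bounded[OF kQ] q] by blast
    have "?\<rho> (?H A) \<le> root m q"
    proof (rule essential_spectral_radius_le_semicompact[OF oc kA])
      show "0 \<le> root m q" using q0 by (simp add: real_root_ge_zero)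
      fix d assume "root m q < d"
      then have "root m q ^ m < d ^ m" using m q0 by (intro power_strict_mono) auto
      then have "q < d ^ m" using m q0 by simp
      \<comment> \<open>Only powers divisible by \<open>m\<close> are compared; this suffices
        because the criterion asks for a single power.\<close>
      then obtain n where n: "n \<ge> 1" "C * q ^ n < (d ^ m) ^ n" using ex_power_less[OF q0] by blast
      have "op_le ((?H A ^^ m) ^^ n) (?H Q ^^ n)" by (rule op_le_power[OF power_le kp kQ])
      then have "semicompact_upto (?H A ^^ (m * n)) (C * q ^ n)"
        unfolding funpow_mult by (rule semicompact_upto_op_le[OF _ C(2)])
      then show "\<exists>N d'. N \<ge> 1 \<and> 0 \<le> d' \<and> d' < d ^ N \<and> semicompact_upto (?H A ^^ N) d'"
        using n m C(1) q0 by (intro exI[of _ "m * n"] exI[of _ "C * q ^ n"]) (auto simp: power_mult)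
    qed
    then have "?\<rho> (?H A) ^ m \<le> root m q ^ m" using nonneg by (intro power_mono)
    then show "?\<rho> (?H A) ^ m \<le> q" using m q0 by simp
  qed
  then have "(?\<rho> (?H A) ^ m) powr (1 / real m) \<le> ?\<rho> (?H Q) powr (1 / real m)" using nonneg by (intro powr_mono2) auto
  moreover have "(?\<rho> (?H A) ^ m) powr (1 / real m) = ?\<rho> (?H A)"
  proof (cases "?\<rho> (?H A) = 0")
    case False
    then show ?thesis using nonneg m by (simp add: powr_powr flip: powr_realpow)
  qed (use m in simp)
  ultimately show "?\<rho> (?H A) \<le> ?\<rho> (?H Q) powr (1 / real m)" by simp
  show "?\<rho> (?H Q) \<le> ?\<rho> (op_product A [1..<m + 1])"
  proof (rule dense_ge)
    fix q assume q: "?\<rho> (op_product A [1..<m + 1]) < q"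
    have Q1: "op_product A [1..<m + 1] \<in> bounded_ops"
      using kernel_operator_bounded[OF c[of 1]] Pj[of 1] m by simp
    then have q0: "q > 0" using essential_spectral_radius_nonneg[OF Q1] q by linarith
    obtain C where C: "\<And>n. semicompact_upto (op_product A [1..<m + 1] ^^ n) (C * q ^ n)"
      using semicompact_powers[OF Q1 q] by blast
    have "\<exists>K. \<forall>n. semicompact_upto (Q j ^^ Suc n) (K * q ^ n)" if j: "j \<in> {1..m}" for j
    proof -
      let ?X = "op_product A [j..<m + 1]" and ?Y = "op_product A [1..<j]"
      have "[1..<m + 1] = [1..<j] @ [j..<m + 1]" using j upt_add_eq_append[of 1 j "m + 1 - j"] by simp
      then have YX: "op_product A [1..<m + 1] = ?Y \<circ> ?X" by (simp only: op_product_append)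
      have "\<exists>k. kernel_operator k ?X" using j exA by (intro kernel_operator_op_product) auto
      then obtain k where X: "kernel_operator k ?X" by blast
      have "?Y \<in> bounded_ops \<and> ?Y ` P \<subseteq> P"
      proof (cases "j = 1")
        case True
        then show ?thesis by (simp add: op_product_Nil bounded_ops_intros)
      next
        case False
        then have "\<exists>k. kernel_operator k ?Y" using j exA by (intro kernel_operator_op_product) auto
        then show ?thesis using kernel_operator_bounded kernel_operator_positive by blast
      qed
      then show ?thesis
        using semicompact_powers_rotate[OF X _ _ _ C[unfolded YX]] Q1 unfolding Pj[OF j] op_product_append YX by blast
    qed
    then obtain K where K: "\<And>j n. j \<in> {1..m} \<Longrightarrow> semicompact_upto (Q j ^^ Suc n) (K j * q ^ n)" by metis
    \<comment> \<open>The Hadamard mean needs one bound for all \<open>j\<close>, and the sum of the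
      constants provides it.\<close>
    define K' where "K' = (\<Sum>j\<in>{1..m}. \<bar>K j\<bar>)"
    have K'0: "0 \<le> K'" unfolding K'_def by (intro sum_nonneg) auto
    have sc: "semicompact_upto (?H Q ^^ Suc n) (K' * q ^ n)" for n
    proof -
      have "\<exists>l. kernel_operator l (Q j ^^ Suc n)" if "j \<in> {1..m}" for j using kernel_operator_power[OF c[OF that]] .
      then obtain l where l: "\<And>j. j \<in> {1..m} \<Longrightarrow> kernel_operator (l j) (Q j ^^ Suc n)" by metis
      have "semicompact_upto (Q j ^^ Suc n) (K' * q ^ n)" if j: "j \<in> {1..m}" for j
      proof (rule semicompact_upto_mono[OF K[OF j]])
        have "\<bar>K j\<bar> \<le> K'" unfolding K'_def using j by (intro member_le_sum) auto
        then show "K j * q ^ n \<le> K' * q ^ n" using q0 by (intro mult_right_mono) auto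
      qed
      from semicompact_upto_hadamard_mean[where k = l and A = "\<lambda>j. Q j ^^ Suc n", OF J l this]
      have "semicompact_upto (?H (\<lambda>j. Q j ^^ Suc n)) (K' * q ^ n)" by (simp add: card)
      with hadamard_mean_power_le[where k = c and A = Q, OF J c, unfolded card] show ?thesis by (rule semicompact_upto_op_le)
    qed
    show "?\<rho> (?H Q) \<le> q"
    proof (rule essential_spectral_radius_le_semicompact[OF oc kQ])
      show "0 \<le> q" using q0 by simp
      fix d assume d: "q < d"
      then have d0: "d > 0" using q0 by simp
      \<comment> \<open>Dividing the constant by \<open>d\<close> absorbs the offset between the
        power \<open>Suc n\<close> and the rate \<open>q ^ n\<close>.\<close>
      obtain n where n: "K' / d * q ^ n < d ^ n" using ex_power_less[OF q0 d] by blast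
      then have "K' * q ^ n < d ^ Suc n" using d0 by (simp add: field_simps)
      then show "\<exists>N d'. N \<ge> 1 \<and> 0 \<le> d' \<and> d' < d ^ N \<and> semicompact_upto (?H Q ^^ N) d'"
        using sc[of n] K'0 q0 by (intro exI[of _ "Suc n"] exI[of _ "K' * q ^ n"]) auto
    qed
  qed
qed

end

theorem theorem3p2:
  fixes M :: "'a measure"
    and rep :: "'l::complex_banach \<Rightarrow> 'a \<Rightarrow> complex"
    and m :: nat
    and A P :: "nat \<Rightarrow> 'l \<Rightarrow> 'l"
  assumes "banach_function_space M rep"
    and "order_continuous_norm (positive_cone M rep)"
    and "order_continuous_norm (dual_cone (positive_cone M rep))"
    and "m \<ge> 1"
    and "\<And>j. j \<in> {1..m} \<Longrightarrow> positive_kernel_operator M rep (A j)"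
    and "\<And>j. j \<in> {1..m} \<Longrightarrow> P j = op_product A ([j..<m + 1] @ [1..<j])"
  shows "essential_spectral_radius (hadamard_mean M rep {1..m} (\<lambda>_. 1 / real m) A)
      \<le> essential_spectral_radius (hadamard_mean M rep {1..m} (\<lambda>_. 1 / real m) P)
           powr (1 / real m)
    \<and> essential_spectral_radius (hadamard_mean M rep {1..m} (\<lambda>_. 1 / real m) P)
           powr (1 / real m)
      \<le> essential_spectral_radius (op_product A [1..<m + 1]) powr (1 / real m)"
proof -
  interpret banach_function_space M rep by fact
  have J: "finite {1..m}" "{1..m} \<noteq> {}" "card {1..m} = m" using assms(4) by auto
  have "\<exists>k. kernel_operator k (P j)" if "j \<in> {1..m}" for j
    unfolding assms(6)[OF that]
  proof (rule kernel_operator_op_product)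
    fix i assume "i \<in> set ([j..<m + 1] @ [1..<j])"
    then have "i \<in> {1..m}" using that by auto
    then show "\<exists>k. kernel_operator k (A i)" using positive_kernel_operator_kernel assms(5) by blast
  qed (use that in auto)
  then obtain k where "\<And>j. j \<in> {1..m} \<Longrightarrow> kernel_operator (k j) (P j)" by metis
  then have "kernel_operator (\<lambda>z. geometric_mean {1..m} (\<lambda>j. k j z)) (hadamard_mean M rep {1..m} (\<lambda>_. 1 / real m) P)"
    using kernel_operator_hadamard_mean[OF J(1,2), of k P] by (simp add: J(3))
  \<comment> \<open>Monotonicity of \<open>powr\<close> in the base, applied to the second
    inequality, requires the smaller base to be nonnegative.\<close>
  then have "0 \<le> essential_spectral_radius (hadamard_mean M rep {1..m} (\<lambda>_. 1 / real m) P)"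
    by (intro essential_spectral_radius_nonneg kernel_operator_bounded)
  then show ?thesis
    using essential_spectral_radius_cyclic_means[OF assms(2,4,5,6)] by (auto intro: powr_mono2)
qed

end
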